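(* The following hold. 1) Let $1<p\leq 2$ and $s\geq p$ ($s<\infty$). Then for every $f\in L^p(\mathbb{T})$, $$\|f\|_{L^p(\mathbb{T})}\leq 2^{1-\frac{1}{s}}\sin\frac{\pi}{2p}\,\bigl\|\left(|P_+f|^s+|P_-f|^s\right)^{\frac 1s}\bigr\|_{L^p(\mathbb{T})},$$ and this inequality is sharp, i.e. the constant $2^{1-\frac1s}\sin\frac{\pi}{2p}$ cannot be replaced by any smaller constant (for the given $p,s$). 2) Let $p\geq 4$ (with $p<\infty$) and $s\geq \frac{p}{p-1}$ ($s<\infty$). Then for every $f\in L^p(\mathbb{T})$, $$\|f\|_{L^p(\mathbb{T})}\leq 2^{1-\frac{1}{s}}\cos\frac{\pi}{2p}\,\bigl\|\left(|P_+f|^s+|P_-f|^s\right)^{\frac 1s}\bigr\|_{L^p(\mathbb{T})}.$$ 3) Let $s\in(0,1]$ and $1<p<+\infty$. Then for every $f\in L^p(\mathbb{T})$, $$\|f\|_{L^p(\mathbb{T})}\leq \bigl\|\left(|P_+f|^s+|P_-f|^s\right)^{\frac 1s}\bigr\|_{L^p(\mathbb{T})}.$$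
   Context: $\mathbb{T}=\{z\in\mathbb{C}:|z|=1\}$ is the unit circle. $L^p(\mathbb{T})$ is the Lebesgue space of complex-valued $p$-integrable functions on $\mathbb{T}$, with norm $\|f\|_{L^p(\mathbb{T})}=\left(\int_{\mathbb{T}}|f(\zeta)|^p\frac{|d\zeta|}{2\pi}\right)^{1/p}$. For $f\in L^p(\mathbb{T})$ with Fourier coefficients $\hat f(n)=\frac{1}{2\pi}\int_0^{2\pi}f(e^{it})e^{-int}\,dt$, $n\in\mathbb{Z}$, so that $f(\zeta)=\sum_{n=-\infty}^{+\infty}\hat f(n)\zeta^n$, the Riesz (analytic) projection is $P_+f(\zeta)=\sum_{n=0}^{+\infty}\hat f(n)\zeta^n$. By the classical theorem of M. Riesz, $P_+$ is a bounded operator on $L^p(\mathbb{T})$ for $1<p<\infty$. The co-analytic projection is $P_-=I-P_+$, where $I$ is the identity operator. *)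

theory Defs
  imports "HOL-Probability.Probability"
begin

text \<open>The measure \<open>|d\<zeta>| / (2\<pi>)\<close> on the Borel sets of the unit circle.\<close>

definition circle_measure :: "complex measure" where
  "circle_measure = distr (uniform_measure lborel {0..2*pi}) (restrict_space borel (sphere 0 1)) cis"

text \<open>Elements of \<open>L\<^sup>p\<close> are represented by functions rather than by classes modulo null sets.
  Values off the unit circle are irrelevant.\<close>

definition Lp_circle :: "real \<Rightarrow> (complex \<Rightarrow> complex) set" where
  "Lp_circle p = {f \<in> borel_measurable circle_measure.
     integrable circle_measure (\<lambda>\<zeta>. norm (f \<zeta>) powr p)}"

definition Lp_norm :: "real \<Rightarrow> (complex \<Rightarrow> 'a::real_normed_vector) \<Rightarrow> real" where
  "Lp_norm p f = (\<integral>\<zeta>. norm (f \<zeta>) powr p \<partial>circle_measure) powr (1 / p)"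

definition fourier_coeff :: "(complex \<Rightarrow> complex) \<Rightarrow> int \<Rightarrow> complex" where
  "fourier_coeff f n =
     1 / (2 * of_real pi) * (LBINT t:{0..2*pi}. f (cis t) * exp (- \<i> * of_int n * of_real t))"

text \<open>The series \<open>\<Sum>n\<ge>0. fourier_coeff f n * \<zeta>^n\<close> is summed in the norm of \<open>L\<^sup>p\<close>. Its sum is unique
  only up to null sets, so a representative is chosen. For \<open>1 < p < \<infinity>\<close> and \<open>f\<close> in \<open>L\<^sup>p\<close> it exists
  by M. Riesz' theorem; for other arguments the value is unspecified.\<close>

definition riesz_plus :: "real \<Rightarrow> (complex \<Rightarrow> complex) \<Rightarrow> complex \<Rightarrow> complex" where
  "riesz_plus p f = (SOME g. g \<in> Lp_circle p \<and>
     (\<lambda>N. Lp_norm p (\<lambda>\<zeta>. g \<zeta> - (\<Sum>n<N. fourier_coeff f (int n) * \<zeta> ^ n))) \<longlonglongrightarrow> 0)"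

definition riesz_minus :: "real \<Rightarrow> (complex \<Rightarrow> complex) \<Rightarrow> complex \<Rightarrow> complex" where
  "riesz_minus p f = (\<lambda>\<zeta>. f \<zeta> - riesz_plus p f \<zeta>)"

lemma measurable_cis_circle [measurable]:
  "cis \<in> measurable borel (restrict_space borel (sphere 0 1))"
  by (rule measurable_restrict_space2)
     (auto intro!: borel_measurable_continuous_onI continuous_intros simp: norm_cis)

lemma integral_circle_measure:
  fixes f :: "complex \<Rightarrow> 'a::euclidean_space"
  assumes "f \<in> borel_measurable circle_measure"
  shows "(\<integral>\<zeta>. f \<zeta> \<partial>circle_measure) = (1 / (2 * pi)) *\<^sub>R (LBINT t:{0..2*pi}. f (cis t))"
proof -
  have m: "f \<in> borel_measurable (restrict_space borel (sphere 0 1))"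
    using assms by (simp add: circle_measure_def measurable_distr_eq1)
  have c: "cis \<in> measurable (uniform_measure lborel {0..2*pi}) (restrict_space borel (sphere 0 1))"
    using measurable_cis_circle by (simp add: measurable_def)
  have mc: "(\<lambda>t. f (cis t)) \<in> borel_measurable lborel"
    using measurable_compose[OF measurable_cis_circle m] by simp
  have u: "uniform_measure lborel {0..2*pi} =
      density lborel (\<lambda>t. ennreal (indicator {0..2*pi} t / (2 * pi)))"
    unfolding uniform_measure_def
    by (intro arg_cong[where f = "density lborel"] ext)
       (auto simp: indicator_def divide_ennreal_def simp flip: divide_ennreal ennreal_1)
  have "(\<integral>\<zeta>. f \<zeta> \<partial>circle_measure) = (\<integral>t. f (cis t) \<partial>uniform_measure lborel {0..2*pi})"
    unfolding circle_measure_def by (rule integral_distr[OF c m])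
  also have "\<dots> = (\<integral>t. (indicator {0..2*pi} t / (2 * pi)) *\<^sub>R f (cis t) \<partial>lborel)"
    unfolding u by (rule integral_density[OF mc]) auto
  also have "\<dots> = (\<integral>t. (1 / (2 * pi)) *\<^sub>R (indicator {0..2*pi} t *\<^sub>R f (cis t)) \<partial>lborel)"
    by (simp add: field_simps)
  also have "\<dots> = (1 / (2 * pi)) *\<^sub>R (LBINT t:{0..2*pi}. f (cis t))"
    unfolding set_lebesgue_integral_def by (rule integral_scaleR_right)
  finally show ?thesis .
qed

lemma space_circle_measure: "space circle_measure = sphere 0 1"
  by (simp add: circle_measure_def space_restrict_space)

lemma prob_space_circle_measure: "prob_space circle_measure"
proof -
  interpret U: prob_space "uniform_measure lborel {0..2*pi}"
    by (rule prob_space_uniform_measure) auto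
  show ?thesis unfolding circle_measure_def
    by (rule U.prob_space_distr) (use measurable_cis_circle in \<open>simp add: measurable_def\<close>)
qed

end

theory Submission
  imports Defs "HOL-Complex_Analysis.Complex_Analysis"
begin

text \<open>
  For a trigonometric polynomial write \<open>f = F + cnj G\<close> on the circle, with polynomials \<open>F\<close>, \<open>G\<close> and
  \<open>G 0 = 0\<close>. Power means reduce the first two inequalities to the smallest admissible exponent
  \<open>s\<close>. There a pointwise inequality
  \<open>|z + cnj w| powr p \<le> K (|z| powr s + |w| powr s) powr (p / s) - D U (z w)\<close> holds, with
  \<open>U u = |u| powr (p / 2) * g |Arg u|\<close> subharmonic. Since \<open>F G\<close> vanishes at \<open>0\<close>, the mean of \<open>U (F G)\<close> is nonnegative and the term drops out on integration.
  A cruder inequality of the same kind gives M. Riesz' theorem, hence the existence of the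
  projections and the passage to the limit from trigonometric polynomials. Sharpness is tested on
  \<open>f = h - cnj h\<close> for \<open>h = ((1 + r z) / (1 - r z)) powr (1 / p)\<close> as \<open>r\<close> tends to \<open>1\<close>, whose
  boundary values have argument close to \<open>\<plusminus>\<pi> / (2 p)\<close>.
\<close>

section \<open>Inequalities for trigonometric and hyperbolic functions\<close>

text \<open>With \<open>N = |z w|\<close> and \<open>|z| / |w| = exp (2 * x)\<close>, dividing by a
  power of \<open>N\<close> turns the pointwise inequality into one on a strip of points
  \<open>(x, y)\<close>, where \<open>y\<close> is half the argument of \<open>- (z * w)\<close> for
  \<open>p \<le> 2\<close> and of \<open>z * w\<close> for \<open>p > 2\<close>. Equality holds at
  \<open>x = 0\<close>, \<open>y = pi / (2 * p)\<close>. Contact there fixes the constants: equality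
  of the values gives the main constant, and equality of the derivatives in \<open>y\<close> gives
  the coefficient \<open>D\<close>. For \<open>p \<le> 2\<close> this is also where the test
  functions live: with \<open>z = h\<close> and \<open>w = - h\<close> the number
  \<open>- (z * w) = h^2\<close> has argument close to \<open>pi / p\<close> in absolute value. The
  only rival of this point is the end \<open>x = \<infinity>\<close> of the strip, that is,
  \<open>w = 0\<close>. The shape of \<open>U\<close> is dictated by subharmonicity. The function
  \<open>|u|^a * cos (a * t)\<close> has an admissible kink on the negative axis as long as
  \<open>a \<le> 1\<close>; for larger exponents \<open>- cos (b * t)\<close> is used instead and
  frozen once it reaches its maximum \<open>1\<close>. Sharp constants do not survive quasi-norm
  estimates, so the limit from trigonometric polynomials is taken inside the integral by dominated
  convergence.\<close>

lemma sin_mult_cos_less: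
  fixes n y :: real
  assumes "0 < n" "n < 1" "0 < y" "y < pi"
  shows "sin (n * y) * cos y < n * sin y * cos (n * y)"
proof -
  define g where "g t = n * sin t * cos (n * t) - sin (n * t) * cos t" for t
  have "g 0 < g y"
  proof (rule DERIV_pos_imp_increasing_open[OF assms(3)])
    fix t assume t: "0 < t" "t < y"
    have "(g has_real_derivative (1 - n\<^sup>2) * sin t * sin (n * t)) (at t)"
      unfolding g_def by (auto intro!: derivative_eq_intros simp: power2_eq_square algebra_simps)
    moreover have "n * t < pi" using t assms mult_strict_mono[of n 1 t pi] by simp
    then have "(1 - n\<^sup>2) * sin t * sin (n * t) > 0"
      using t assms by (auto intro!: mult_pos_pos sin_gt_zero simp: power_less_one_iff)
    ultimately show "\<exists>d. (g has_real_derivative d) (at t) \<and> 0 < d" by blast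
  qed (auto simp: g_def intro!: continuous_intros)
  then show ?thesis by (simp add: g_def)
qed

text \<open>Differentiating the difference of the two sides leaves a single product with the factor
  \<open>1 - n^2\<close>. Read as \<open>tanh (n * x) / tanh x > n\<close>, against
  \<open>tan (n * y) / tan y < n\<close> on \<open>(0, pi / 2)\<close> from the lemma before, it is
  what makes the critical point equations on the strip contradictory.\<close>

lemma sinh_mult_cosh_less:
  fixes n x :: real
  assumes "0 < n" "n < 1" "0 < x"
  shows "n * sinh x * cosh (n * x) < sinh (n * x) * cosh x"
proof -
  define g where "g t = sinh (n * t) * cosh t - n * sinh t * cosh (n * t)" for t
  have "g 0 < g x"
  proof (rule DERIV_pos_imp_increasing_open[OF assms(3)])
    fix t assume t: "0 < t" "t < x"
    have "(g has_real_derivative (1 - n\<^sup>2) * sinh t * sinh (n * t)) (at t)"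
      unfolding g_def by (auto intro!: derivative_eq_intros simp: power2_eq_square algebra_simps)
    moreover have "(1 - n\<^sup>2) * sinh t * sinh (n * t) > 0"
      using t assms by (auto intro!: mult_pos_pos simp: power_less_one_iff)
    ultimately show "\<exists>d. (g has_real_derivative d) (at t) \<and> 0 < d" by blast
  qed (auto simp: g_def intro!: continuous_intros)
  then show ?thesis by (simp add: g_def)
qed

text \<open>Both sides agree at \<open>0\<close> and \<open>1/2\<close>; the left one is convex, the right one concave.\<close>

lemma powr_le_cos:
  fixes y :: real
  assumes "0 \<le> y" "y \<le> 1/2"
  shows "2 powr (- y) \<le> cos (pi * y / 2)"
proof -
  define l where "l y = 1 - (2 - sqrt 2) * y" for y :: real
  have "2 powr (- y) \<le> l y"
  proof -
    have "convex_on UNIV (\<lambda>y::real. exp (- (ln 2 * y)))"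
      by (rule f''_ge0_imp_convex[where f' = "\<lambda>y. - ln 2 * exp (- (ln 2 * y))" and f'' = "\<lambda>y. (ln 2)\<^sup>2 * exp (- (ln 2 * y))"])
         (auto intro!: derivative_eq_intros simp: power2_eq_square)
    from convex_onD[OF this, of "2 * y" 0 "1/2"] 
    have "2 powr (- y) \<le> (1 - 2 * y) + 2 * y * 2 powr (-1/2)"
      using assms by (simp add: powr_def mult.commute)
    also have "2 powr (-1/2) = sqrt 2 / 2" for y :: real
      by (simp add: powr_minus_divide powr_half_sqrt real_div_sqrt field_simps)
    finally show ?thesis by (simp add: l_def algebra_simps)
  qed
  also have "l y \<le> cos (pi * y / 2)"
  proof -
    have "convex_on {0..1/2} (\<lambda>y::real. - cos (pi * y / 2))"
    proof (rule f''_ge0_imp_convex[where f' = "\<lambda>y. pi / 2 * sin (pi * y / 2)" and f'' = "\<lambda>y. (pi/2)\<^sup>2 * cos (pi * y / 2)"])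
      fix x :: real assume "x \<in> {0..1/2}"
      then show "(pi/2)\<^sup>2 * cos (pi * x / 2) \<ge> 0"
        using mult_left_mono[of x "1/2" pi] by (auto intro!: mult_nonneg_nonneg cos_ge_zero intro: order_trans[of _ 0])
    qed (auto intro!: derivative_eq_intros simp: power2_eq_square)
    from convex_onD[OF this, of "2 * y" 0 "1/2"] 
    show ?thesis using assms by (simp add: l_def cos_45 algebra_simps)
  qed
  finally show ?thesis .
qed

text \<open>This is the pointwise inequality with \<open>w = 0\<close>, equivalently the end
  \<open>x = \<infinity>\<close> of the strip. It is \<open>powr_le_cos\<close> at
  \<open>1 - 1 / p\<close>, which is at most \<open>1/2\<close> because
  \<open>p \<le> 2\<close>.\<close>

lemma one_le_sin_powr:
  fixes p :: real
  assumes "1 < p" "p \<le> 2"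
  shows "1 \<le> 2 powr (p - 1) * sin (pi / (2 * p)) powr p"
proof -
  have "2 powr (- (1 - 1 / p)) \<le> cos (pi * (1 - 1 / p) / 2)"
    using assms by (intro powr_le_cos) (auto simp: field_simps)
  also have "pi * (1 - 1 / p) / 2 = pi / 2 - pi / (2 * p)" using assms by (simp add: field_simps)
  also have "cos (pi / 2 - pi / (2 * p)) = sin (pi / (2 * p))" by (simp add: cos_diff)
  finally have "(2 powr (- (1 - 1 / p))) powr p \<le> sin (pi / (2 * p)) powr p" using assms by (intro powr_mono2) auto
  also have "(2 powr (- (1 - 1 / p))) powr p = 2 powr (- (1 - 1 / p) * p)" by (simp add: powr_powr)
  also have "- (1 - 1 / p) * p = 1 - p" using assms by (simp add: field_simps)
  finally have "2 powr (p - 1) * 2 powr (1 - p) \<le> 2 powr (p - 1) * sin (pi / (2 * p)) powr p" by simp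
  then show ?thesis by (simp flip: powr_add)
qed

text \<open>The analogue for large \<open>p\<close>: \<open>powr_le_cos\<close> at
  \<open>1 / p\<close>.\<close>

lemma one_le_cos_powr:
  fixes p :: real
  assumes "2 \<le> p"
  shows "1 \<le> 2 * cos (pi / (2 * p)) powr p"
proof -
  have "2 powr (- (1 / p)) \<le> cos (pi * (1 / p) / 2)"
    using assms by (intro powr_le_cos) (auto simp: field_simps)
  also have "pi * (1 / p) / 2 = pi / (2 * p)" by simp
  finally have "(2 powr (- (1 / p))) powr p \<le> cos (pi / (2 * p)) powr p" using assms by (intro powr_mono2) auto
  also have "(2 powr (- (1 / p))) powr p = 2 powr (- 1)" using assms by (simp add: powr_powr)
  finally show ?thesis by (simp add: powr_minus)
qed

text \<open>A second derivative test on one side, for the edge \<open>y = 0\<close> of the strip;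
  the bound \<open>b\<close> keeps the comparison point inside the strip.\<close>

lemma critical_point_decreasing:
  fixes f f' :: "real \<Rightarrow> real"
  assumes f: "\<And>y. (f has_real_derivative f' y) (at y)" and f': "f' 0 = 0" "(f' has_real_derivative l) (at 0)" "l < 0"
    and b: "b > 0"
  obtains h where "0 < h" "h \<le> b" "f h < f 0"
proof -
  obtain d where d: "d > 0" "\<And>h. h > 0 \<Longrightarrow> h < d \<Longrightarrow> f' h < 0"
    using DERIV_neg_dec_right[OF f'(2,3)] f'(1) by auto
  define h where "h = min (d / 2) b"
  have h: "h > 0" "h < d" "h \<le> b" using d b by (auto simp: h_def)
  have "f h < f 0"
  proof (rule DERIV_neg_imp_decreasing_open[OF h(1), where f = f])
    fix t assume "0 < t" "t < h"
    then show "\<exists>y. (f has_real_derivative y) (at t) \<and> y < 0" using f d(2)[of t] h by auto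
  next
    show "continuous_on {0..h} f"
      by (intro continuous_at_imp_continuous_on ballI DERIV_isCont[OF f])
  qed
  then show thesis using that h by blast
qed

lemma DERIV_pos_less_left:
  fixes f :: "real \<Rightarrow> real"
  assumes "(f has_real_derivative l) (at y)" "l > 0" "b > 0"
  obtains h where "0 < h" "h \<le> b" "f (y - h) < f y"
proof -
  obtain d where "d > 0" "\<And>h. h > 0 \<Longrightarrow> h < d \<Longrightarrow> f (y - h) < f y"
    using DERIV_pos_inc_left[OF assms(1,2)] by auto
  then show thesis using that[of "min (d / 2) b"] assms(3) by auto
qed

text \<open>The growth \<open>exp (p * x)\<close> is split off explicitly, so that quotients by
  \<open>cosh (p * x)\<close> or \<open>cosh (q * x) powr (p - 1)\<close> keep a majorant with a
  limit as \<open>x\<close> tends to infinity.\<close>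

lemma powr_half_le_cosh:
  fixes x p A :: real
  assumes "p > 0" "0 \<le> A" "A \<le> (cosh x)\<^sup>2"
  shows "A powr (p / 2) \<le> exp (p * x) * (1 + exp (- 2 * x)) powr p * 2 powr (- p)"
proof -
  have "A powr (p / 2) \<le> ((cosh x)\<^sup>2) powr (p / 2)" using assms by (intro powr_mono2) auto
  also have "\<dots> = cosh x powr p" by (simp add: powr_powr flip: powr_numeral)
  also have "cosh x = exp x * (1 + exp (- 2 * x)) / 2"
    by (simp add: cosh_def field_simps flip: exp_add)
  also have "(exp x * (1 + exp (- 2 * x)) / 2) powr p = exp (p * x) * (1 + exp (- 2 * x)) powr p * 2 powr (- p)"
    by (simp add: powr_mult powr_divide powr_minus_divide exp_powr_real mult.commute)
  finally show ?thesis .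
qed

text \<open>A violation at \<open>(x0, y0)\<close> makes the noncompact strip harmless: for large
  \<open>x\<close> the majorant \<open>\<tau> x\<close> lies below \<open>f x0 y0\<close>, evenness
  leaves only \<open>x \<ge> 0\<close>, and what remains is a compact rectangle containing
  \<open>(|x0|, y0)\<close>.\<close>

lemma even_strip_attains_max:
  fixes f :: "real \<Rightarrow> real \<Rightarrow> real"
  assumes cont: "continuous_on (UNIV \<times> {0..Y}) (\<lambda>(x, y). f x y)"
    and even: "\<And>x y. f (- x) y = f x y"
    and tail: "\<And>x y. 0 \<le> x \<Longrightarrow> y \<in> {0..Y} \<Longrightarrow> f x y \<le> \<tau> x" "(\<tau> \<longlongrightarrow> t) at_top" "t \<le> s"
    and big: "f x0 y0 > s" "y0 \<in> {0..Y}"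
  obtains x y where "0 \<le> x" "y \<in> {0..Y}" "f x y > s" "\<And>x' y'. y' \<in> {0..Y} \<Longrightarrow> f x' y' \<le> f x y"
proof -
  have "eventually (\<lambda>x. \<tau> x < f x0 y0) at_top"
    using tail(2,3) big by (intro order_tendstoD(2)[OF tail(2)]) auto
  then obtain X0 where X0: "\<And>x. x \<ge> X0 \<Longrightarrow> \<tau> x < f x0 y0"
    by (auto simp: eventually_at_top_linorder)
  define X where "X = max X0 \<bar>x0\<bar>"
  let ?K = "{0..X} \<times> {0..Y}"
  have mem: "(\<bar>x0\<bar>, y0) \<in> ?K" using big by (auto simp: X_def)
  have "compact ?K" by (intro compact_Times compact_Icc)
  moreover have "continuous_on ?K (\<lambda>(x, y). f x y)"
    by (rule continuous_on_subset[OF cont]) auto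
  ultimately obtain m where m: "m \<in> ?K" "\<And>z. z \<in> ?K \<Longrightarrow> (\<lambda>(x, y). f x y) z \<le> (\<lambda>(x, y). f x y) m"
    using continuous_attains_sup[of ?K "\<lambda>(x, y). f x y"] mem by blast
  obtain x y where xy: "m = (x, y)" by (cases m)
  have fabs: "f \<bar>x'\<bar> y' = f x' y'" for x' y' using even[of x' y'] by (simp add: abs_if)
  have le: "f x0 y0 \<le> f x y" using m(2)[OF mem] by (simp add: xy fabs)
  show thesis
  proof
    show "0 \<le> x" "y \<in> {0..Y}" using m(1) by (auto simp: xy)
    show "f x y > s" using le big by simp
    fix x' y' assume y': "y' \<in> {0..Y}"
    show "f x' y' \<le> f x y"
    proof (cases "\<bar>x'\<bar> \<le> X")
      case True
      then show ?thesis using m(2)[of "(\<bar>x'\<bar>, y')"] y' by (simp add: xy fabs)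
    next
      case False
      have "f x' y' \<le> \<tau> \<bar>x'\<bar>" using tail(1)[of "\<bar>x'\<bar>" y'] y' by (simp add: fabs)
      also have "\<dots> < f x0 y0" using X0 False by (auto simp: X_def)
      finally show ?thesis using le by simp
    qed
  qed
qed

section \<open>The strip inequality for \<open>1 < p < 2\<close>\<close>

lemma sin_ratio_mono:
  fixes n a b :: real
  assumes n: "0 < n" "n < 1" and ab: "0 < a" "a \<le> b" "b \<le> pi"
  shows "sin (n * a) * sin b \<le> sin (n * b) * sin a"
proof (cases "b = pi")
  \<comment> \<open>The cross-multiplied form admits \<open>b = pi\<close>, which occurs as
    \<open>2 * y\<close> at the edge \<open>y = pi / 2\<close>.\<close>
  case True
  have "n * pi < pi" using n by simp
  then show ?thesis using True ab n by (auto intro!: mult_nonneg_nonneg sin_ge_zero)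
next
  case False
  have "sin (n * a) / sin a \<le> sin (n * b) / sin b"
  proof (rule DERIV_nonneg_imp_nondecreasing[OF ab(2)])
    fix t assume t: "a \<le> t" "t \<le> b"
    then have t': "0 < t" "t < pi" using ab False by auto
    then have [simp]: "sin t > 0" "sin t \<noteq> 0" using sin_gt_zero by force+
    have "((\<lambda>t. sin (n * t) / sin t) has_real_derivative
        (n * sin t * cos (n * t) - sin (n * t) * cos t) / (sin t)\<^sup>2) (at t)"
      by (auto intro!: derivative_eq_intros simp: power2_eq_square algebra_simps)
    moreover have "(n * sin t * cos (n * t) - sin (n * t) * cos t) / (sin t)\<^sup>2 \<ge> 0"
      using sin_mult_cos_less[OF n t'] by simp
    ultimately show "\<exists>d. ((\<lambda>t. sin (n * t) / sin t) has_real_derivative d) (at t) \<and> 0 \<le> d" by blast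
  qed
  moreover have "sin a > 0" "sin b > 0" using ab False by (auto intro!: sin_gt_zero)
  ultimately show ?thesis by (simp add: field_simps)
qed

text \<open>The edge \<open>x = 0\<close> of the strip, with equality at
  \<open>\<alpha> = pi / (2 * p)\<close>. As \<open>p / 2 < 1\<close>, Young's inequality bounds the
  power of \<open>(sin y)^2\<close> by its tangent at \<open>s^2\<close>. What remains is
  \<open>f \<ge> 0\<close>; since \<open>2 * s * c = sin (2 * \<alpha>)\<close> and
  \<open>sin (p * \<alpha>) = 1\<close>, the sign of \<open>f'\<close> compares
  \<open>sin (p * t) / sin (2 * t)\<close> with its value at \<open>\<alpha>\<close>, so
  \<open>f\<close> is smallest there.\<close>

lemma sin_powr_le:
  fixes p y :: real
  defines "s \<equiv> sin (pi / (2 * p))" and "c \<equiv> cos (pi / (2 * p))"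
  assumes p: "1 < p" "p < 2" and y: "0 \<le> y" "y \<le> pi / 2"
  shows "c * cos (p * y) + s powr (1 - p) * ((sin y)\<^sup>2) powr (p / 2) \<le> s"
proof -
  define \<alpha> where "\<alpha> = pi / (2 * p)"
  have \<alpha>: "0 < \<alpha>" "\<alpha> < pi / 2" "p * \<alpha> = pi / 2" using p by (auto simp: \<alpha>_def field_simps)
  have s: "s > 0" and c: "c > 0" using \<alpha> p by (auto simp: s_def c_def \<alpha>_def[symmetric] intro!: sin_gt_zero cos_gt_zero)
  have sc: "2 * s * c = sin (2 * \<alpha>)" by (simp add: s_def c_def \<alpha>_def[symmetric] sin_double)
  define f where "f t = p / (2 * s) * (s\<^sup>2 - (sin t)\<^sup>2) - c * cos (p * t)" for t
  define f' where "f' t = p * (c * sin (p * t) - sin (2 * t) / (2 * s))" for t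
  have der: "(f has_real_derivative f' t) (at t)" for t
    unfolding f_def f'_def sin_double using s
    by (auto intro!: derivative_eq_intros simp: field_simps)
  have f\<alpha>: "f \<alpha> = 0" by (simp add: f_def \<alpha> s_def \<alpha>_def[symmetric])
  have "f y \<ge> 0"
  proof (cases "y \<le> \<alpha>")
    case True
    have "f \<alpha> \<le> f y"
    proof (rule DERIV_nonpos_imp_nonincreasing[OF True, where f = f])
      fix t assume t: "y \<le> t" "t \<le> \<alpha>"
      have "f' t \<le> 0"
      proof (cases "t = 0")
        case False
        then have "sin (p / 2 * (2 * t)) * sin (2 * \<alpha>) \<le> sin (p / 2 * (2 * \<alpha>)) * sin (2 * t)"
          using p y t \<alpha> by (intro sin_ratio_mono) auto
        then have "sin (p * t) * (2 * s * c) \<le> sin (2 * t)" by (simp add: sc \<alpha>)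
        then show ?thesis using s p unfolding f'_def
          by (simp add: mult_le_0_iff field_simps)
      qed (simp add: f'_def)
      then show "\<exists>d. (f has_real_derivative d) (at t) \<and> d \<le> 0" using der by blast
    qed
    then show ?thesis using f\<alpha> by simp
  next
    case False
    have "f \<alpha> \<le> f y"
    proof (rule DERIV_nonneg_imp_nondecreasing[where f = f])
      show "\<alpha> \<le> y" using False by simp
      fix t assume t: "\<alpha> \<le> t" "t \<le> y"
      have "sin (p / 2 * (2 * \<alpha>)) * sin (2 * t) \<le> sin (p / 2 * (2 * t)) * sin (2 * \<alpha>)"
        using p y t \<alpha> by (intro sin_ratio_mono) auto
      then have "sin (2 * t) \<le> sin (p * t) * (2 * s * c)" by (simp add: sc \<alpha>)
      then have "f' t \<ge> 0" using s p unfolding f'_def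
        by (simp add: zero_le_mult_iff field_simps)
      then show "\<exists>d. (f has_real_derivative d) (at t) \<and> 0 \<le> d" using der by blast
    qed
    then show ?thesis using f\<alpha> by simp
  qed
  moreover have "s powr (1 - p) * ((sin y)\<^sup>2) powr (p / 2) \<le> (p / 2 * (sin y)\<^sup>2 + (1 - p / 2) * s\<^sup>2) / s"
  proof -
    have "((sin y)\<^sup>2) powr (p / 2) * (s\<^sup>2) powr (1 - p / 2) \<le> p / 2 * (sin y)\<^sup>2 + (1 - p / 2) * s\<^sup>2"
      using p s Youngs_inequality_0[of "p / 2" "1 - p / 2" "(sin y)\<^sup>2" "s\<^sup>2"]
      by (cases "sin y = 0") auto
    also have "(s\<^sup>2) powr (1 - p / 2) = s * s powr (1 - p)"
    proof -
      have "(s\<^sup>2) powr (1 - p / 2) = s powr (2 - p)"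
        using s by (simp add: powr_powr flip: powr_numeral)
      also have "\<dots> = s powr (1 + (1 - p))" by simp
      also have "\<dots> = s * s powr (1 - p)" unfolding powr_add using s by simp
      finally show ?thesis .
    qed
    finally show ?thesis using s by (simp add: field_simps)
  qed
  moreover have "p / (2 * s) * (s\<^sup>2 - (sin y)\<^sup>2) + (p / 2 * (sin y)\<^sup>2 + (1 - p / 2) * s\<^sup>2) / s = s"
    using s by (simp add: field_simps power2_eq_square)
  ultimately show ?thesis by (simp add: f_def)
qed

text \<open>Let \<open>k\<close> be the maximum over the strip of the quotient of the left side by \<open>cosh (p * x)\<close>. At an interior
  maximum the difference \<open>L\<close> (with \<open>k\<close> in place of \<open>s\<close>) and its gradient vanish. Eliminating \<open>k\<close>
  gives \<open>tanh (e * x) / tanh x = tan (e * y) / tan y\<close> for \<open>e = p - 1\<close>, but the left side exceeds \<open>e\<close>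
  and the right side is less than \<open>e\<close>. So the quotient is largest at \<open>x = 0\<close> or as \<open>x\<close> tends to infinity.\<close>

lemma sinh_sin_powr_le:
  fixes p x y :: real
  defines "s \<equiv> sin (pi / (2 * p))" and "c \<equiv> cos (pi / (2 * p))"
  assumes p: "1 < p" "p < 2" and y: "0 \<le> y" "y \<le> pi / 2"
  shows "c * cos (p * y) + s powr (1 - p) * ((sinh x)\<^sup>2 + (sin y)\<^sup>2) powr (p / 2) \<le> s * cosh (p * x)"
proof (rule ccontr)
  assume neg: "\<not> ?thesis"
  define \<alpha> where "\<alpha> = pi / (2 * p)"
  define e where "e = p - 1"
  have e: "0 < e" "e < 1" "p = 1 + e" using p by (auto simp: e_def)
  have \<alpha>: "0 < \<alpha>" "\<alpha> < pi / 2" using p by (auto simp: \<alpha>_def field_simps)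
  have s: "s > 0" and c: "c > 0" using \<alpha> p by (auto simp: s_def c_def \<alpha>_def[symmetric] intro!: sin_gt_zero cos_gt_zero)
  define m where "m = s powr (1 - p)"
  have m: "m > 0" using s by (simp add: m_def)
  define A where "A x y = (sinh x)\<^sup>2 + (sin y)\<^sup>2" for x y :: real
  define f where "f x y = (c * cos (p * y) + m * A x y powr (p / 2)) / cosh (p * x)" for x y
  have A0: "A x y \<ge> 0" for x y by (simp add: A_def)
  have Apos: "A x y > 0" if "x > 0" for x y
    using that by (auto simp: A_def intro!: add_pos_nonneg)
  have big: "f x y > s" using neg by (simp add: f_def A_def m_def field_simps)
  have "continuous_on (UNIV \<times> {0..pi/2}) (\<lambda>(x, y). f x y)"
    unfolding f_def A_def case_prod_unfold using p
    by (intro continuous_intros continuous_on_powr') auto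
  moreover have "f (- x) y = f x y" for x y by (simp add: f_def A_def)
  moreover have "f x y \<le> 2 * c * exp (- p * x) + m * 2 powr (1 - p) * (1 + exp (- 2 * x)) powr p" (is "_ \<le> ?\<tau> x")
    if "0 \<le> x" for x y
  proof -
    have "A x y \<le> (cosh x)\<^sup>2"
      using cosh_square_eq[of x] abs_sin_le_one[of y] by (simp add: A_def abs_square_le_1)
    then have "A x y powr (p / 2) \<le> exp (p * x) * (1 + exp (- 2 * x)) powr p * 2 powr (- p)"
      using p A0 by (intro powr_half_le_cosh) auto
    then have "c * cos (p * y) + m * A x y powr (p / 2) \<le> c * 1 + m * (exp (p * x) * (1 + exp (- 2 * x)) powr p * 2 powr (- p))"
      using c m by (intro add_mono mult_left_mono) auto
    also have "\<dots> = ?\<tau> x * (exp (p * x) / 2)"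
      by (simp add: field_simps powr_diff powr_minus_divide flip: exp_add)
    also have "\<dots> \<le> ?\<tau> x * cosh (p * x)"
      using c m by (intro mult_left_mono) (auto simp: cosh_def)
    finally show ?thesis by (simp add: f_def field_simps)
  qed
  moreover have "(?\<tau> \<longlongrightarrow> 2 * c * 0 + m * 2 powr (1 - p) * (1 + 0) powr p) at_top"
  proof (intro tendsto_intros)
    show "((\<lambda>x. exp (- p * x)) \<longlongrightarrow> 0) at_top" "((\<lambda>x::real. exp (- 2 * x)) \<longlongrightarrow> 0) at_top"
      using p by real_asymp+
  qed simp
  \<comment> \<open>The limit of the majorant is \<open>(2 * s) powr (1 - p)\<close>, and
    \<open>one_le_sin_powr\<close> says exactly that it is at most \<open>s\<close>.\<close>
  moreover have "2 * c * 0 + m * 2 powr (1 - p) * (1 + 0) powr p \<le> s"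
  proof -
    have "m * 2 powr (1 - p) * 1 \<le> m * 2 powr (1 - p) * (2 powr (p - 1) * s powr p)"
      using one_le_sin_powr[of p] p m unfolding s_def by (intro mult_left_mono) auto
    also have "\<dots> = m * (2 powr (1 - p) * 2 powr (p - 1)) * s powr p" by (simp only: mult_ac)
    also have "\<dots> = m * s powr p" by (simp flip: powr_add)
    also have "\<dots> = s" using s by (simp add: m_def flip: powr_add)
    finally show ?thesis by simp
  qed
  moreover have "y \<in> {0..pi/2}" using y by simp
  ultimately obtain x y where xy: "0 \<le> x" "y \<in> {0..pi/2}" "f x y > s"
    "\<And>x' y'. y' \<in> {0..pi/2} \<Longrightarrow> f x' y' \<le> f x y"
    using even_strip_attains_max[of "pi/2" f ?\<tau> _ s x y, OF _ _ _ _ _ big] by blast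
  define k where "k = f x y"
  have k: "k > s" using xy by (simp add: k_def)
  \<comment> \<open>\<open>L\<close> is nonnegative on the strip and vanishes at
    \<open>(x, y)\<close>, so a maximum of the quotient has become a minimum of a
    difference.\<close>
  define L where "L x' y' = k * cosh (p * x') - c * cos (p * y') - m * A x' y' powr (p / 2)" for x' y'
  have Lxy: "L x y = 0" by (simp add: L_def k_def f_def)
  have Lge: "L x' y' \<ge> 0" if "y' \<in> {0..pi/2}" for x' y'
    using xy(4)[OF that, of x'] by (simp add: L_def k_def[symmetric]) (simp add: f_def field_simps)
  have xpos: "x > 0"
  proof (rule ccontr)
    assume "\<not> x > 0"
    then have "x = 0" using xy by simp
    then show False using sin_powr_le[of p y] p xy(2,3)
      by (simp add: f_def A_def m_def s_def c_def)
  qed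
  \<comment> \<open>\<open>R\<close> absorbs the fractional power: \<open>L = 0\<close> and the two
    critical point equations become linear in \<open>R\<close>.\<close>
  define R where "R y' = m * A x y' powr (p / 2 - 1)" for y'
  have AR: "m * A x y powr (p / 2) = R y * A x y"
    using Apos[OF xpos, of y] by (simp add: R_def powr_diff)
  have dx: "((\<lambda>x. L x y) has_real_derivative (p * (k * sinh (p * x) - R y * sinh x * cosh x))) (at x)"
    unfolding L_def A_def R_def using Apos[OF xpos, of y]
    by (auto intro!: derivative_eq_intros simp: A_def field_simps)
  have dy: "((\<lambda>y. L x y) has_real_derivative (p * (c * sin (p * y) - R y * sin y * cos y))) (at y)" for y
    unfolding L_def A_def R_def using Apos[OF xpos, of y]
    by (auto intro!: derivative_eq_intros simp: A_def field_simps)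
  have "p * (k * sinh (p * x) - R y * sinh x * cosh x) = 0"
    by (rule DERIV_local_min[OF dx, of 1]) (use Lge xy(2) Lxy in auto)
  then have E1: "k * sinh (p * x) = R y * sinh x * cosh x" using p by simp
  have E0: "k * cosh (p * x) - c * cos (p * y) = R y * ((sinh x)\<^sup>2 + (sin y)\<^sup>2)"
    using Lxy AR by (simp add: L_def A_def)
  have hyp: "e * sinh x * cosh (e * x) < sinh (e * x) * cosh x"
    by (rule sinh_mult_cosh_less[OF e(1,2) xpos])
  have shp: "sinh (p * x) = sinh x * cosh (e * x) + cosh x * sinh (e * x)"
    "cosh (p * x) = cosh x * cosh (e * x) + sinh x * sinh (e * x)"
    by (simp_all add: e(3) ring_distribs sinh_add cosh_add)
  have snp: "sin (p * y) = sin y * cos (e * y) + cos y * sin (e * y)"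
    "cos (p * y) = cos y * cos (e * y) - sin y * sin (e * y)"
    by (simp_all add: e(3) ring_distribs sin_add cos_add)
  consider "y = 0" | "y = pi / 2" | "0 < y" "y < pi / 2" using xy(2) by fastforce
  then show False
  proof cases
    case 1
    \<comment> \<open>Here the second derivative in \<open>y\<close> is negative.\<close>
    have e1: "k * cosh (e * x) = c * cosh x"
    proof -
      have "cosh x * (k * cosh (p * x) - c) = (k * sinh (p * x)) * sinh x"
        using E0 1 unfolding E1 by (simp add: power2_eq_square)
      then have "k * (cosh x * cosh (p * x) - sinh x * sinh (p * x)) = c * cosh x"
        by (simp add: algebra_simps)
      also have "cosh x * cosh (p * x) - sinh x * sinh (p * x) = cosh (e * x)"
        using cosh_diff[of "p * x" x] by (simp add: e_def algebra_simps)
      finally show ?thesis .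
    qed
    have "R 0 * sinh x * cosh (e * x) * cosh x = k * sinh (p * x) * cosh (e * x)"
      using E1 1 by simp
    also have "\<dots> = c * cosh x * sinh (p * x)" using e1 by (simp add: mult.commute)
    finally have "R 0 * sinh x * cosh (e * x) = c * sinh (p * x)" by simp
    also have "\<dots> > c * (p * (sinh x * cosh (e * x)))"
      using hyp c unfolding shp by (intro mult_strict_left_mono) (auto simp: e(3) algebra_simps)
    finally have R0: "R 0 > c * p" using xpos by (simp add: mult.assoc[symmetric])
    have d0: "((\<lambda>y. p * (c * sin (p * y) - R y * sin y * cos y)) has_real_derivative p * (c * p - R 0)) (at 0)"
      unfolding R_def A_def using xpos
      by (auto intro!: derivative_eq_intros simp: field_simps)
    have "p * (c * p - R 0) < 0" using R0 p by (simp add: mult_less_0_iff)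
    then obtain h where "0 < h" "h \<le> pi / 2" "L x h < L x 0"
      using critical_point_decreasing[OF dy _ d0, of "pi / 2"] p by auto
    then show False using Lge[of h x] Lxy 1 by simp
  next
    case 2
    \<comment> \<open>At \<open>y = pi / 2\<close> the term with \<open>cos y\<close> drops out and
      \<open>p * y < pi\<close>. So \<open>L\<close> would become negative just inside the
      edge.\<close>
    have "p * (c * sin (p * y) - R y * sin y * cos y) > 0"
    proof -
      have "cos y = 0" unfolding 2 by simp
      moreover have "sin (p * y) > 0" unfolding 2 using p by (intro sin_gt_zero) auto
      ultimately show ?thesis using p c by simp
    qed
    then obtain h where "0 < h" "h \<le> pi / 2" "L x (y - h) < L x y"
      using DERIV_pos_less_left[OF dy, of y "pi / 2"] p by auto
    then show False using Lge[of "y - h" x] Lxy 2 by auto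
  next
    case 3
    have sy: "sin y > 0" and cy: "cos y > 0" using 3 by (auto intro!: sin_gt_zero cos_gt_zero)
    have shx: "sinh x > 0" using xpos by simp
    have "p * (c * sin (p * y) - R y * sin y * cos y) = 0"
      by (rule DERIV_local_min[OF dy, of "min y (pi / 2 - y)"]) (use Lge Lxy 3 in \<open>auto simp: abs_if split: if_splits\<close>)
    then have E2: "c * sin (p * y) = R y * sin y * cos y" using p by simp
    have trig: "sin (e * y) * cos y < e * sin y * cos (e * y)"
      using 3 by (intro sin_mult_cos_less e) auto
    \<comment> \<open>\<open>R\<close> is eliminated between \<open>E0\<close>, \<open>E1\<close>
      and \<open>E2\<close>, and the addition theorems lower the frequency from \<open>p\<close> to
      \<open>e = p - 1\<close>. Dividing \<open>c'\<close> below by this identity gives the equality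
      of the \<open>tanh\<close> and \<open>tan\<close> quotients.\<close>
    have a: "k * cosh (e * x) * cos y = c * cos (e * y) * cosh x"
    proof -
      have "cosh x * cos y * (k * cosh (p * x) - c * cos (p * y))
          = (R y * sinh x * cosh x) * sinh x * cos y + (R y * sin y * cos y) * sin y * cosh x"
        unfolding E0 by (simp add: power2_eq_square algebra_simps)
      also have "\<dots> = k * sinh (p * x) * sinh x * cos y + c * sin (p * y) * sin y * cosh x"
        by (simp add: E1 E2)
      finally have "k * cos y * (cosh (p * x) * cosh x - sinh (p * x) * sinh x)
          = c * cosh x * (cos (p * y) * cos y + sin (p * y) * sin y)"
        by (simp add: algebra_simps)
      also have "cosh (p * x) * cosh x - sinh (p * x) * sinh x = cosh (e * x)"
        using cosh_diff[of "p * x" x] by (simp add: e_def algebra_simps)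
      also have "cos (p * y) * cos y + sin (p * y) * sin y = cos (e * y)"
        using cos_diff[of "p * y" y] by (simp add: e_def algebra_simps)
      finally show ?thesis by (simp add: mult_ac)
    qed
    have b: "k * sinh (p * x) * (sin y * cos y) = c * sin (p * y) * (sinh x * cosh x)"
      by (simp add: E1 E2)
    have "k * sinh (e * x) * sin y * (cosh x * cos y) = c * sin (e * y) * sinh x * (cosh x * cos y)"
    proof -
      have "k * sinh (e * x) * sin y * (cosh x * cos y) + (k * cosh (e * x) * cos y) * sinh x * sin y
          = c * sin (e * y) * sinh x * (cosh x * cos y) + (c * cos (e * y) * cosh x) * sinh x * sin y"
        using b unfolding shp snp by (simp add: algebra_simps)
      then show ?thesis unfolding a by simp
    qed
    then have c': "k * sinh (e * x) * sin y = c * sin (e * y) * sinh x" using cy by simp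
    have "k * sin y * cos y * (e * sinh x * cosh (e * x)) < k * sin y * cos y * (sinh (e * x) * cosh x)"
      using hyp k s sy cy by (intro mult_strict_left_mono) auto
    also have "\<dots> = c * sinh x * cosh x * (sin (e * y) * cos y)" using c' by (simp add: mult_ac)
    also have "\<dots> < c * sinh x * cosh x * (e * sin y * cos (e * y))"
      using trig c shx by (intro mult_strict_left_mono) auto
    also have "\<dots> = k * sin y * cos y * (e * sinh x * cosh (e * x))" using a by (simp add: mult_ac)
    finally show False by simp
  qed
qed

section \<open>The strip inequality for \<open>p > 2\<close>\<close>

lemma sin_cos_powr_ratio_antimono:
  fixes p a b :: real
  assumes p: "p > 2" and ab: "0 < a" "a \<le> b" "b \<le> pi / p"
  shows "sin (p * b) * (sin a * cos a powr (p - 1)) \<le> sin (p * a) * (sin b * cos b powr (p - 1))"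
proof -
  define n where "n = p - 1"
  have n: "n > 1" "p = n + 1" using p by (auto simp: n_def)
  have "pi / p < pi / 2" using p by (simp add: field_simps)
  then have b2: "b < pi / 2" using ab by linarith
  define g where "g t = - (sin (p * t) / (sin t * cos t powr n))" for t
  have "g a \<le> g b"
  proof (rule DERIV_nonneg_imp_nondecreasing[OF ab(2), where f = g])
    fix t assume t: "a \<le> t" "t \<le> b"
    then have t': "0 < t" "t < pi / 2" using ab b2 by auto
    have st: "sin t > 0" and ct: "cos t > 0" using t' by (auto intro!: sin_gt_zero cos_gt_zero)
    define C where "C = cos t powr n"
    have C: "C > 0" "cos t powr (n - 1) = C / cos t" using ct by (simp_all add: C_def powr_diff)
    have "p * t \<le> p * (pi / p)" using t ab p by (intro mult_left_mono) auto
    then have "p * t \<le> pi" using p by simp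
    then have "n * t < pi" using t' by (simp add: n ring_distribs)
    \<comment> \<open>Here \<open>n > 1\<close>, so the comparison is applied with factor
      \<open>1 / n\<close> at the point \<open>n * t\<close>.\<close>
    then have "sin (1 / n * (n * t)) * cos (n * t) < 1 / n * sin (n * t) * cos (1 / n * (n * t))"
      using n t' by (intro sin_mult_cos_less) auto
    then have neg: "n * sin t * cos (n * t) < sin (n * t) * cos t"
      using n by (simp add: field_simps)
    have sp: "sin (p * t) = sin (n * t) * cos t + cos (n * t) * sin t"
      and cp: "cos (p * t) = cos (n * t) * cos t - sin (n * t) * sin t"
      by (simp_all add: n ring_distribs sin_add cos_add)
    \<comment> \<open>Up to a positive factor this is minus the derivative of \<open>g\<close>. With
      \<open>p = n + 1\<close> it collapses to the difference whose sign was just found.\<close>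
    have "(p * cos (p * t) * sin t * cos t - sin (p * t) * ((cos t)\<^sup>2 - n * (sin t)\<^sup>2))
        = n * sin t * cos (n * t) - sin (n * t) * cos t"
      unfolding sp cp using sin_cos_squared_add[of t] n(2) by algebra
    then have "p * cos (p * t) * sin t * cos t - sin (p * t) * ((cos t)\<^sup>2 - n * (sin t)\<^sup>2) \<le> 0"
      using neg by simp
    moreover have "(g has_real_derivative
        - (C * (p * cos (p * t) * sin t * cos t - sin (p * t) * ((cos t)\<^sup>2 - n * (sin t)\<^sup>2)) / (cos t * (sin t * C)\<^sup>2))) (at t)"
      unfolding g_def using st ct C
      by (auto intro!: derivative_eq_intros simp: C_def[symmetric] C(2) field_simps power2_eq_square)
    ultimately show "\<exists>d. (g has_real_derivative d) (at t) \<and> 0 \<le> d"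
      using ct C by (auto intro!: exI mult_nonneg_nonpos divide_nonpos_nonneg simp: neg_le_0_iff_le)
  qed
  moreover have "sin a > 0" "sin b > 0" "cos a > 0" "cos b > 0"
    using ab b2 by (auto intro!: sin_gt_zero cos_gt_zero)
  ultimately show ?thesis by (simp add: g_def n_def[symmetric] field_simps)
qed

text \<open>The edge \<open>x = 0\<close>, again with equality at
  \<open>\<alpha> = pi / (2 * p)\<close>. The sign of \<open>f'\<close> compares
  \<open>sin (p * t) / (sin t * cos t powr (p - 1))\<close> with its value at
  \<open>\<alpha>\<close>. The range ends at \<open>pi / p\<close>, where \<open>p * y = pi\<close>
  and \<open>U\<close> starts to be frozen.\<close>

lemma cos_powr_le:
  fixes p y :: real
  defines "s \<equiv> sin (pi / (2 * p))" and "c \<equiv> cos (pi / (2 * p))"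
  assumes p: "p > 2" and y: "0 \<le> y" "y \<le> pi / p"
  shows "c powr (1 - p) * ((cos y)\<^sup>2) powr (p / 2) \<le> c + s * cos (p * y)"
proof -
  define \<alpha> where "\<alpha> = pi / (2 * p)"
  have \<alpha>: "0 < \<alpha>" "\<alpha> < pi / 2" "p * \<alpha> = pi / 2" "\<alpha> \<le> pi / p" using p by (auto simp: \<alpha>_def field_simps)
  have "pi / p < pi / 2" using p by (simp add: field_simps)
  then have cpos: "cos t > 0" if "0 \<le> t" "t \<le> pi / p" for t
    using that pi_gt_zero by (intro cos_gt_zero_pi; linarith)
  have s: "s > 0" and c: "c > 0" using \<alpha> p by (auto simp: s_def c_def \<alpha>_def[symmetric] intro!: sin_gt_zero cos_gt_zero)
  define m where "m = c powr (1 - p)"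
  have m: "m > 0" "m * c powr (p - 1) = 1" "m * c powr p = c"
    using c by (auto simp: m_def simp flip: powr_add)
  define f where "f t = c + s * cos (p * t) - m * cos t powr p" for t
  define f' where "f' t = p * (m * (sin t * cos t powr (p - 1)) - s * sin (p * t))" for t
  have der: "(f has_real_derivative f' t) (at t)" if "0 \<le> t" "t \<le> pi / p" for t
    unfolding f_def f'_def using cpos[OF that]
    by (auto intro!: derivative_eq_intros simp: powr_diff field_simps)
  have f\<alpha>: "f \<alpha> = 0" using m by (simp add: f_def \<alpha> c_def \<alpha>_def[symmetric])
  have "f y \<ge> 0"
  proof (cases "y \<le> \<alpha>")
    case True
    have "f \<alpha> \<le> f y"
    proof (rule DERIV_nonpos_imp_nonincreasing[OF True, where f = f])
      fix t assume t: "y \<le> t" "t \<le> \<alpha>"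
      have "f' t \<le> 0"
      proof (cases "t = 0")
        case False
        then have "sin (p * \<alpha>) * (sin t * cos t powr (p - 1)) \<le> sin (p * t) * (sin \<alpha> * cos \<alpha> powr (p - 1))"
          using p y t \<alpha> by (intro sin_cos_powr_ratio_antimono) auto
        then have "m * (sin t * cos t powr (p - 1)) \<le> m * (sin (p * t) * (s * c powr (p - 1)))"
          using m by (simp add: \<alpha> s_def c_def \<alpha>_def[symmetric])
        also have "\<dots> = s * sin (p * t) * (m * c powr (p - 1))" by (simp add: mult_ac)
        finally show ?thesis using p by (simp add: f'_def m mult_le_0_iff)
      qed (simp add: f'_def)
      then show "\<exists>d. (f has_real_derivative d) (at t) \<and> d \<le> 0" using der[of t] t y \<alpha> by auto
    qed
    then show ?thesis using f\<alpha> by simp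
  next
    case False
    have "f \<alpha> \<le> f y"
    proof (rule DERIV_nonneg_imp_nondecreasing[where f = f])
      show "\<alpha> \<le> y" using False by simp
      fix t assume t: "\<alpha> \<le> t" "t \<le> y"
      have "sin (p * t) * (sin \<alpha> * cos \<alpha> powr (p - 1)) \<le> sin (p * \<alpha>) * (sin t * cos t powr (p - 1))"
        using p y t \<alpha> by (intro sin_cos_powr_ratio_antimono) auto
      then have "m * (sin (p * t) * (s * c powr (p - 1))) \<le> m * (sin t * cos t powr (p - 1))"
        using m by (simp add: \<alpha> s_def c_def \<alpha>_def[symmetric])
      also have "m * (sin (p * t) * (s * c powr (p - 1))) = s * sin (p * t) * (m * c powr (p - 1))" by (simp add: mult_ac)
      finally have "f' t \<ge> 0" using p by (simp add: f'_def m zero_le_mult_iff)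
      then show "\<exists>d. (f has_real_derivative d) (at t) \<and> 0 \<le> d" using der[of t] t y \<alpha> by auto
    qed
    then show ?thesis using f\<alpha> by simp
  qed
  moreover have "((cos y)\<^sup>2) powr (p / 2) = cos y powr p"
    using cpos[OF y] by (simp add: powr_powr flip: powr_numeral)
  ultimately show ?thesis by (simp add: f_def m_def)
qed

text \<open>Same scheme as \<open>sinh_sin_powr_le\<close>, for the quotient by
  \<open>cosh (q * x) powr (p - 1)\<close>. With \<open>n = p - 1\<close> and
  \<open>e = 1 / n\<close>, an interior maximum above \<open>c\<close> leads to
  \<open>tanh (e * x) / tanh x = tan y / tan (n * y)\<close>. The left side exceeds
  \<open>e\<close>; the right side is less than \<open>e\<close>, by
  \<open>sin_mult_cos_less\<close> at the point \<open>n * y\<close>.\<close>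

lemma sinh_cos_powr_le:
  fixes p x y :: real
  defines "s \<equiv> sin (pi / (2 * p))" and "c \<equiv> cos (pi / (2 * p))" and "q \<equiv> p / (p - 1)"
  assumes p: "p > 2" and y: "0 \<le> y" "y \<le> pi / p"
  shows "c powr (1 - p) * ((sinh x)\<^sup>2 + (cos y)\<^sup>2) powr (p / 2) \<le> c * cosh (q * x) powr (p - 1) + s * cos (p * y)"
proof (rule ccontr)
  assume neg: "\<not> ?thesis"
  define \<alpha> where "\<alpha> = pi / (2 * p)"
  define e where "e = 1 / (p - 1)"
  define n where "n = p - 1"
  have n: "n > 1" "p = 1 + n" "n * e = 1" "e * n = 1" using p by (auto simp: n_def e_def)
  have e: "0 < e" "e < 1" "q = 1 + e" using p by (auto simp: e_def q_def field_simps)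
  have qp: "q * (p - 1) = p" using p by (simp add: q_def)
  have \<alpha>: "0 < \<alpha>" "\<alpha> < pi / 2" using p by (auto simp: \<alpha>_def field_simps)
  have pi2: "pi / p < pi / 2" using p by (simp add: field_simps)
  have s: "s > 0" and c: "c > 0" using \<alpha> p by (auto simp: s_def c_def \<alpha>_def[symmetric] intro!: sin_gt_zero cos_gt_zero)
  define m where "m = c powr (1 - p)"
  have m: "m > 0" using c by (simp add: m_def)
  define B where "B x y = (sinh x)\<^sup>2 + (cos y)\<^sup>2" for x y :: real
  define f where "f x y = (m * B x y powr (p / 2) - s * cos (p * y)) / cosh (q * x) powr (p - 1)" for x y
  have B0: "B x y \<ge> 0" for x y by (simp add: B_def)
  have Bpos: "B x y > 0" if "x > 0" for x y
    using that by (auto simp: B_def intro!: add_pos_nonneg)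
  have chp: "cosh (q * x) powr (p - 1) > 0" for x by (simp add: less_imp_neq[OF cosh_real_pos, symmetric])
  have big: "f x y > c" using neg chp[of x] by (simp add: f_def B_def m_def field_simps)
  have ymem: "y \<in> {0..pi/p}" using y by simp
  have "continuous_on (UNIV \<times> {0..pi/p}) (\<lambda>(x, y). f x y)"
    unfolding f_def B_def case_prod_unfold using p
    by (intro continuous_intros continuous_on_powr') (auto simp: less_imp_neq[OF cosh_real_pos, symmetric])
  moreover have "f (- x) y = f x y" for x y by (simp add: f_def B_def)
  moreover have "f x y \<le> s * 2 powr (p - 1) * exp (- p * x) + m * (1 + exp (- 2 * x)) powr p / 2" (is "_ \<le> ?\<tau> x")
    if "0 \<le> x" for x y
  proof -
    have "B x y \<le> (cosh x)\<^sup>2"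
      using cosh_square_eq[of x] abs_cos_le_one[of y] by (simp add: B_def abs_square_le_1)
    then have "B x y powr (p / 2) \<le> exp (p * x) * (1 + exp (- 2 * x)) powr p * 2 powr (- p)"
      using p B0 by (intro powr_half_le_cosh) auto
    moreover have "- cos (p * y) \<le> 1" by (smt (verit) cos_ge_minus_one)
    ultimately have "m * B x y powr (p / 2) + s * (- cos (p * y)) \<le> m * (exp (p * x) * (1 + exp (- 2 * x)) powr p * 2 powr (- p)) + s * 1"
      using s m by (intro add_mono mult_left_mono) auto
    also have "\<dots> = ?\<tau> x * (exp (p * x) * 2 powr (1 - p))"
      by (simp add: field_simps powr_diff powr_minus_divide flip: exp_add)
    also have "exp (p * x) * 2 powr (1 - p) = (exp (q * x) / 2) powr (p - 1)"
    proof -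
      have "(exp (q * x) / 2) powr (p - 1) = exp (q * (p - 1) * x) / 2 powr (p - 1)"
        by (simp add: powr_divide exp_powr_real mult_ac)
      then show ?thesis unfolding qp by (simp add: powr_diff)
    qed
    also have "?\<tau> x * (exp (q * x) / 2) powr (p - 1) \<le> ?\<tau> x * cosh (q * x) powr (p - 1)"
      using s m p by (intro mult_left_mono powr_mono2) (auto simp: cosh_def)
    finally show ?thesis using chp[of x] by (simp add: f_def field_simps)
  qed
  moreover have "(?\<tau> \<longlongrightarrow> s * 2 powr (p - 1) * 0 + m * (1 + 0) powr p / 2) at_top"
  proof (intro tendsto_intros)
    show "((\<lambda>x. exp (- p * x)) \<longlongrightarrow> 0) at_top" "((\<lambda>x::real. exp (- 2 * x)) \<longlongrightarrow> 0) at_top"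
      using p by real_asymp+
  qed simp_all
  \<comment> \<open>The limit is \<open>m / 2\<close>, and \<open>one_le_cos_powr\<close> bounds it
    by \<open>c\<close>.\<close>
  moreover have "s * 2 powr (p - 1) * 0 + m * (1 + 0) powr p / 2 \<le> c"
  proof -
    have "m / 2 * 1 \<le> m / 2 * (2 * c powr p)"
      using one_le_cos_powr[of p] p m unfolding c_def by (intro mult_left_mono) auto
    also have "\<dots> = m * c powr p" by simp
    also have "\<dots> = c" using c by (simp add: m_def flip: powr_add)
    finally show ?thesis by simp
  qed
  ultimately obtain x y where xy: "0 \<le> x" "y \<in> {0..pi/p}" "f x y > c"
    "\<And>x' y'. y' \<in> {0..pi/p} \<Longrightarrow> f x' y' \<le> f x y"
    using even_strip_attains_max[of "pi/p" f ?\<tau> _ c x y, OF _ _ _ _ _ big ymem] by blast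
  define k where "k = f x y"
  have k: "k > c" using xy by (simp add: k_def)
  define L where "L x' y' = k * cosh (q * x') powr (p - 1) + s * cos (p * y') - m * B x' y' powr (p / 2)" for x' y'
  have Lxy: "L x y = 0" using chp[of x] by (simp add: L_def k_def f_def)
  have Lge: "L x' y' \<ge> 0" if "y' \<in> {0..pi/p}" for x' y'
    using xy(4)[OF that, of x'] chp[of x'] by (simp add: L_def k_def[symmetric]) (simp add: f_def field_simps)
  have xpos: "x > 0"
  proof (rule ccontr)
    assume "\<not> x > 0"
    then have "x = 0" using xy by simp
    then show False using cos_powr_le[of p y] p xy(2,3)
      by (simp add: f_def B_def m_def s_def c_def)
  qed
  define R where "R y' = m * B x y' powr (p / 2 - 1)" for y'
  \<comment> \<open>\<open>E\<close> does for the power of \<open>cosh\<close> what \<open>R\<close>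
    does for the power of \<open>B\<close>. Because \<open>q * (p - 1) = p\<close>, both derivatives
    carry the same factor \<open>p\<close>.\<close>
  define E where "E = k * cosh (q * x) powr (p - 2)"
  have Rpos: "R y' > 0" for y' using m Bpos[OF xpos, of y'] by (simp add: R_def)
  have Epos: "E > 0" using k c by (simp add: E_def less_imp_neq[OF cosh_real_pos, symmetric])
  have BR: "m * B x y powr (p / 2) = R y * B x y"
    using Bpos[OF xpos, of y] by (simp add: R_def powr_diff)
  have EC: "k * cosh (q * x) powr (p - 1) = E * cosh (q * x)"
  proof -
    have "cosh (q * x) powr (p - 1) = cosh (q * x) powr (p - 2 + 1)" by simp
    also have "\<dots> = cosh (q * x) powr (p - 2) * cosh (q * x)" unfolding powr_add by simp
    finally show ?thesis by (simp add: E_def)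
  qed
  have dx: "((\<lambda>x. L x y) has_real_derivative (p * (E * sinh (q * x) - R y * sinh x * cosh x))) (at x)"
  proof -
    have "((\<lambda>x. L x y) has_real_derivative
       (k * ((p - 1) * cosh (q * x) powr (p - 2) * (sinh (q * x) * q))
         - p * R y * sinh x * cosh x)) (at x)"
      unfolding L_def B_def R_def using Bpos[OF xpos, of y]
      by (auto intro!: derivative_eq_intros simp: B_def field_simps)
    also have "k * ((p - 1) * cosh (q * x) powr (p - 2) * (sinh (q * x) * q)) = (q * (p - 1)) * E * sinh (q * x)"
      by (simp add: E_def mult_ac)
    also have "\<dots> = p * E * sinh (q * x)" unfolding qp by simp
    finally show ?thesis by (simp add: algebra_simps)
  qed
  have dy: "((\<lambda>y. L x y) has_real_derivative (p * (R y * sin y * cos y - s * sin (p * y)))) (at y)" for y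
    unfolding L_def B_def R_def using Bpos[OF xpos, of y]
    by (auto intro!: derivative_eq_intros simp: B_def field_simps)
  have "p * (E * sinh (q * x) - R y * sinh x * cosh x) = 0"
    by (rule DERIV_local_min[OF dx, of 1]) (use Lge xy(2) Lxy in auto)
  then have E1: "E * sinh (q * x) = R y * sinh x * cosh x" using p by simp
  have E0: "E * cosh (q * x) + s * cos (p * y) = R y * ((sinh x)\<^sup>2 + (cos y)\<^sup>2)"
    using Lxy BR by (simp add: L_def B_def EC)
  have hyp: "e * sinh x * cosh (e * x) < sinh (e * x) * cosh x"
    by (rule sinh_mult_cosh_less[OF e(1,2) xpos])
  have shp: "sinh (q * x) = sinh x * cosh (e * x) + cosh x * sinh (e * x)"
    "cosh (q * x) = cosh x * cosh (e * x) + sinh x * sinh (e * x)"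
    by (simp_all add: e(3) ring_distribs sinh_add cosh_add)
  have snp: "sin (p * y) = sin y * cos (n * y) + cos y * sin (n * y)"
    "cos (p * y) = cos y * cos (n * y) - sin y * sin (n * y)"
    by (simp_all add: n(2) ring_distribs sin_add cos_add)
  have shx: "sinh x > 0" "sinh (e * x) > 0" using xpos e by auto
  have che: "cosh x * cosh (q * x) - sinh x * sinh (q * x) = cosh (e * x)"
    using cosh_diff[of "q * x" x] by (simp add: e(3) algebra_simps)
  have she: "sinh (q * x) * cosh x - cosh (q * x) * sinh x = sinh (e * x)"
    using sinh_diff[of "q * x" x] by (simp add: e(3) algebra_simps)
  consider "y = 0" | "y = pi / p" | "0 < y" "y < pi / p" using xy(2) by fastforce
  then show False
  proof cases
    case 1
    \<comment> \<open>Here the second derivative in \<open>y\<close> is negative.\<close>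
    have "sinh x * (E * cosh (q * x) + s) = (R y * sinh x * cosh x) * cosh x"
      using E0 1 cosh_square_eq[of x] by (simp add: power2_eq_square)
    also have "\<dots> = E * sinh (q * x) * cosh x" by (simp add: E1)
    finally have "s * sinh x = E * sinh (e * x)" unfolding she[symmetric] by (simp add: algebra_simps)
    then have "R 0 * sinh x * cosh x * sinh (e * x) = s * sinh x * sinh (q * x)"
      using E1 1 by (simp add: mult_ac)
    then have "R 0 * cosh x * sinh (e * x) = s * sinh (q * x)" using shx by simp
    then have "e * (R 0 * cosh x * sinh (e * x)) = s * (e * sinh x * cosh (e * x) + e * (cosh x * sinh (e * x)))"
      unfolding shp by (simp add: algebra_simps)
    also have "\<dots> < s * (sinh (e * x) * cosh x + e * (cosh x * sinh (e * x)))"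
      using hyp s by (intro mult_strict_left_mono) auto
    also have "\<dots> = e * (s * p) * (cosh x * sinh (e * x))"
      using n by (simp add: algebra_simps)
    finally have R0: "R 0 < s * p" using e shx by (simp add: mult.assoc)
    have d0: "((\<lambda>y. p * (R y * sin y * cos y - s * sin (p * y))) has_real_derivative p * (R 0 - s * p)) (at 0)"
      unfolding R_def B_def using xpos
      by (auto intro!: derivative_eq_intros simp: field_simps add_pos_pos)
    have "p * (R 0 - s * p) < 0" using R0 p by (simp add: mult_less_0_iff)
    then obtain h where "0 < h" "h \<le> pi / p" "L x h < L x 0"
      using critical_point_decreasing[OF dy _ d0, of "pi / p"] p by auto
    then show False using Lge[of h x] Lxy 1 by simp
  next
    case 2
    have "p * (R y * sin y * cos y - s * sin (p * y)) > 0"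
    proof -
      have "sin (p * y) = 0" unfolding 2 using p by simp
      moreover have "sin y > 0" "cos y > 0" using p pi2 unfolding 2 by (auto intro!: sin_gt_zero2 cos_gt_zero)
      ultimately show ?thesis using p Rpos by simp
    qed
    then obtain h where "0 < h" "h \<le> pi / p" "L x (y - h) < L x y"
      using DERIV_pos_less_left[OF dy, of y "pi / p"] p by auto
    then show False using Lge[of "y - h" x] Lxy 2 by auto
  next
    case 3
    have "y < pi / 2" using 3 pi2 by linarith
    then have sy: "sin y > 0" and cy: "cos y > 0" using 3 by (auto intro!: sin_gt_zero2 cos_gt_zero)
    have "p * (R y * sin y * cos y - s * sin (p * y)) = 0"
      by (rule DERIV_local_min[OF dy, of "min y (pi / p - y)"]) (use Lge Lxy 3 in \<open>auto simp: abs_if split: if_splits\<close>)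
    then have E2: "s * sin (p * y) = R y * sin y * cos y" using p by simp
    have "p * y \<le> pi" using 3 p by (simp add: field_simps)
    then have "n * y < pi" using 3 by (simp add: n ring_distribs)
    then have "sin (e * (n * y)) * cos (n * y) < e * sin (n * y) * cos (e * (n * y))"
      using 3 n e by (intro sin_mult_cos_less) auto
    then have trig: "sin y * cos (n * y) < e * sin (n * y) * cos y"
      using n by (simp add: mult.assoc[symmetric])
    have a: "E * cosh (e * x) * sin y = s * sin (n * y) * cosh x"
    proof -
      have "sin y * cosh x * (E * cosh (q * x) + s * cos (p * y))
          = (R y * sinh x * cosh x) * sinh x * sin y + (R y * sin y * cos y) * cos y * cosh x"
        unfolding E0 by (simp add: power2_eq_square algebra_simps)
      also have "\<dots> = E * sinh (q * x) * sinh x * sin y + s * sin (p * y) * cos y * cosh x"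
        by (simp add: E1 E2)
      finally have "E * sin y * (cosh x * cosh (q * x) - sinh x * sinh (q * x))
          = s * cosh x * (sin (p * y) * cos y - cos (p * y) * sin y)"
        by (simp add: algebra_simps)
      also have "sin (p * y) * cos y - cos (p * y) * sin y = sin (n * y)"
        using sin_diff[of "p * y" y] by (simp add: n_def algebra_simps)
      finally show ?thesis unfolding che by (simp add: mult_ac)
    qed
    have b: "E * sinh (q * x) * (sin y * cos y) = s * sin (p * y) * (sinh x * cosh x)"
      by (simp add: E1 E2)
    have "E * sinh (e * x) * cos y * (cosh x * sin y) = s * cos (n * y) * sinh x * (cosh x * sin y)"
    proof -
      have "E * sinh (e * x) * cos y * (cosh x * sin y) + (E * cosh (e * x) * sin y) * sinh x * cos y
          = s * cos (n * y) * sinh x * (cosh x * sin y) + (s * sin (n * y) * cosh x) * sinh x * cos y"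
        using b unfolding shp snp by (simp add: algebra_simps)
      then show ?thesis unfolding a by simp
    qed
    then have c': "E * sinh (e * x) * cos y = s * cos (n * y) * sinh x" using sy by simp
    have "E * sin y * cos y * (e * sinh x * cosh (e * x)) < E * sin y * cos y * (sinh (e * x) * cosh x)"
      using hyp Epos sy cy by (intro mult_strict_left_mono) auto
    also have "\<dots> = s * sinh x * cosh x * (sin y * cos (n * y))" using c' by (simp add: mult_ac)
    also have "\<dots> < s * sinh x * cosh x * (e * sin (n * y) * cos y)"
      using trig s shx by (intro mult_strict_left_mono) auto
    also have "\<dots> = E * sin y * cos y * (e * sinh x * cosh (e * x))" using a by (simp add: mult_ac)
    finally show False by simp
  qed
qed

section \<open>Pointwise inequalities for complex numbers\<close>

text \<open>This is \<open>|Arg u|\<close> for \<open>u \<noteq> 0\<close>; at \<open>0\<close> it is \<open>arccos 0\<close>.\<close>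

definition absarg :: "complex \<Rightarrow> real" where
  "absarg u = arccos (Re u / norm u)"

text \<open>Positively homogeneous of degree \<open>a\<close> and symmetric under conjugation. The
  arbitrary value of \<open>absarg\<close> at \<open>0\<close> is harmless since
  \<open>0 powr a = 0\<close>.\<close>

definition polar_fun :: "real \<Rightarrow> (real \<Rightarrow> real) \<Rightarrow> complex \<Rightarrow> real" where
  "polar_fun a g u = norm u powr a * g (absarg u)"

lemma absarg_arg_bounds: "- 1 \<le> Re u / norm u" "Re u / norm u \<le> 1"
  using abs_Re_le_cmod[of u] by (auto simp: divide_simps abs_le_iff)

lemma absarg_bounds: "0 \<le> absarg u" "absarg u \<le> pi"
  using absarg_arg_bounds[of u] by (auto simp: absarg_def arccos_lbound arccos_ubound)

lemma cos_absarg: "norm u * cos (absarg u) = Re u"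
  using absarg_arg_bounds[of u] by (cases "u = 0") (auto simp: absarg_def)

lemma absarg_scale: "r > 0 \<Longrightarrow> absarg (of_real r * u) = absarg u"
  by (simp add: absarg_def norm_mult)

lemma polar_fun_scale: "r > 0 \<Longrightarrow> polar_fun a g (of_real r * u) = r powr a * polar_fun a g u"
  by (simp add: polar_fun_def absarg_scale norm_mult powr_mult)

lemma polar_fun_0 [simp]: "polar_fun a g 0 = 0"
  by (simp add: polar_fun_def)

lemma abs_polar_fun_le:
  assumes "\<And>t. \<bar>g t\<bar> \<le> 1"
  shows "\<bar>polar_fun a g u\<bar> \<le> norm u powr a"
  using mult_left_mono[OF assms, of "norm u powr a" "absarg u"] by (simp add: polar_fun_def abs_mult)

lemma continuous_on_polar_fun:
  assumes a: "a > 0" and g: "continuous_on {0..pi} g" "\<And>t. \<bar>g t\<bar> \<le> 1"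
  shows "continuous_on UNIV (polar_fun a g)"
proof -
  have "isCont (polar_fun a g) u" for u
  proof (cases "u = 0")
    case True
    have "((\<lambda>u. polar_fun a g u) \<longlongrightarrow> 0) (at 0)"
    proof (rule Lim_null_comparison)
      show "\<forall>\<^sub>F x in at 0. norm (polar_fun a g x) \<le> norm x powr a"
        using abs_polar_fun_le[OF g(2)] by simp
      have "((\<lambda>x::complex. norm x powr a) \<longlongrightarrow> norm (0::complex) powr a) (at 0)"
        using a by (intro tendsto_powr' tendsto_intros) auto
      then show "((\<lambda>x::complex. norm x powr a) \<longlongrightarrow> 0) (at 0)" by simp
    qed
    then show ?thesis using True by (simp add: isCont_def)
  next
    case False
    have "continuous_on (- {0}) absarg"
      unfolding absarg_def by (intro continuous_intros ballI) (use absarg_arg_bounds complex_Re_le_cmod in auto)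
    then have "continuous_on (- {0}) (polar_fun a g)"
      unfolding polar_fun_def
      by (intro continuous_intros continuous_on_compose2[OF g(1)]) (auto simp: absarg_bounds)
    then show ?thesis using False by (simp add: continuous_on_eq_continuous_at open_Compl)
  qed
  then show ?thesis by (simp add: continuous_at_imp_continuous_on)
qed

text \<open>Scale is separated from shape: \<open>N\<close> carries the homogeneity,
  \<open>x\<close> is half the logarithm of \<open>|z| / |w|\<close>. The square is
  \<open>|z|^2 + |w|^2 + 2 * Re (z * w)\<close>, rewritten with the half-angle formulas.\<close>

lemma polar_coords_pair:
  fixes z w :: complex
  assumes "z \<noteq> 0" "w \<noteq> 0"
  obtains x N where "N > 0" "N = norm (z * w)" "norm z = sqrt N * exp x" "norm w = sqrt N * exp (- x)"
    "(norm (z + cnj w))\<^sup>2 = 4 * N * ((sinh x)\<^sup>2 + (cos (absarg (z * w) / 2))\<^sup>2)"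
    "\<And>p. norm z powr p + norm w powr p = N powr (p / 2) * (2 * cosh (p * x))"
proof -
  define N where "N = norm (z * w)"
  define x where "x = ln (norm z / norm w) / 2"
  have N: "N > 0" using assms by (simp add: N_def)
  have ex: "exp x = sqrt (norm z / norm w)"
    using assms by (simp add: x_def exp_ln ln_sqrt[symmetric])
  have nz: "norm z = sqrt N * exp x" and nw: "norm w = sqrt N * exp (- x)"
    using assms by (auto simp: N_def ex exp_minus norm_mult real_sqrt_mult real_sqrt_divide field_simps)
  have cc: "cos (absarg (z * w)) = 2 * (cos (absarg (z * w) / 2))\<^sup>2 - 1"
    using cos_double_cos[of "absarg (z * w) / 2"] by simp
  have "(norm (z + cnj w))\<^sup>2 = (norm z)\<^sup>2 + (norm w)\<^sup>2 + 2 * Re (z * w)"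
    unfolding cmod_power2 by (simp add: power2_eq_square algebra_simps)
  also have "Re (z * w) = N * cos (absarg (z * w))" by (simp add: N_def cos_absarg)
  also have "(norm z)\<^sup>2 + (norm w)\<^sup>2 = N * (exp (2 * x) + exp (- 2 * x))"
    using N by (simp add: nz nw power_mult_distrib ring_distribs exp_double[symmetric])
  also have "exp (2 * x) + exp (- 2 * x) = 4 * (sinh x)\<^sup>2 + 2"
    using exp_add[of x "-x"] by (simp add: sinh_def power2_eq_square algebra_simps flip: exp_add)
  finally have 1: "(norm (z + cnj w))\<^sup>2 = 4 * N * ((sinh x)\<^sup>2 + (cos (absarg (z * w) / 2))\<^sup>2)"
    unfolding cc by (simp add: algebra_simps)
  have 2: "norm z powr p + norm w powr p = N powr (p / 2) * (2 * cosh (p * x))" for p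
    unfolding nz nw using N
    by (simp add: powr_mult exp_powr_real cosh_def powr_half_sqrt[symmetric] powr_powr ring_distribs mult.commute)
  show thesis using that N N_def nz nw 1 2 by blast
qed

lemma norm_powr_eq_power2: "norm z powr p = ((norm z)\<^sup>2) powr (p / 2)"
  by (cases "norm z = 0") (simp_all add: powr_powr flip: powr_numeral)

text \<open>In polar coordinates, with \<open>y\<close> half the argument of
  \<open>- (z * w)\<close>, this is \<open>sinh_sin_powr_le\<close> multiplied by
  \<open>2 powr p * N powr (p / 2) * s powr (p - 1)\<close>. The degenerate case of a vanishing
  variable is \<open>one_le_sin_powr\<close>.\<close>

lemma norm_add_cnj_powr_le_lower:
  fixes p :: real and z w :: complex
  defines "s \<equiv> sin (pi / (2 * p))" and "c \<equiv> cos (pi / (2 * p))"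
  assumes p: "1 < p" "p \<le> 2"
  shows "norm (z + cnj w) powr p \<le> 2 powr (p - 1) * s powr p * (norm z powr p + norm w powr p)
    - 2 powr p * s powr (p - 1) * c * polar_fun (p / 2) (\<lambda>t. cos (p / 2 * t)) (- (z * w))"
proof (cases "z = 0 \<or> w = 0")
  case True
  have "norm z powr p * 1 \<le> norm z powr p * (2 powr (p - 1) * s powr p)"
       "norm w powr p * 1 \<le> norm w powr p * (2 powr (p - 1) * s powr p)"
    using one_le_sin_powr[OF p] unfolding s_def by (intro mult_left_mono; simp)+
  then show ?thesis using True by (auto simp: mult_ac)
next
  case False
  then have zw: "z \<noteq> 0" "w \<noteq> 0" by auto
  obtain x N where N: "N > 0" "N = norm (z * w)"
    and sq: "(norm (z + cnj w))\<^sup>2 = 4 * N * ((sinh x)\<^sup>2 + (cos (absarg (z * w) / 2))\<^sup>2)"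
    and sum: "\<And>p. norm z powr p + norm w powr p = N powr (p / 2) * (2 * cosh (p * x))"
    by (rule polar_coords_pair[OF zw]) blast
  define y where "y = absarg (- (z * w)) / 2"
  have y: "0 \<le> y" "y \<le> pi / 2" using absarg_bounds[of "- (z * w)"] by (auto simp: y_def)
  have "absarg (- (z * w)) = pi - absarg (z * w)"
    unfolding absarg_def using absarg_arg_bounds[of "z * w"] by (simp add: arccos_minus del: times_complex.sel)
  then have ay: "absarg (z * w) / 2 = pi / 2 - y" by (simp add: y_def field_simps)
  have cy: "cos (absarg (z * w) / 2) = sin y" unfolding ay by (simp add: cos_diff)
  have al: "0 < pi / (2 * p)" "pi / (2 * p) < pi / 2" using p by (auto simp: field_simps)
  then have s: "s > 0" and c: "c > 0" unfolding s_def c_def by (auto intro!: sin_gt_zero2 cos_gt_zero)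
  let ?A = "(sinh x)\<^sup>2 + (sin y)\<^sup>2"
  have main: "?A powr (p / 2) \<le> s powr (p - 1) * (s * cosh (p * x) - c * cos (p * y))"
  proof (cases "p = 2")
    \<comment> \<open>At the endpoint \<open>p = 2\<close> the strip inequality is an identity
      between double-angle formulas.\<close>
    case True
    have sc: "s * s = 1 / 2" "s * c = 1 / 2"
      by (simp_all add: True s_def c_def sin_45 cos_45 field_simps)
    have "s powr (p - 1) * (s * cosh (p * x) - c * cos (p * y)) = (s * s) * cosh (2 * x) - (s * c) * cos (2 * y)"
      using s by (simp add: True algebra_simps)
    also have "\<dots> = ?A"
      unfolding sc cosh_double cos_double_sin using cosh_square_eq[of x] by (simp add: field_simps)
    also have "?A = ?A powr (p / 2)" by (simp add: True)
    finally show ?thesis by simp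
  next
    case False
    then have "c * cos (p * y) + s powr (1 - p) * ?A powr (p / 2) \<le> s * cosh (p * x)"
      using sinh_sin_powr_le[of p y x] p y unfolding s_def c_def by simp
    then have "s powr (p - 1) * (s powr (1 - p) * ?A powr (p / 2)) \<le> s powr (p - 1) * (s * cosh (p * x) - c * cos (p * y))"
      by (intro mult_left_mono) auto
    then show ?thesis using s by (simp add: mult.assoc[symmetric] flip: powr_add)
  qed
  have "norm (z + cnj w) powr p = (4 * N * ?A) powr (p / 2)"
    unfolding norm_powr_eq_power2 sq cy ..
  also have "\<dots> = 2 powr p * N powr (p / 2) * ?A powr (p / 2)"
    using N powr_powr[of 2 2 "p / 2"] by (simp add: powr_mult)
  also have "\<dots> \<le> 2 powr p * N powr (p / 2) * (s powr (p - 1) * (s * cosh (p * x) - c * cos (p * y)))"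
    by (intro mult_left_mono main) auto
  also have "\<dots> = 2 powr (p - 1) * s powr p * (N powr (p / 2) * (2 * cosh (p * x)))
      - 2 powr p * s powr (p - 1) * c * (N powr (p / 2) * cos (p * y))"
    using s by (simp add: powr_diff field_simps)
  also have "N powr (p / 2) * cos (p * y) = polar_fun (p / 2) (\<lambda>t. cos (p / 2 * t)) (- (z * w))"
    by (simp add: polar_fun_def N y_def)
  finally show ?thesis unfolding sum .
qed

text \<open>The conjugate exponent \<open>q\<close> makes \<open>(|z|^q + |w|^q)^(p - 1)\<close>
  homogeneous of degree \<open>p\<close> in \<open>(z, w)\<close>, so that
  \<open>sinh_cos_powr_le\<close> applies in the same coordinates.\<close>

lemma norm_add_cnj_powr_le_upper:
  fixes p :: real and z w :: complex
  defines "s \<equiv> sin (pi / (2 * p))" and "c \<equiv> cos (pi / (2 * p))" and "q \<equiv> p / (p - 1)"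
  assumes p: "2 < p"
  shows "norm (z + cnj w) powr p \<le> 2 * c powr p * (norm z powr q + norm w powr q) powr (p - 1)
    - 2 powr p * c powr (p - 1) * s * polar_fun (p / 2) (\<lambda>t. - cos (min (p / 2 * t) pi)) (z * w)"
proof (cases "z = 0 \<or> w = 0")
  case True
  have qp: "q * (p - 1) = p" using p by (simp add: q_def)
  have "norm z powr p * 1 \<le> norm z powr p * (2 * c powr p)"
       "norm w powr p * 1 \<le> norm w powr p * (2 * c powr p)"
    using one_le_cos_powr[of p] p unfolding c_def by (intro mult_left_mono; simp)+
  then show ?thesis using True by (auto simp: mult_ac powr_powr qp)
next
  case False
  then have zw: "z \<noteq> 0" "w \<noteq> 0" by auto
  have qp: "q * (p - 1) = p" using p by (simp add: q_def)
  obtain x N where N: "N > 0" "N = norm (z * w)"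
    and sq: "(norm (z + cnj w))\<^sup>2 = 4 * N * ((sinh x)\<^sup>2 + (cos (absarg (z * w) / 2))\<^sup>2)"
    and sum: "\<And>p. norm z powr p + norm w powr p = N powr (p / 2) * (2 * cosh (p * x))"
    by (rule polar_coords_pair[OF zw]) blast
  \<comment> \<open>For arguments of \<open>z * w\<close> beyond \<open>2 * pi / p\<close> the
    right-hand side is frozen at \<open>y = pi / p\<close>; the left-hand side stays below its value
    there because the cosine decreases.\<close>
  define y where "y = min (absarg (z * w) / 2) (pi / p)"
  have y: "0 \<le> y" "y \<le> pi / p" using absarg_bounds[of "z * w"] p by (auto simp: y_def)
  have al: "0 < pi / (2 * p)" "pi / (2 * p) < pi / 2" using p by (auto simp: field_simps)
  then have s: "s > 0" and c: "c > 0" unfolding s_def c_def by (auto intro!: sin_gt_zero2 cos_gt_zero)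
  let ?B = "(sinh x)\<^sup>2 + (cos y)\<^sup>2"
  have "c powr (p - 1) * (c powr (1 - p) * ?B powr (p / 2)) \<le> c powr (p - 1) * (c * cosh (q * x) powr (p - 1) + s * cos (p * y))"
    using sinh_cos_powr_le[of p y x] p y unfolding s_def c_def q_def by (intro mult_left_mono) auto
  then have main: "?B powr (p / 2) \<le> c powr (p - 1) * (c * cosh (q * x) powr (p - 1) + s * cos (p * y))"
    using c by (simp add: mult.assoc[symmetric] flip: powr_add)
  have "cos (absarg (z * w) / 2) \<le> cos y" "0 \<le> cos (absarg (z * w) / 2)"
    using absarg_bounds[of "z * w"] y by (auto intro!: cos_monotone_0_pi_le cos_ge_zero simp: y_def min_def)
  then have "(norm (z + cnj w))\<^sup>2 \<le> 4 * N * ?B"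
    unfolding sq using N by (intro mult_left_mono add_left_mono power_mono) auto
  then have "norm (z + cnj w) powr p \<le> (4 * N * ?B) powr (p / 2)"
    unfolding norm_powr_eq_power2 using p by (intro powr_mono2) auto
  also have "\<dots> = 2 powr p * N powr (p / 2) * ?B powr (p / 2)"
    using N powr_powr[of 2 2 "p / 2"] by (simp add: powr_mult)
  also have "\<dots> \<le> 2 powr p * N powr (p / 2) * (c powr (p - 1) * (c * cosh (q * x) powr (p - 1) + s * cos (p * y)))"
    by (intro mult_left_mono main) auto
  also have "\<dots> = 2 * c powr p * (N powr (q / 2 * (p - 1)) * (2 powr (p - 1) * cosh (q * x) powr (p - 1)))
      - 2 powr p * c powr (p - 1) * s * (N powr (p / 2) * - cos (p * y))"
    using c by (simp add: powr_diff field_simps qp)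
  also have "N powr (q / 2 * (p - 1)) * (2 powr (p - 1) * cosh (q * x) powr (p - 1))
      = (N powr (q / 2) * (2 * cosh (q * x))) powr (p - 1)"
    by (simp add: powr_mult powr_powr)
  also have "N powr (p / 2) * - cos (p * y) = polar_fun (p / 2) (\<lambda>t. - cos (min (p / 2 * t) pi)) (z * w)"
  proof -
    have "p * y = min (p / 2 * absarg (z * w)) pi"
      using p by (auto simp: y_def min_def field_simps)
    then show ?thesis by (simp add: polar_fun_def N)
  qed
  finally show ?thesis unfolding sum .
qed

text \<open>Compactness replaces computation, as only some constant is wanted. Both sides have
  degree \<open>p\<close>, so the unit sphere suffices. The term \<open>|z + cnj w|^p\<close>
  vanishes only for \<open>w = - cnj z\<close>; there \<open>z * w\<close> is a negative number, and
  \<open>D = 2 / - g pi\<close> turns \<open>|z|^p + D * U (z * w)\<close> into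
  \<open>- |z|^p\<close>.\<close>

lemma riesz_pointwise:
  fixes p :: real
  assumes p: "p > 0" and g: "continuous_on {0..pi} g" "\<And>t. \<bar>g t\<bar> \<le> 1" "g pi < 0"
  obtains C D where "C \<ge> 0" "D \<ge> 0"
    "\<And>z w. norm z powr p \<le> C * norm (z + cnj w) powr p - D * polar_fun (p / 2) g (z * w)"
proof -
  define H where "H = polar_fun (p / 2) g"
  define D where "D = 2 / - g pi"
  have D: "D > 0" "D * g pi = - 2" using g by (auto simp: D_def field_simps)
  have H: "continuous_on UNIV H" unfolding H_def using p g by (intro continuous_on_polar_fun) auto
  define \<phi> where "\<phi> v = norm (fst v) powr p + D * H (fst v * snd v)" for v :: "complex \<times> complex"
  define \<psi> where "\<psi> v = norm (fst v + cnj (snd v)) powr p" for v :: "complex \<times> complex"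
  let ?S = "sphere (0 :: complex \<times> complex) 1"
  have cphi: "continuous_on UNIV \<phi>" unfolding \<phi>_def using p
    by (intro continuous_intros continuous_on_powr' continuous_on_compose2[OF H]) auto
  have cpsi: "continuous_on UNIV \<psi>" unfolding \<psi>_def using p
    by (intro continuous_intros continuous_on_powr') auto
  have scale: "\<phi> (of_real r * z, of_real r * w) = r powr p * \<phi> (z, w)"
    "\<psi> (of_real r * z, of_real r * w) = r powr p * \<psi> (z, w)" if r: "r > 0" for r z w
  proof -
    have "H (of_real r * z * (of_real r * w)) = H (of_real (r\<^sup>2) * (z * w))"
      by (simp add: power2_eq_square mult_ac)
    also have "\<dots> = (r\<^sup>2) powr (p / 2) * H (z * w)"
      unfolding H_def using r by (intro polar_fun_scale) auto
    also have "(r\<^sup>2) powr (p / 2) = r powr p" using r by (simp add: powr_powr flip: powr_numeral)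
    finally show "\<phi> (of_real r * z, of_real r * w) = r powr p * \<phi> (z, w)"
      using r by (simp add: \<phi>_def norm_mult powr_mult algebra_simps)
    have "norm (of_real r * z + cnj (of_real r * w)) = r * norm (z + cnj w)"
      using r by (simp add: norm_mult flip: ring_distribs)
    then show "\<psi> (of_real r * z, of_real r * w) = r powr p * \<psi> (z, w)"
      using r by (simp add: \<psi>_def powr_mult)
  qed
  have "compact (\<phi> ` ?S)" by (intro compact_continuous_image continuous_on_subset[OF cphi]) auto
  then obtain M where M: "\<And>v. v \<in> ?S \<Longrightarrow> \<phi> v \<le> M"
    by (meson bounded_has_Sup(1) bounded_imp_bdd_above bdd_above.E compact_imp_bounded imageI)
  \<comment> \<open>Only points with \<open>\<phi> \<ge> 0\<close> need a positive multiple of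
    \<open>\<psi>\<close>, and on this compact set \<open>\<psi>\<close> has a positive
    minimum.\<close>
  let ?K = "?S \<inter> {v. \<phi> v \<ge> 0}"
  have K: "compact ?K"
    by (intro compact_Int_closed closed_Collect_le cphi continuous_intros) auto
  have pos: "\<psi> v > 0" if v: "v \<in> ?K" for v
  proof (rule ccontr)
    obtain z w where zw: "v = (z, w)" by (cases v)
    assume "\<not> \<psi> v > 0"
    then have "z + cnj w = 0" by (auto simp: \<psi>_def zw)
    then have w: "w = - cnj z" by (metis add_eq_0_iff complex_cnj_cnj complex_cnj_minus)
    have z: "z \<noteq> 0" using v zw w by auto
    have "z * w = of_real ((norm z)\<^sup>2) * (- 1)" using complex_norm_square[of z] by (simp add: w)
    then have "H (z * w) = ((norm z)\<^sup>2) powr (p / 2) * H (- 1)"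
      unfolding H_def using polar_fun_scale[of "(norm z)\<^sup>2" "p / 2" g "- 1"] z by simp
    also have "H (- 1) = g pi" by (simp add: H_def polar_fun_def absarg_def)
    also have "((norm z)\<^sup>2) powr (p / 2) = norm z powr p" by (simp add: norm_powr_eq_power2[symmetric])
    finally have "\<phi> v = norm z powr p + norm z powr p * (D * g pi)" by (simp add: \<phi>_def zw)
    also have "\<dots> < 0" using z unfolding D by simp
    finally show False using v by simp
  qed
  obtain C where C: "C \<ge> 0" "\<And>v. v \<in> ?S \<Longrightarrow> \<phi> v \<le> C * \<psi> v"
  proof (cases "?K = {}")
    case True
    then have "\<phi> v \<le> 0 * \<psi> v" if "v \<in> ?S" for v using that by fastforce
    then show thesis using that[of 0] by simp
  next
    case False
    obtain v0 where v0: "v0 \<in> ?K" "\<And>v. v \<in> ?K \<Longrightarrow> \<psi> v0 \<le> \<psi> v"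
      using continuous_attains_inf[OF K False continuous_on_subset[OF cpsi]] by auto
    have M0: "M \<ge> 0" using M[of v0] v0(1) by auto
    have "\<phi> v \<le> M / \<psi> v0 * \<psi> v" if v: "v \<in> ?S" for v
    proof (cases "\<phi> v \<ge> 0")
      case True
      have "\<phi> v \<le> M / \<psi> v0 * \<psi> v0" using M[OF v] pos[OF v0(1)] by simp
      also have "\<dots> \<le> M / \<psi> v0 * \<psi> v"
        using v0(2)[of v] v True M0 pos[OF v0(1)] by (intro mult_left_mono) auto
      finally show ?thesis .
    next
      case False
      then show ?thesis using M0 pos[OF v0(1)] by (smt (verit) \<psi>_def divide_nonneg_pos powr_ge_zero zero_le_mult_iff)
    qed
    then show thesis using that[of "M / \<psi> v0"] M0 pos[OF v0(1)] by auto
  qed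
  have "norm z powr p \<le> C * norm (z + cnj w) powr p - D * H (z * w)" for z w
  proof (cases "(z, w) = 0")
    case True
    then show ?thesis by (auto simp: H_def zero_prod_def)
  next
    case False
    define r where "r = norm (z, w)"
    have r: "r > 0" using False by (simp add: r_def)
    define z' w' where "z' = of_real (1 / r) * z" and "w' = of_real (1 / r) * w"
    have zw: "z = of_real r * z'" "w = of_real r * w'" using r by (auto simp: z'_def w'_def)
    have "norm (z', w') = norm ((1 / r) *\<^sub>R (z, w))" by (simp add: z'_def w'_def scaleR_conv_of_real)
    also have "\<dots> = 1" unfolding norm_scaleR r_def[symmetric] using r by simp
    finally have "\<phi> (z', w') \<le> C * \<psi> (z', w')" by (intro C(2)) simp
    then have "r powr p * \<phi> (z', w') \<le> r powr p * (C * \<psi> (z', w'))" by (intro mult_left_mono) auto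
    then have "\<phi> (z, w) \<le> C * \<psi> (z, w)" unfolding zw scale[OF r] by (simp add: mult_ac)
    then show ?thesis by (simp add: \<phi>_def \<psi>_def)
  qed
  then show thesis using that[of C D] C D by (simp add: H_def)
qed

section \<open>Trigonometric polynomials on the circle\<close>

abbreviation circle_mean :: "(complex \<Rightarrow> 'a::{banach, second_countable_topology}) \<Rightarrow> 'a" where
  "circle_mean \<equiv> integral\<^sup>L circle_measure"

text \<open>On the circle \<open>cnj z\<close> is \<open>1 / z\<close>: these are the Laurent
  polynomials, written without division.\<close>

definition laurent_on_circle :: "(complex \<Rightarrow> complex) \<Rightarrow> bool" where
  "laurent_on_circle f \<longleftrightarrow> (\<exists>N Q. \<forall>z. norm z = 1 \<longrightarrow> f z = cnj z ^ N * poly Q z)"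

lemma cnj_power_mult_power: "norm z = 1 \<Longrightarrow> cnj z ^ n * z ^ n = 1"
  using complex_norm_square[of z] by (simp add: power_mult_distrib[symmetric] mult.commute)

lemma laurent_on_circle_const: "laurent_on_circle (\<lambda>_. c)"
  unfolding laurent_on_circle_def by (rule exI[of _ 0], rule exI[of _ "[:c:]"]) simp

lemma laurent_on_circle_id: "laurent_on_circle (\<lambda>z. z)"
  unfolding laurent_on_circle_def by (rule exI[of _ 0], rule exI[of _ "[:0, 1:]"]) simp

lemma laurent_on_circle_cnj: "laurent_on_circle cnj"
  unfolding laurent_on_circle_def by (rule exI[of _ 1], rule exI[of _ 1]) simp

lemma laurent_on_circle_mult:
  assumes "laurent_on_circle f" "laurent_on_circle g"
  shows "laurent_on_circle (\<lambda>z. f z * g z)"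
proof -
  from assms obtain N Q M R where "\<And>z. norm z = 1 \<Longrightarrow> f z = cnj z ^ N * poly Q z"
     "\<And>z. norm z = 1 \<Longrightarrow> g z = cnj z ^ M * poly R z" by (auto simp: laurent_on_circle_def)
  then show ?thesis unfolding laurent_on_circle_def
    by (intro exI[of _ "N + M"] exI[of _ "Q * R"]) (simp add: power_add mult_ac)
qed

lemma laurent_on_circle_add:
  assumes "laurent_on_circle f" "laurent_on_circle g"
  shows "laurent_on_circle (\<lambda>z. f z + g z)"
proof -
  from assms obtain N Q M R where *: "\<And>z. norm z = 1 \<Longrightarrow> f z = cnj z ^ N * poly Q z"
     "\<And>z. norm z = 1 \<Longrightarrow> g z = cnj z ^ M * poly R z" by (auto simp: laurent_on_circle_def)
  have "f z + g z = cnj z ^ (N + M) * poly (monom 1 M * Q + monom 1 N * R) z" if "norm z = 1" for z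
  proof -
    have "f z + g z = (cnj z ^ M * z ^ M) * (cnj z ^ N * poly Q z) + (cnj z ^ N * z ^ N) * (cnj z ^ M * poly R z)"
      using that by (simp add: * cnj_power_mult_power)
    then show ?thesis by (simp add: poly_monom power_add algebra_simps)
  qed
  then show ?thesis unfolding laurent_on_circle_def by blast
qed

lemma laurent_on_circle_real_polynomial:
  fixes f :: "complex \<Rightarrow> real"
  assumes "real_polynomial_function f"
  shows "laurent_on_circle (\<lambda>z. of_real (f z))"
  using assms
proof induction
  case (linear f)
  then interpret bounded_linear f .
  \<comment> \<open>A real linear form on the plane is a combination of \<open>z\<close> and
    \<open>cnj z\<close>; the coefficients come from \<open>Re z = (z + cnj z) / 2\<close> and
    \<open>Im z = (z - cnj z) / (2 * \<i>)\<close>.\<close>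
  define a b :: complex where "a = of_real (f 1) / 2 + - (\<i> / 2) * of_real (f \<i>)"
    and "b = of_real (f 1) / 2 + \<i> / 2 * of_real (f \<i>)"
  have eq: "of_real (f z) = z * a + cnj z * b" for z
  proof -
    have "z = Re z *\<^sub>R 1 + Im z *\<^sub>R \<i>" by (simp add: complex_eq_iff)
    then have "f z = f (Re z *\<^sub>R 1 + Im z *\<^sub>R \<i>)" by (rule arg_cong)
    then have "f z = Re z * f 1 + Im z * f \<i>" unfolding add scaleR by simp
    then show ?thesis by (simp add: a_def b_def complex_eq_iff algebra_simps)
  qed
  show ?case unfolding eq
    by (rule laurent_on_circle_add laurent_on_circle_mult laurent_on_circle_id laurent_on_circle_cnj
      laurent_on_circle_const)+
next
  case (const c)
  show ?case by (rule laurent_on_circle_const)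
next
  case (add f g)
  then show ?case unfolding of_real_add by (intro laurent_on_circle_add)
next
  case (mult f g)
  then show ?case unfolding of_real_mult by (intro laurent_on_circle_mult)
qed

text \<open>One more factor \<open>cnj z\<close> shifts the coefficients of \<open>F\<close> down;
  its constant term \<open>c\<close> becomes \<open>c * cnj z\<close> and moves to the conjugate
  part, which therefore never acquires a constant term.\<close>

lemma laurent_split:
  fixes Q :: "complex poly"
  obtains F G where "poly G 0 = 0" "\<And>z. norm z = 1 \<Longrightarrow> cnj z ^ N * poly Q z = poly F z + cnj (poly G z)"
proof -
  have "\<exists>F G. poly G 0 = 0 \<and> (\<forall>z. norm z = 1 \<longrightarrow> cnj z ^ N * poly Q z = poly F z + cnj (poly G z))"
  proof (induction N)
    case 0
    show ?case by (intro exI[of _ Q] exI[of _ 0]) simp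
  next
    case (Suc N)
    then obtain F G where FG: "poly G 0 = 0"
      "\<And>z. norm z = 1 \<Longrightarrow> cnj z ^ N * poly Q z = poly F z + cnj (poly G z)" by blast
    obtain c F' where F: "F = pCons c F'" by (cases F)
    have "cnj z ^ Suc N * poly Q z = poly F' z + cnj (poly (pCons 0 (G + [:cnj c:])) z)" if "norm z = 1" for z
    proof -
      have "cnj z ^ Suc N * poly Q z = cnj z * c + (cnj z ^ 1 * z ^ 1) * poly F' z + cnj z * cnj (poly G z)"
        using FG(2)[OF that] by (simp add: F algebra_simps)
      then show ?thesis unfolding cnj_power_mult_power[OF that] by (simp add: algebra_simps)
    qed
    then show ?case by (intro exI[of _ F'] exI[of _ "pCons 0 (G + [:cnj c:])"]) auto
  qed
  then show thesis using that by blast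
qed

lemma trig_polynomial_approx:
  fixes f :: "complex \<Rightarrow> complex"
  assumes "continuous_on (sphere 0 1) f" "e > 0"
  obtains F G where "poly G 0 = 0"
    "\<And>z. norm z = 1 \<Longrightarrow> norm (f z - (poly F z + cnj (poly G z))) < e"
proof -
  obtain g where g: "polynomial_function g" "\<And>z. z \<in> sphere 0 1 \<Longrightarrow> norm (f z - g z) < e"
    using Stone_Weierstrass_polynomial_function[OF compact_sphere assms] by blast
  have "real_polynomial_function (Re \<circ> g)" "real_polynomial_function (Im \<circ> g)"
    using g(1) unfolding polynomial_function_def by (auto simp: bounded_linear_Re bounded_linear_Im)
  from this[THEN laurent_on_circle_real_polynomial]
  have "laurent_on_circle (\<lambda>z. of_real (Re (g z)) + \<i> * of_real (Im (g z)))"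
    by (intro laurent_on_circle_add laurent_on_circle_mult laurent_on_circle_const) (simp_all add: o_def)
  then have "laurent_on_circle g" by (simp flip: complex_eq)
  then obtain N Q where NQ: "\<And>z. norm z = 1 \<Longrightarrow> g z = cnj z ^ N * poly Q z"
    by (auto simp: laurent_on_circle_def)
  obtain F G where "poly G 0 = 0" "\<And>z. norm z = 1 \<Longrightarrow> cnj z ^ N * poly Q z = poly F z + cnj (poly G z)"
    using laurent_split[of N Q] by blast
  then show thesis using NQ g(2) by (intro that[of G F]) auto
qed

lemma borel_measurable_circle_continuous:
  fixes f :: "complex \<Rightarrow> 'a::topological_space"
  assumes "continuous_on (sphere 0 1) f"
  shows "f \<in> borel_measurable circle_measure"
proof -
  have "sets circle_measure = sets (restrict_space borel (sphere 0 1))" by (simp add: circle_measure_def)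
  then show ?thesis using borel_measurable_continuous_on_restrict[OF assms] by (simp cong: measurable_cong_sets)
qed

lemma integrable_circle_continuous:
  fixes f :: "complex \<Rightarrow> 'a::{banach, second_countable_topology}"
  assumes "continuous_on (sphere 0 1) f"
  shows "integrable circle_measure f"
proof -
  interpret prob_space circle_measure by (rule prob_space_circle_measure)
  have "compact (f ` sphere 0 1)" by (intro compact_continuous_image assms) simp
  then obtain B where "\<And>x. x \<in> sphere 0 1 \<Longrightarrow> norm (f x) \<le> B"
    by (meson bounded_iff compact_imp_bounded imageI)
  then show ?thesis
    by (intro integrable_const_bound[of _ B] borel_measurable_circle_continuous assms AE_I2) (simp add: space_circle_measure)
qed

lemma integral_circle_power:
  assumes "n > 0"
  shows "circle_mean (\<lambda>w. w ^ n) = (0 :: complex)"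
proof -
  have c: "continuous_on (sphere 0 1) (\<lambda>w::complex. w ^ n)" by (intro continuous_intros)
  have "(LBINT t:{0..2*pi}. cis t ^ n) = (\<integral>t. indicator {0..2*pi} t *\<^sub>R cis (real n * t) \<partial>lborel)"
    unfolding set_lebesgue_integral_def Complex.DeMoivre ..
  also have "\<dots> = cis (real n * (2 * pi)) / (\<i> * of_nat n) - cis (real n * 0) / (\<i> * of_nat n)"
  proof (rule integral_FTC_Icc)
    fix x :: real
    have "((\<lambda>z. exp (\<i> * of_nat n * z) / (\<i> * of_nat n)) has_field_derivative exp (\<i> * of_nat n * of_real x)) (at (of_real x))"
      using assms by (auto intro!: derivative_eq_intros)
    from has_vector_derivative_real_field[OF this, of UNIV]
    have "((\<lambda>t. cis (real n * t) / (\<i> * of_nat n)) has_vector_derivative cis (real n * x)) (at x)"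
      by (simp add: cis_conv_exp mult.assoc)
    then show "((\<lambda>t. cis (real n * t) / (\<i> * of_nat n)) has_vector_derivative cis (real n * x)) (at x within {0..2*pi})"
      by (rule has_vector_derivative_at_within)
  qed (auto intro!: continuous_intros)
  also have "cis (real n * (2 * pi)) = 1"
    using cis_multiple_2pi[of "real n"] by (simp add: mult_ac)
  finally show ?thesis
    by (simp add: integral_circle_measure borel_measurable_circle_continuous[OF c])
qed

lemma integral_circle_poly: "circle_mean (\<lambda>z. poly F z) = poly F (0::complex)"
proof (induction F)
  case 0
  then show ?case by simp
next
  case (pCons a F)
  interpret prob_space circle_measure by (rule prob_space_circle_measure)
  have *: "circle_mean (\<lambda>z. z * poly F z) = 0"
  proof -
    have "circle_mean (\<lambda>z. z * poly F z) = circle_mean (\<lambda>z. (\<Sum>i\<le>degree F. coeff F i * z ^ Suc i))"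
      by (simp add: poly_altdef sum_distrib_left mult_ac)
    also have "\<dots> = (\<Sum>i\<le>degree F. (circle_mean (\<lambda>z. coeff F i * z ^ Suc i)))"
      by (intro Bochner_Integration.integral_sum integrable_circle_continuous continuous_intros)
    also have "\<dots> = 0" by (simp add: integral_circle_power del: power_Suc)
    finally show ?thesis .
  qed
  have "circle_mean (\<lambda>z. poly (pCons a F) z) = circle_mean (\<lambda>z. a) + circle_mean (\<lambda>z. z * poly F z)"
    unfolding poly_pCons
    by (intro Bochner_Integration.integral_add integrable_circle_continuous continuous_intros)
  then show ?case unfolding * using prob_space by simp
qed

section \<open>Submean value property\<close>

text \<open>A stand-in for subharmonicity: the mean value property of \<open>Re \<phi>\<close>
  yields the submean inequality of \<open>U\<close> on small circles about \<open>u0\<close>. A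
  function with kinks can be treated point by point, with a different \<open>\<phi>\<close> at each
  point.\<close>

definition touched_below :: "(complex \<Rightarrow> real) \<Rightarrow> complex \<Rightarrow> bool" where
  "touched_below U u0 \<longleftrightarrow> (\<exists>r \<phi>. r > 0 \<and> \<phi> holomorphic_on ball u0 r \<and> Re (\<phi> u0) = U u0 \<and>
     (\<forall>u \<in> ball u0 r. Re (\<phi> u) \<le> U u))"

lemma norm_diff_power2: "(norm (z - w))\<^sup>2 = (norm z)\<^sup>2 - 2 * Re (cnj w * z) + (norm w)\<^sup>2"
  unfolding cmod_power2 by (simp add: power2_eq_square algebra_simps)

text \<open>The boundary values of \<open>U \<circ> h\<close> are uniformly close to the real part of a polynomial \<open>T\<close>, by
  the Stone--Weierstrass theorem. An interior maximum of \<open>U \<circ> h - Re T + e |z|\<^sup>2\<close> would make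
  \<open>exp\<close> of a holomorphic function violate the maximum modulus principle.\<close>

lemma touched_below_submean:
  fixes U :: "complex \<Rightarrow> real"
  assumes U: "continuous_on UNIV U" and touch: "\<And>u. touched_below U u"
  shows "U (poly h 0) \<le> circle_mean (\<lambda>x. U (poly h x))"
proof (rule field_le_epsilon)
  fix e' :: real assume "e' > 0"
  define e where "e = e' / 3"
  have e: "e > 0" using \<open>e' > 0\<close> by (simp add: e_def)
  interpret prob_space circle_measure by (rule prob_space_circle_measure)
  have Uh: "continuous_on A (\<lambda>z. U (poly h z))" for A
    by (intro continuous_on_compose2[OF U] continuous_intros) auto
  obtain F G where "poly G 0 = 0"
    and FG: "\<And>x. norm x = 1 \<Longrightarrow> norm (of_real (U (poly h x)) - (poly F x + cnj (poly G x))) < e"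
    by (rule trig_polynomial_approx[of "\<lambda>x. of_real (U (poly h x))" e]) (use e in \<open>auto intro!: continuous_intros Uh\<close>)
  \<comment> \<open>Conjugating the second summand does not change its real part, so the
    trigonometric polynomial may be replaced by a holomorphic one.\<close>
  define T where "T = F + G"
  have T: "\<bar>U (poly h x) - Re (poly T x)\<bar> < e" if "norm x = 1" for x
    using abs_Re_le_cmod[of "of_real (U (poly h x)) - (poly F x + cnj (poly G x))"] FG[OF that]
    by (simp add: T_def)
  have mean: "Re (poly T 0) - e \<le> circle_mean (\<lambda>x. U (poly h x))"
  proof -
    have "circle_mean (\<lambda>x. Re (poly T x) - e) \<le> circle_mean (\<lambda>x. U (poly h x))"
    proof (intro integral_mono integrable_circle_continuous Uh continuous_intros)
      fix x assume "x \<in> space circle_measure"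
      then show "Re (poly T x) - e \<le> U (poly h x)" using T[of x] by (simp add: space_circle_measure)
    qed
    also have "circle_mean (\<lambda>x. Re (poly T x) - e) = circle_mean (\<lambda>x. Re (poly T x)) - e"
      using prob_space by (subst Bochner_Integration.integral_diff)
         (auto intro!: integrable_circle_continuous continuous_intros)
    also have "circle_mean (\<lambda>x. Re (poly T x)) = Re (poly T 0)"
      by (subst integral_Re) (auto intro!: integrable_circle_continuous continuous_intros simp: integral_circle_poly)
    finally show ?thesis .
  qed
  define v where "v z = U (poly h z) - Re (poly T z) + e * (norm z)\<^sup>2" for z
  have "continuous_on (cball 0 1) v" unfolding v_def by (intro continuous_intros Uh)
  then obtain z0 where z0: "norm z0 \<le> 1" "\<And>z. norm z \<le> 1 \<Longrightarrow> v z \<le> v z0"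
    using continuous_attains_sup[of "cball (0::complex) 1" v] by auto
  have "norm z0 = 1"
  proof (rule ccontr)
    assume "norm z0 \<noteq> 1"
    then have z0': "norm z0 < 1" using z0 by simp
    obtain r \<phi> where r: "r > 0" and \<phi>: "\<phi> holomorphic_on ball (poly h z0) r"
      "Re (\<phi> (poly h z0)) = U (poly h z0)" "\<And>u. u \<in> ball (poly h z0) r \<Longrightarrow> Re (\<phi> u) \<le> U u"
      using touch[of "poly h z0"] unfolding touched_below_def by blast
    have "isCont (poly h) z0" by simp
    then obtain d where d: "d > 0" "\<And>z. dist z z0 < d \<Longrightarrow> dist (poly h z) (poly h z0) < r"
      using r unfolding continuous_at_eps_delta by (auto simp: dist_norm)
    define \<delta> where "\<delta> = min d (1 - norm z0)"
    have \<delta>: "\<delta> > 0" using d z0' by (simp add: \<delta>_def)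
    have sub: "poly h z \<in> ball (poly h z0) r" "norm z \<le> 1" if "z \<in> ball z0 \<delta>" for z
      using that d(2)[of z] norm_triangle_ineq[of z0 "z - z0"]
      by (auto simp: \<delta>_def dist_commute dist_norm norm_minus_commute)
    \<comment> \<open>The last term is the holomorphic part of \<open>e * |z|^2\<close> at
      \<open>z0\<close>: on the level of real parts, \<open>e * |z|^2 = e * |z - z0|^2 + 2 * e * Re
      (cnj z0 * z) - e * |z0|^2\<close>. What is left over makes the maximum of \<open>Re G\<close>
      at \<open>z0\<close> strict.\<close>
    define G where "G z = \<phi> (poly h z) - poly T z + 2 * of_real e * cnj z0 * z" for z
    have holG: "G holomorphic_on ball z0 \<delta>"
      unfolding G_def using sub
      by (intro holomorphic_intros holomorphic_on_compose_gen[OF _ \<phi>(1), unfolded o_def]) auto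
    have Gle: "Re (G z) + e * (norm (z - z0))\<^sup>2 \<le> Re (G z0)" if z: "z \<in> ball z0 \<delta>" for z
    proof -
      have "v z \<le> v z0" using z0(2) sub[OF z] by blast
      moreover have "Re (\<phi> (poly h z)) \<le> U (poly h z)" using \<phi>(3) sub[OF z] by blast
      moreover have "e * (norm (z - z0))\<^sup>2 = e * (norm z)\<^sup>2 - Re (2 * of_real e * cnj z0 * z) + e * (norm z0)\<^sup>2"
        unfolding norm_diff_power2 by (simp add: algebra_simps)
      moreover have "Re (2 * of_real e * cnj z0 * z0) = 2 * (e * (norm z0)\<^sup>2)"
        unfolding cmod_power2 by (simp add: power2_eq_square algebra_simps)
      ultimately show ?thesis unfolding v_def G_def minus_complex.sel plus_complex.sel \<phi>(2) by linarith
    qed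
    have "(\<lambda>z. exp (G z)) constant_on ball z0 \<delta>"
    proof (rule maximum_modulus_principle[where U = "ball z0 \<delta>" and \<xi> = z0])
      fix z assume z: "z \<in> ball z0 \<delta>"
      have "0 \<le> e * (norm (z - z0))\<^sup>2" using e by simp
      then show "norm (exp (G z)) \<le> norm (exp (G z0))" using Gle[OF z] by simp
    qed (use \<delta> in \<open>auto intro!: holomorphic_intros holG\<close>)
    then have "exp (G (z0 + of_real (\<delta> / 2))) = exp (G z0)"
      using \<delta> unfolding constant_on_def by (auto simp: dist_norm norm_divide)
    then have "norm (exp (G (z0 + of_real (\<delta> / 2)))) = norm (exp (G z0))" by simp
    then have "Re (G (z0 + of_real (\<delta> / 2))) = Re (G z0)" by simp
    moreover have "z0 + of_real (\<delta> / 2) \<in> ball z0 \<delta>" using \<delta> by (simp add: dist_norm norm_divide)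
    from Gle[OF this] have "Re (G (z0 + of_real (\<delta> / 2))) + e * (norm (of_real (\<delta> / 2) :: complex))\<^sup>2 \<le> Re (G z0)"
      by simp
    moreover have "e * (norm (of_real (\<delta> / 2) :: complex))\<^sup>2 > 0" using e \<delta> by simp
    ultimately show False by linarith
  qed
  then have "v 0 \<le> e + e" using z0(2)[of 0] T[of z0] by (simp add: v_def)
  then have "U (poly h 0) \<le> Re (poly T 0) + 2 * e" by (simp add: v_def)
  then show "U (poly h 0) \<le> circle_mean (\<lambda>x. U (poly h x)) + e'"
    using mean by (simp add: e_def)
qed

lemma touched_below_mono:
  assumes "touched_below U u" "U u = V u" "\<And>u. U u \<le> V u"
  shows "touched_below V u"
  using assms unfolding touched_below_def by (metis order_trans)

text \<open>A homogeneous function need not be touched from below at \<open>0\<close>, so near \<open>0\<close> it is replaced by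
  its maximum with a linear function.\<close>

lemma polar_fun_mean_nonneg:
  assumes a: "a > 0" and g: "continuous_on {0..pi} g" "\<And>t. \<bar>g t\<bar> \<le> 1"
    and touch: "\<And>u. u \<noteq> 0 \<Longrightarrow> touched_below (polar_fun a g) u"
    and \<sigma>: "\<bar>\<sigma>\<bar> \<le> 1" "\<And>t. t \<in> {0..pi} \<Longrightarrow> \<sigma> * cos t \<le> g t"
    and h: "poly h 0 = 0"
  shows "0 \<le> circle_mean (\<lambda>z. polar_fun a g (poly h z))"
proof (rule field_le_epsilon)
  fix e :: real assume e: "e > 0"
  interpret prob_space circle_measure by (rule prob_space_circle_measure)
  let ?U = "polar_fun a g"
  have U: "continuous_on A ?U" for A using continuous_on_polar_fun[OF a g] continuous_on_subset by blast
  \<comment> \<open>Inside the disc of radius \<open>\<delta>\<close> both competing functions are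
    at most \<open>\<delta> powr a\<close> in absolute value, so the replacement costs at most
    \<open>2 * \<delta> powr a = e\<close>.\<close>
  define \<delta> where "\<delta> = (e / 2) powr (1 / a)"
  have \<delta>: "\<delta> > 0" using e by (simp add: \<delta>_def)
  have \<delta>a: "2 * \<delta> powr a = e" using e a by (simp add: \<delta>_def powr_powr)
  \<comment> \<open>With this slope, \<open>c * Re u\<close> equals
    \<open>\<delta> powr a * \<sigma> * cos (absarg u)\<close> on \<open>|u| = \<delta>\<close>,
    which lies below \<open>polar_fun a g u\<close>; hence \<open>V\<close> is continuous across
    that circle.\<close>
  define c where "c = \<sigma> * \<delta> powr (a - 1)"
  define V where "V u = (if norm u \<le> \<delta> then max (?U u) (c * Re u) else ?U u)" for u
  have edge: "c * Re u \<le> ?U u" if "norm u = \<delta>" for u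
  proof -
    have "Re u = \<delta> * cos (absarg u)" using cos_absarg[of u] that by simp
    then have "c * Re u = \<delta> powr a * (\<sigma> * cos (absarg u))"
      using \<delta> by (simp add: c_def powr_diff)
    also have "\<dots> \<le> \<delta> powr a * g (absarg u)" using \<sigma>(2) absarg_bounds by (intro mult_left_mono) auto
    finally show ?thesis by (simp add: polar_fun_def that)
  qed
  have UV: "?U u \<le> V u" for u by (simp add: V_def)
  have V: "continuous_on UNIV V"
    unfolding V_def
  proof (rule continuous_on_cases_le)
    show "continuous_on {u \<in> UNIV. norm u \<le> \<delta>} (\<lambda>u. max (?U u) (c * Re u))"
      by (intro continuous_on_max continuous_intros U)
    show "max (?U u) (c * Re u) = ?U u" if "norm u = \<delta>" for u using edge[OF that] by simp
  qed (intro continuous_intros U)+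
  have lin: "touched_below V u" if "norm u < \<delta>" "V u = c * Re u" for u
    unfolding touched_below_def
  proof (intro exI conjI ballI)
    show "\<delta> - norm u > 0" using that by simp
    show "(\<lambda>u. of_real c * u) holomorphic_on ball u (\<delta> - norm u)" by (intro holomorphic_intros)
    show "Re (of_real c * u) = V u" using that by simp
    fix w assume "w \<in> ball u (\<delta> - norm u)"
    then have "norm w < \<delta>" using norm_triangle_ineq[of u "w - u"] by (simp add: dist_norm norm_minus_commute)
    then show "Re (of_real c * w) \<le> V w" by (simp add: V_def)
  qed
  have "touched_below V u" for u
  proof (cases "u = 0")
    case True
    then show ?thesis using \<delta> by (intro lin) (auto simp: V_def)
  next
    case False
    show ?thesis
    proof (cases "V u = ?U u")
      case True
      then show ?thesis using touched_below_mono[OF touch[OF False]] UV by simp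
    next
      case False
      then have "norm u \<le> \<delta>" "V u = c * Re u" by (auto simp: V_def max_def split: if_splits)
      moreover have "norm u \<noteq> \<delta>" using False edge by (auto simp: V_def)
      ultimately show ?thesis by (intro lin) auto
    qed
  qed
  from touched_below_submean[OF V this, of h]
  have "0 \<le> circle_mean (\<lambda>z. V (poly h z))" using \<delta> by (simp add: h V_def)
  also have "\<dots> \<le> circle_mean (\<lambda>z. ?U (poly h z) + e)"
  proof (intro integral_mono integrable_circle_continuous continuous_on_compose2[OF V] continuous_intros
       continuous_on_compose2[OF U[of UNIV]])
    fix z :: complex
    let ?u = "poly h z"
    show "V ?u \<le> ?U ?u + e"
    proof (cases "norm ?u \<le> \<delta>")
      case True
      have "\<bar>?U ?u\<bar> \<le> norm ?u powr a" by (rule abs_polar_fun_le[OF g(2)])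
      also have "\<dots> \<le> \<delta> powr a" using True a by (intro powr_mono2) auto
      finally have 1: "\<bar>?U ?u\<bar> \<le> \<delta> powr a" .
      have "\<bar>c * Re ?u\<bar> = \<bar>\<sigma>\<bar> * (\<delta> powr (a - 1) * \<bar>Re ?u\<bar>)" by (simp add: c_def abs_mult)
      also have "\<dots> \<le> 1 * (\<delta> powr (a - 1) * \<delta>)"
        using \<sigma>(1) abs_Re_le_cmod[of ?u] True by (intro mult_mono) auto
      also have "\<dots> = \<delta> powr a" using \<delta> by (simp add: powr_diff)
      finally have "\<bar>c * Re ?u\<bar> \<le> \<delta> powr a" .
      then show ?thesis using 1 \<delta>a e True by (simp add: V_def)
    qed (use e in \<open>simp add: V_def\<close>)
  qed auto
  also have "\<dots> = circle_mean (\<lambda>z. ?U (poly h z)) + e"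
    using prob_space by (subst Bochner_Integration.integral_add)
      (auto intro!: integrable_circle_continuous continuous_intros continuous_on_compose2[OF U[of UNIV]])
  finally show "0 \<le> circle_mean (\<lambda>z. ?U (poly h z)) + e" .
qed

section \<open>Touching functions for the two choices of \<open>U\<close>\<close>

lemma absarg_eq_abs_Im_Ln:
  assumes "u \<noteq> 0"
  shows "absarg u = \<bar>Im (Ln u)\<bar>"
proof -
  have "u = exp (Ln u)" using assms by simp
  then have "Re u = norm u * cos (Im (Ln u))" by (metis Re_exp norm_exp_eq_Re)
  then have "absarg u = arccos (cos (Im (Ln u)))" using assms by (simp add: absarg_def)
  also have "\<dots> = \<bar>Im (Ln u)\<bar>"
    using assms Im_Ln_le_pi[of u] mpi_less_Im_Ln[of u] by (intro arccos_cos_eq_abs) auto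
  finally show ?thesis .
qed

lemma Re_exp_mult_Ln:
  assumes "u \<noteq> 0"
  shows "Re (exp (of_real a * Ln u)) = norm u powr a * cos (a * absarg u)"
proof -
  have "cos (a * absarg u) = cos (a * Im (Ln u))"
    using assms by (simp add: absarg_eq_abs_Im_Ln abs_if)
  then show ?thesis using assms by (simp add: Re_exp powr_def)
qed

lemma absarg_eq_pi:
  assumes "u \<noteq> 0" "u \<in> \<real>\<^sub>\<le>\<^sub>0"
  shows "absarg u = pi"
proof -
  from assms have "u = of_real (Re u)" "Re u < 0" by (auto simp: complex_nonpos_Reals_iff complex_eq_iff)
  then have "Re u / norm u = - 1" by (metis abs_of_neg divide_minus_left divide_self less_irrefl minus_divide_right norm_of_real)
  then show ?thesis by (simp add: absarg_def)
qed

lemma absarg_minus: "absarg (- u) = pi - absarg u"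
  unfolding absarg_def using absarg_arg_bounds[of u] by (simp add: arccos_minus)

lemma ball_subset_compl_nonpos_Reals:
  fixes u :: complex
  assumes "u \<notin> \<real>\<^sub>\<le>\<^sub>0"
  obtains r where "r > 0" "ball u r \<subseteq> - \<real>\<^sub>\<le>\<^sub>0"
proof -
  have "open (- \<real>\<^sub>\<le>\<^sub>0 :: complex set)" "u \<in> - \<real>\<^sub>\<le>\<^sub>0" using assms by (auto simp: open_Compl)
  then show thesis by (rule openE) (rule that)
qed

text \<open>Off the negative axis \<open>U\<close> is itself the real part of
  \<open>u powr a\<close>. On that axis the branch built from \<open>Ln (- u) + \<i> * pi\<close> is
  taken: it agrees with \<open>U\<close> on one side of the cut and lies below \<open>U\<close> on
  the other, where the difference is \<open>2 * sin (a * pi) * sin (a * \<tau>) \<ge> 0\<close>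
  times a power of \<open>|u|\<close>, thanks to \<open>a \<le> 1\<close>.\<close>

lemma touched_below_cos:
  assumes a: "0 < a" "a \<le> 1" and u0: "u0 \<noteq> 0"
  shows "touched_below (polar_fun a (\<lambda>t. cos (a * t))) u0"
proof (cases "u0 \<in> \<real>\<^sub>\<le>\<^sub>0")
  case False
  then obtain r where r: "r > 0" "ball u0 r \<subseteq> - \<real>\<^sub>\<le>\<^sub>0" by (rule ball_subset_compl_nonpos_Reals)
  have eq: "Re (exp (of_real a * Ln u)) = polar_fun a (\<lambda>t. cos (a * t)) u" if "u \<in> ball u0 r" for u
  proof -
    have "u \<noteq> 0" using r(2) that by (metis ComplD nonpos_Reals_zero_I subsetD)
    then show ?thesis by (simp add: Re_exp_mult_Ln polar_fun_def)
  qed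
  show ?thesis unfolding touched_below_def
    by (intro exI[of _ r] exI[of _ "\<lambda>u. exp (of_real a * Ln u)"] conjI ballI holomorphic_intros)
       (use r eq in auto)
next
  case True
  let ?\<phi> = "\<lambda>u. exp (of_real a * (Ln (- u) + \<i> * of_real pi))"
  have nonpos: "- u \<notin> \<real>\<^sub>\<le>\<^sub>0" "u \<noteq> 0" if "u \<in> ball u0 (norm u0)" for u
  proof -
    from True have "u0 = of_real (Re u0)" "Re u0 \<le> 0" by (auto simp: complex_nonpos_Reals_iff complex_eq_iff)
    then have "Re u0 = - norm u0" by (metis abs_of_nonpos minus_minus norm_of_real)
    then have "Re u < 0" using that abs_Re_le_cmod[of "u - u0"] by (auto simp: dist_norm norm_minus_commute)
    then show "- u \<notin> \<real>\<^sub>\<le>\<^sub>0" "u \<noteq> 0" by (auto simp: complex_nonpos_Reals_iff)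
  qed
  have Re\<phi>: "Re (?\<phi> u) = norm u powr a * cos (a * (Im (Ln (- u)) + pi))" if "u \<noteq> 0" for u
    using that by (simp add: Re_exp powr_def algebra_simps)
  have le: "cos (a * (\<tau> + pi)) \<le> cos (a * (pi - \<bar>\<tau>\<bar>))" if "\<bar>\<tau>\<bar> \<le> pi" for \<tau>
  proof (cases "\<tau> \<le> 0")
    case True
    then show ?thesis by (simp add: add.commute)
  next
    case False
    have "sin (a * pi) * sin (a * \<tau>) \<ge> 0"
      using a False that mult_mono[of a 1 \<tau> pi] by (intro mult_nonneg_nonneg sin_ge_zero) auto
    then show ?thesis using False by (simp add: ring_distribs cos_add cos_diff)
  qed
  show ?thesis unfolding touched_below_def
  proof (intro exI[of _ "norm u0"] exI[of _ ?\<phi>] conjI ballI)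
    show "?\<phi> holomorphic_on ball u0 (norm u0)" using nonpos by (intro holomorphic_intros) auto
    have "Im (Ln (- u0)) = 0"
      using absarg_eq_abs_Im_Ln[of "- u0"] absarg_minus[of u0] absarg_eq_pi[OF u0 True] u0 by simp
    then show "Re (?\<phi> u0) = polar_fun a (\<lambda>t. cos (a * t)) u0"
      unfolding Re\<phi>[OF u0] by (simp add: polar_fun_def absarg_eq_pi[OF u0 True])
    fix u assume u: "u \<in> ball u0 (norm u0)"
    have "absarg u = pi - \<bar>Im (Ln (- u))\<bar>" "\<bar>Im (Ln (- u))\<bar> \<le> pi"
      using absarg_minus[of u] absarg_eq_abs_Im_Ln[of "- u"] absarg_bounds[of u] nonpos[OF u] by auto
    then show "Re (?\<phi> u) \<le> polar_fun a (\<lambda>t. cos (a * t)) u"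
      unfolding Re\<phi>[OF nonpos(2)[OF u]] polar_fun_def by (auto intro!: mult_left_mono le)
  qed (use u0 in auto)
qed

text \<open>Angular distance obeys the triangle inequality: \<open>v\<close> is \<open>u\<close>
  divided by \<open>u / v\<close>, and
  \<open>arccos (cos \<theta>) \<le> \<bar>\<theta>\<bar>\<close>.\<close>

lemma absarg_triangle:
  assumes "u \<noteq> 0" "v \<noteq> 0"
  shows "absarg v \<le> absarg u + absarg (u / v)"
proof -
  have "v = exp (Ln u - Ln (u / v))" using assms by (simp add: exp_diff)
  then have "Re v = norm v * cos (Im (Ln u - Ln (u / v)))" by (metis Re_exp norm_exp_eq_Re)
  then have *: "absarg v = arccos (cos (Im (Ln u) - Im (Ln (u / v))))" using assms by (simp add: absarg_def)
  have "arccos (cos \<theta>) \<le> \<bar>\<theta>\<bar>" for \<theta> :: real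
  proof (cases "\<bar>\<theta>\<bar> \<le> pi")
    case False
    then show ?thesis using arccos_ubound[of "cos \<theta>"] by simp
  qed (simp add: arccos_cos_eq_abs)
  from this[of "Im (Ln u) - Im (Ln (u / v))"] show ?thesis
    unfolding * using assms by (simp add: absarg_eq_abs_Im_Ln)
qed

lemma touched_below_neg_cos_min:
  assumes b: "1 \<le> b" and u0: "u0 \<noteq> 0"
  shows "touched_below (polar_fun b (\<lambda>t. - cos (min (b * t) pi))) u0"
proof (cases "b * absarg u0 < pi")
  case True
  have "1 * absarg u0 \<le> b * absarg u0" using b absarg_bounds by (intro mult_right_mono) auto
  then have "u0 \<notin> \<real>\<^sub>\<le>\<^sub>0" using True absarg_eq_pi[OF u0] by auto
  then obtain r where r: "r > 0" "ball u0 r \<subseteq> - \<real>\<^sub>\<le>\<^sub>0" by (rule ball_subset_compl_nonpos_Reals)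
  show ?thesis unfolding touched_below_def
  proof (intro exI[of _ r] exI[of _ "\<lambda>u. - exp (of_real b * Ln u)"] conjI ballI holomorphic_intros)
    show "Re (- exp (of_real b * Ln u0)) = polar_fun b (\<lambda>t. - cos (min (b * t) pi)) u0"
      using True u0 Re_exp_mult_Ln[OF u0, of b] by (simp add: polar_fun_def)
    fix u assume "u \<in> ball u0 r"
    then have "u \<noteq> 0" using r(2) by (metis ComplD nonpos_Reals_zero_I subsetD)
    moreover have "- cos (b * absarg u) \<le> - cos (min (b * absarg u) pi)"
      by (simp add: min_def)
    ultimately show "Re (- exp (of_real b * Ln u)) \<le> polar_fun b (\<lambda>t. - cos (min (b * t) pi)) u"
      using Re_exp_mult_Ln[of u b] mult_left_mono[of "- cos (b * absarg u)" "- cos (min (b * absarg u) pi)" "norm u powr b"]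
      by (simp add: polar_fun_def)
  qed (use r in auto)
next
  case False
  let ?\<phi> = "\<lambda>u. of_real (norm u0 powr b) * exp (of_real b * Ln (u / u0))"
  have "isCont (\<lambda>u. Im (Ln (u / u0))) u0"
    by (intro continuous_Im isCont_o2[OF _ continuous_at_Ln]) (use u0 in \<open>auto intro!: continuous_intros\<close>)
  moreover have "Im (Ln (u0 / u0)) = 0" using u0 by simp
  \<comment> \<open>The bound \<open>pi / b\<close> keeps \<open>b * absarg (u / u0)\<close> in the
    range where the cosine decreases.\<close>
  ultimately obtain d where d: "d > 0" "\<And>u. dist u u0 < d \<Longrightarrow> \<bar>Im (Ln (u / u0))\<bar> < pi / b"
    using b pi_gt_zero unfolding continuous_at_eps_delta
    by (metis dist_real_def diff_zero divide_pos_pos less_le_trans zero_less_one)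
  define r where "r = min d (norm u0)"
  have nonpos: "u / u0 \<notin> \<real>\<^sub>\<le>\<^sub>0" "u \<noteq> 0" if "u \<in> ball u0 r" for u
  proof -
    have "norm (u / u0 - 1) = norm (u - u0) / norm u0" using u0 by (simp add: field_simps flip: norm_divide)
    also have "\<dots> < 1" using that u0 by (simp add: r_def dist_norm norm_minus_commute)
    finally have "Re (u / u0) > 0" using abs_Re_le_cmod[of "u / u0 - 1"] by (simp del: Re_divide)
    then show "u / u0 \<notin> \<real>\<^sub>\<le>\<^sub>0" "u \<noteq> 0" by (auto simp: complex_nonpos_Reals_iff simp del: Re_divide)
  qed
  have Re\<phi>: "Re (?\<phi> u) = norm u powr b * cos (b * absarg (u / u0))" if "u \<noteq> 0" for u
    using that u0 Re_exp_mult_Ln[of "u / u0" b] by (simp add: norm_divide powr_divide del: Re_divide)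
  show ?thesis unfolding touched_below_def
  proof (intro exI[of _ r] exI[of _ ?\<phi>] conjI ballI)
    show "?\<phi> holomorphic_on ball u0 r" using nonpos u0 by (intro holomorphic_intros) auto
    show "Re (?\<phi> u0) = polar_fun b (\<lambda>t. - cos (min (b * t) pi)) u0"
      using False u0 unfolding Re\<phi>[OF u0] by (simp add: polar_fun_def absarg_def min_def)
    fix u assume u: "u \<in> ball u0 r"
    have "cos (b * absarg (u / u0)) \<le> - cos (min (b * absarg u) pi)"
    proof (cases "b * absarg u < pi")
      case True
      have "b * absarg u0 \<le> b * (absarg u + absarg (u / u0))"
        using b by (intro mult_left_mono absarg_triangle nonpos(2)[OF u] u0) auto
      then have "pi - b * absarg u \<le> b * absarg (u / u0)" using False by (simp add: algebra_simps)
      moreover have "b * absarg (u / u0) \<le> pi"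
        using d(2)[of u] u b nonpos(2)[OF u] u0
        by (simp add: absarg_eq_abs_Im_Ln r_def dist_commute field_simps)
      moreover have "pi - b * absarg u \<ge> 0" using True by simp
      ultimately have "cos (b * absarg (u / u0)) \<le> cos (pi - b * absarg u)"
        by (intro cos_monotone_0_pi_le) auto
      then show ?thesis using True by simp
    qed (simp add: min_def)
    then show "Re (?\<phi> u) \<le> polar_fun b (\<lambda>t. - cos (min (b * t) pi)) u"
      unfolding Re\<phi>[OF nonpos(2)[OF u]] polar_fun_def by (intro mult_left_mono) auto
  qed (use d u0 in \<open>auto simp: r_def\<close>)
qed

lemma cos_polar_mean_nonneg:
  assumes "0 < a" "a \<le> 1" "poly h 0 = 0"
  shows "0 \<le> circle_mean (\<lambda>z. polar_fun a (\<lambda>t. cos (a * t)) (poly h z))"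
proof (rule polar_fun_mean_nonneg[where \<sigma> = 1])
  fix t assume t: "t \<in> {0..pi}"
  have "a * t \<le> 1 * t" using assms t by (intro mult_right_mono) auto
  then show "1 * cos t \<le> cos (a * t)" using assms t by (auto intro!: cos_monotone_0_pi_le)
qed (use assms touched_below_cos in \<open>auto intro!: continuous_intros\<close>)

lemma neg_cos_polar_mean_nonneg:
  assumes "1 \<le> b" "poly h 0 = 0"
  shows "0 \<le> circle_mean (\<lambda>z. polar_fun b (\<lambda>t. - cos (min (b * t) pi)) (poly h z))"
proof (rule polar_fun_mean_nonneg[where \<sigma> = "- 1"])
  fix t assume t: "t \<in> {0..pi}"
  have "1 * t \<le> b * t" using assms t by (intro mult_right_mono) auto
  then show "- 1 * cos t \<le> - cos (min (b * t) pi)" using assms t by (auto intro!: cos_monotone_0_pi_le)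
qed (use assms touched_below_neg_cos_min in \<open>auto intro!: continuous_intros\<close>)

section \<open>Mean convergence on the circle\<close>

interpretation circle: prob_space circle_measure
  by (rule prob_space_circle_measure)

text \<open>The \<open>p\<close>-th power of the norm. It satisfies the triangle inequality only up
  to the factor \<open>2 powr p\<close>, which suffices for all qualitative arguments and avoids
  roots.\<close>

definition pint :: "real \<Rightarrow> (complex \<Rightarrow> complex) \<Rightarrow> real" where
  "pint p f = circle_mean (\<lambda>z. norm (f z) powr p)"

lemma pint_nonneg: "0 \<le> pint p f"
  by (simp add: pint_def)

lemma Lp_circleD:
  assumes "f \<in> Lp_circle p"
  shows "f \<in> borel_measurable circle_measure" "integrable circle_measure (\<lambda>z. norm (f z) powr p)"
  using assms by (auto simp: Lp_circle_def)

lemma norm_add_powr_le: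
  fixes a b :: "'a::real_normed_vector"
  assumes "p > 0"
  shows "norm (a + b) powr p \<le> 2 powr p * (norm a powr p + norm b powr p)"
proof -
  have "norm (a + b) \<le> 2 * max (norm a) (norm b)" using norm_triangle_ineq[of a b] by linarith
  then have "norm (a + b) powr p \<le> (2 * max (norm a) (norm b)) powr p" using assms by (intro powr_mono2) auto
  also have "\<dots> = 2 powr p * max (norm a) (norm b) powr p" by (simp add: powr_mult)
  also have "\<dots> \<le> 2 powr p * (norm a powr p + norm b powr p)" by (intro mult_left_mono) (auto simp: max_def)
  finally show ?thesis .
qed

lemma Lp_circle_bounded_by:
  assumes "f \<in> borel_measurable circle_measure" "integrable circle_measure H"
    "AE z in circle_measure. norm (f z) powr p \<le> H z"
  shows "f \<in> Lp_circle p" "pint p f \<le> circle_mean (\<lambda>z. H z)"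
proof -
  note [measurable] = assms(1)
  have int: "integrable circle_measure (\<lambda>z. norm (f z) powr p)"
  proof (rule Bochner_Integration.integrable_bound[OF assms(2)])
    show "AE z in circle_measure. norm (norm (f z) powr p) \<le> norm (H z)"
      using assms(3) by eventually_elim auto
  qed measurable
  then show "f \<in> Lp_circle p" using assms(1) by (simp add: Lp_circle_def)
  show "pint p f \<le> circle_mean (\<lambda>z. H z)"
    unfolding pint_def by (rule integral_mono_AE[OF int assms(2,3)])
qed

lemma Lp_circle_add:
  assumes p: "p > 0" and f: "f \<in> Lp_circle p" and g: "g \<in> Lp_circle p"
  shows "(\<lambda>z. f z + g z) \<in> Lp_circle p"
    and "pint p (\<lambda>z. f z + g z) \<le> 2 powr p * (pint p f + pint p g)"
proof -
  note [measurable] = Lp_circleD[OF f] Lp_circleD[OF g]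
  have m: "(\<lambda>z. f z + g z) \<in> borel_measurable circle_measure" by measurable
  have i: "integrable circle_measure (\<lambda>z. 2 powr p * (norm (f z) powr p + norm (g z) powr p))"
    using Lp_circleD(2)[OF f] Lp_circleD(2)[OF g] by (intro integrable_mult_right Bochner_Integration.integrable_add)
  have b: "AE z in circle_measure. norm (f z + g z) powr p \<le> 2 powr p * (norm (f z) powr p + norm (g z) powr p)"
    using norm_add_powr_le[OF p] by (intro AE_I2)
  show "(\<lambda>z. f z + g z) \<in> Lp_circle p" by (rule Lp_circle_bounded_by(1)[OF m i b])
  have "pint p (\<lambda>z. f z + g z) \<le> circle_mean (\<lambda>z. 2 powr p * (norm (f z) powr p + norm (g z) powr p))"
    by (rule Lp_circle_bounded_by(2)[OF m i b])
  also have "\<dots> = 2 powr p * (pint p f + pint p g)"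
    unfolding pint_def by (simp add: Lp_circleD(2)[OF f] Lp_circleD(2)[OF g])
  finally show "pint p (\<lambda>z. f z + g z) \<le> 2 powr p * (pint p f + pint p g)" .
qed

lemma Lp_circle_minus:
  assumes "f \<in> Lp_circle p"
  shows "(\<lambda>z. - f z) \<in> Lp_circle p" "pint p (\<lambda>z. - f z) = pint p f"
  using assms by (auto simp: Lp_circle_def pint_def)

lemma Lp_circle_diff:
  assumes "p > 0" "f \<in> Lp_circle p" "g \<in> Lp_circle p"
  shows "(\<lambda>z. f z - g z) \<in> Lp_circle p"
    and "pint p (\<lambda>z. f z - g z) \<le> 2 powr p * (pint p f + pint p g)"
  using Lp_circle_add[OF assms(1,2) Lp_circle_minus(1)[OF assms(3)]] Lp_circle_minus(2)[OF assms(3)] by simp_all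

lemma pint_diff_commute: "pint p (\<lambda>z. f z - g z) = pint p (\<lambda>z. g z - f z)"
  by (simp add: pint_def norm_minus_commute)

lemma pint_diff_triangle:
  assumes "p > 0" "f \<in> Lp_circle p" "g \<in> Lp_circle p" "h \<in> Lp_circle p"
  shows "pint p (\<lambda>z. f z - h z) \<le> 2 powr p * (pint p (\<lambda>z. f z - g z) + pint p (\<lambda>z. g z - h z))"
  using Lp_circle_add(2)[OF assms(1) Lp_circle_diff(1)[OF assms(1-3)] Lp_circle_diff(1)[OF assms(1,3,4)]] by simp

lemma Lp_circle_continuous:
  assumes "continuous_on (sphere 0 1) f" "p > 0"
  shows "f \<in> Lp_circle p"
  using assms unfolding Lp_circle_def
  by (auto intro!: borel_measurable_circle_continuous integrable_circle_continuous continuous_intros continuous_on_powr')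

text \<open>\<open>H\<close> is the sum of the functions \<open>|d k|^p\<close> weighted by
  \<open>(2 powr p) ^ k\<close>. The assumed decay beats the weights, so the integrals form a
  geometric series, and each term is at most the sum.\<close>

lemma fast_convergence:
  fixes d :: "nat \<Rightarrow> complex \<Rightarrow> complex"
  assumes p: "p > 0" and d: "\<And>k. d k \<in> Lp_circle p" "\<And>k. pint p (d k) \<le> (4 powr (- p)) ^ k"
  obtains H where "integrable circle_measure H" "\<And>z. H z \<ge> 0"
    "AE z in circle_measure. \<forall>k. norm (d k z) powr p \<le> H z * (2 powr (- p)) ^ k"
proof -
  define e where "e k z = (2 powr p) ^ k * norm (d k z) powr p" for k z
  note [measurable] = Lp_circleD(1)[OF d(1)]
  have e_int: "integrable circle_measure (e k)" for k
    unfolding e_def using Lp_circleD(2)[OF d(1)] by (intro integrable_mult_right)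
  have e_nn: "e k z \<ge> 0" for k z by (simp add: e_def)
  have e_le: "circle_mean (\<lambda>z. e k z) \<le> (2 powr (- p)) ^ k" for k
  proof -
    have "circle_mean (\<lambda>z. e k z) = (2 powr p) ^ k * pint p (d k)" by (simp add: e_def pint_def)
    also have "\<dots> \<le> (2 powr p) ^ k * (4 powr (- p)) ^ k" using d(2) by (intro mult_left_mono) auto
    also have "\<dots> = (2 powr p * 4 powr (- p)) ^ k" by (simp add: power_mult_distrib)
    also have "4 powr (- p) = 2 powr (- p) * 2 powr (- p)" by (simp flip: powr_mult)
    also have "2 powr p * (2 powr (- p) * 2 powr (- p)) = 2 powr (- p)" by (simp flip: powr_add)
    finally show ?thesis .
  qed
  have geo: "summable (\<lambda>k. (2 powr (- p)) ^ k)" using p by (intro summable_geometric) (simp add: powr_less_one)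
  have sum_int: "summable (\<lambda>k. circle_mean (\<lambda>z. norm (e k z)))"
    by (rule summable_comparison_test'[OF geo]) (use e_le e_nn in \<open>auto simp: abs_of_nonneg integral_nonneg\<close>)
  have AE_sum: "AE z in circle_measure. summable (\<lambda>k. norm (e k z))"
  proof -
    have "(\<integral>\<^sup>+z. (\<Sum>k. ennreal (e k z)) \<partial>circle_measure) = (\<Sum>k. \<integral>\<^sup>+z. ennreal (e k z) \<partial>circle_measure)"
      unfolding e_def by (intro nn_integral_suminf) measurable
    also have "\<dots> = (\<Sum>k. ennreal (circle_mean (\<lambda>z. e k z)))"
      using e_nn by (intro suminf_cong nn_integral_eq_integral e_int) auto
    also have "\<dots> < \<infinity>"
      using sum_int e_nn by (subst suminf_ennreal2) (auto simp: integral_nonneg)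
    finally have "AE z in circle_measure. (\<Sum>k. ennreal (e k z)) \<noteq> \<infinity>"
      by (intro nn_integral_PInf_AE) (auto simp: e_def less_top)
    then show ?thesis
    proof eventually_elim
      case (elim z)
      then have "summable (\<lambda>k. e k z)" using e_nn by (intro summable_suminf_not_top) auto
      then show ?case using e_nn by simp
    qed
  qed
  \<comment> \<open>The absolute value gives \<open>H \<ge> 0\<close> also at points where the
    series diverges and its \<open>suminf\<close> has no meaning.\<close>
  define H where "H z = \<bar>\<Sum>k. e k z\<bar>" for z
  show thesis
  proof
    show "integrable circle_measure H"
      unfolding H_def by (intro integrable_abs integrable_suminf e_int AE_sum sum_int)
    show "AE z in circle_measure. \<forall>k. norm (d k z) powr p \<le> H z * (2 powr (- p)) ^ k"
      using AE_sum
    proof eventually_elim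
      case (elim z)
      then have s: "summable (\<lambda>k. e k z)" using e_nn by simp
      show ?case
      proof
        fix k
        have "e k z \<le> (\<Sum>k. e k z)" using sum_le_suminf[OF s, of "{k}"] e_nn by simp
        then have "(2 powr (- p)) ^ k * e k z \<le> (2 powr (- p)) ^ k * H z"
          unfolding H_def by (intro mult_left_mono) auto
        then show "norm (d k z) powr p \<le> H z * (2 powr (- p)) ^ k"
          by (simp add: e_def mult.assoc[symmetric] flip: power_mult_distrib powr_add) (simp add: mult.commute)
      qed
    qed
  qed (simp add: H_def)
qed

lemma powr_le_geometricD:
  fixes x H p :: real
  assumes p: "p > 0" and "0 \<le> x" "0 \<le> H" "x powr p \<le> H * (2 powr (- p)) ^ k"
  shows "x \<le> H powr (1 / p) * (1 / 2) ^ k"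
proof -
  have "(x powr p) powr (1 / p) \<le> (H * (2 powr (- p)) ^ k) powr (1 / p)"
    using assms by (intro powr_mono2) auto
  also have "(x powr p) powr (1 / p) = x" using assms by (simp add: powr_powr)
  also have "(H * (2 powr (- p)) ^ k) powr (1 / p) = H powr (1 / p) * ((2 powr (- p)) ^ k) powr (1 / p)"
    using assms by (simp add: powr_mult)
  also have "((2 powr (- p)) ^ k) powr (1 / p) = 2 powr (- real k)"
    using p by (simp add: powr_realpow[symmetric] powr_powr)
  also have "\<dots> = (1 / 2) ^ k" by (simp add: powr_minus powr_realpow power_divide inverse_eq_divide)
  finally show ?thesis .
qed

text \<open>The Riesz--Fischer argument: a rapidly Cauchy subsequence telescopes into a series
  dominated by a geometric one almost everywhere; the Cauchy property then carries the convergence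
  to the whole sequence.\<close>

lemma Lp_circle_complete:
  fixes g :: "nat \<Rightarrow> complex \<Rightarrow> complex"
  assumes p: "p > 0" and g: "\<And>n. g n \<in> Lp_circle p"
    and Cauchy: "\<And>e. e > 0 \<Longrightarrow> \<exists>N. \<forall>m\<ge>N. \<forall>n\<ge>N. pint p (\<lambda>z. g m z - g n z) < e"
  obtains G where "G \<in> Lp_circle p" "(\<lambda>n. pint p (\<lambda>z. G z - g n z)) \<longlonglongrightarrow> 0"
proof -
  have "\<exists>N. \<forall>k. (\<forall>m\<ge>N k. \<forall>n\<ge>N k. pint p (\<lambda>z. g m z - g n z) < (4 powr (- p)) ^ k) \<and> N k \<le> N (Suc k)"
  proof (rule dependent_nat_choice[where Q = "\<lambda>_ x y. x \<le> y"])
    show "\<exists>N. \<forall>m\<ge>N. \<forall>n\<ge>N. pint p (\<lambda>z. g m z - g n z) < (4 powr (- p)) ^ 0"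
      using Cauchy[of 1] by simp
    fix x k
    obtain N where "\<forall>m\<ge>N. \<forall>n\<ge>N. pint p (\<lambda>z. g m z - g n z) < (4 powr (- p)) ^ Suc k"
      using Cauchy[of "(4 powr (- p)) ^ Suc k"] by auto
    then show "\<exists>y. (\<forall>m\<ge>y. \<forall>n\<ge>y. pint p (\<lambda>z. g m z - g n z) < (4 powr (- p)) ^ Suc k) \<and> x \<le> y"
      by (intro exI[of _ "max x N"]) auto
  qed
  then obtain N where N: "\<And>k m n. m \<ge> N k \<Longrightarrow> n \<ge> N k \<Longrightarrow> pint p (\<lambda>z. g m z - g n z) < (4 powr (- p)) ^ k"
    "\<And>k. N k \<le> N (Suc k)" by blast
  define d where "d k z = g (N (Suc k)) z - g (N k) z" for k z
  have "d k \<in> Lp_circle p" for k unfolding d_def by (intro Lp_circle_diff p g)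
  moreover have "pint p (d k) \<le> (4 powr (- p)) ^ k" for k
    unfolding d_def using N by (intro less_imp_le) auto
  ultimately obtain H where H: "integrable circle_measure H" "\<And>z. H z \<ge> 0"
    "AE z in circle_measure. \<forall>k. norm (d k z) powr p \<le> H z * (2 powr (- p)) ^ k"
    by (rule fast_convergence[OF p]) blast
  \<comment> \<open>Taking \<open>lim\<close> at every point gives measurability at once; the points
    of divergence form a null set.\<close>
  define G where "G z = lim (\<lambda>k. g (N k) z)" for z
  note [measurable] = Lp_circleD(1)[OF g]
  have G_m: "G \<in> borel_measurable circle_measure"
    unfolding G_def by measurable
  have close: "AE z in circle_measure. \<forall>k. norm (G z - g (N k) z) powr p \<le> 2 powr p * (H z * (2 powr (- p)) ^ k)"
    using H(3)
  proof eventually_elim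
    case (elim z)
    define B where "B = H z powr (1 / p)"
    have d_le: "norm (d k z) \<le> B * (1 / 2) ^ k" for k
      unfolding B_def using elim H(2) p by (intro powr_le_geometricD) auto
    have tel: "g (N (k + n)) z = g (N k) z + (\<Sum>j<n. d (k + j) z)" for k n
      by (induction n) (auto simp: d_def)
    have "summable (\<lambda>k. d k z)"
      by (rule summable_comparison_test'[where g = "\<lambda>k. B * (1 / 2) ^ k" and N = 0])
        (use d_le in \<open>auto intro!: summable_mult summable_geometric\<close>)
    then have "convergent (\<lambda>n. \<Sum>j<n. d j z)" by (simp add: summable_iff_convergent)
    then have "convergent (\<lambda>n. g (N 0) z + (\<Sum>j<n. d j z))" by (intro convergent_add convergent_const)
    then have "convergent (\<lambda>n. g (N (0 + n)) z)" by (subst tel) (simp only: add_0)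
    then have "convergent (\<lambda>n. g (N n) z)" by (simp only: add_0)
    then have lim: "(\<lambda>n. g (N n) z) \<longlonglongrightarrow> G z" by (simp add: G_def convergent_LIMSEQ_iff)
    show ?case
    proof
      fix k
      have "norm (G z - g (N k) z) \<le> 2 * (B * (1 / 2) ^ k)"
      proof (rule LIMSEQ_le_const2)
        show "(\<lambda>n. norm (g (N (n + k)) z - g (N k) z)) \<longlonglongrightarrow> norm (G z - g (N k) z)"
          by (intro tendsto_intros LIMSEQ_ignore_initial_segment[OF lim])
        have "norm (g (N (n + k)) z - g (N k) z) \<le> 2 * (B * (1 / 2) ^ k)" for n
        proof -
          have "norm (g (N (n + k)) z - g (N k) z) = norm (\<Sum>j<n. d (k + j) z)"
            using tel[of k n] by (simp add: add.commute)
          also have "\<dots> \<le> (\<Sum>j<n. norm (d (k + j) z))" by (rule norm_sum)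
          also have "\<dots> \<le> (\<Sum>j<n. B * (1 / 2) ^ (k + j))" by (intro sum_mono d_le)
          also have "\<dots> = B * (1 / 2) ^ k * (\<Sum>j<n. (1 / 2) ^ j)" by (simp add: sum_distrib_left power_add mult_ac)
          also have "\<dots> \<le> B * (1 / 2) ^ k * 2"
          proof (intro mult_left_mono)
            show "(\<Sum>j<n. (1 / 2) ^ j) \<le> (2 :: real)" by (simp add: sum_gp_strict)
          qed (simp add: B_def)
          finally show ?thesis by simp
        qed
        then show "\<exists>M. \<forall>n\<ge>M. norm (g (N (n + k)) z - g (N k) z) \<le> 2 * (B * (1 / 2) ^ k)" by blast
      qed
      then have "norm (G z - g (N k) z) powr p \<le> (2 * (B * (1 / 2) ^ k)) powr p"
        using p by (intro powr_mono2) auto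
      also have "\<dots> = 2 powr p * (H z * ((1 / 2) ^ k) powr p)"
        using p H(2)[of z] by (simp add: powr_mult B_def powr_powr)
      also have "((1 / 2) ^ k) powr p = (2 powr (- p)) ^ k"
        by (simp add: powr_realpow[symmetric] powr_powr mult.commute powr_minus powr_divide inverse_eq_divide)
      finally show "norm (G z - g (N k) z) powr p \<le> 2 powr p * (H z * (2 powr (- p)) ^ k)" .
    qed
  qed
  have Gk: "(\<lambda>z. G z - g (N k) z) \<in> Lp_circle p"
    "pint p (\<lambda>z. G z - g (N k) z) \<le> 2 powr p * circle_mean (\<lambda>z. H z) * (2 powr (- p)) ^ k" for k
  proof -
    have m: "(\<lambda>z. G z - g (N k) z) \<in> borel_measurable circle_measure" using G_m by measurable
    have i: "integrable circle_measure (\<lambda>z. 2 powr p * (H z * (2 powr (- p)) ^ k))"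
      using H(1) by (intro integrable_mult_right integrable_mult_left)
    have b: "AE z in circle_measure. norm (G z - g (N k) z) powr p \<le> 2 powr p * (H z * (2 powr (- p)) ^ k)"
      using close by eventually_elim simp
    show "(\<lambda>z. G z - g (N k) z) \<in> Lp_circle p" by (rule Lp_circle_bounded_by(1)[OF m i b])
    show "pint p (\<lambda>z. G z - g (N k) z) \<le> 2 powr p * circle_mean (\<lambda>z. H z) * (2 powr (- p)) ^ k"
      using Lp_circle_bounded_by(2)[OF m i b] by simp
  qed
  have G: "G \<in> Lp_circle p" using Lp_circle_add(1)[OF p Gk(1)[of 0] g[of "N 0"]] by simp
  have geo0: "(\<lambda>k. (2 powr (- p)) ^ k) \<longlonglongrightarrow> 0" using p by (intro LIMSEQ_power_zero) (simp add: powr_less_one)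
  have lim0: "(\<lambda>k. pint p (\<lambda>z. G z - g (N k) z)) \<longlonglongrightarrow> 0"
  proof (rule tendsto_sandwich[OF _ _ tendsto_const])
    show "(\<lambda>k. 2 powr p * circle_mean (\<lambda>z. H z) * (2 powr (- p)) ^ k) \<longlonglongrightarrow> 0"
      by (rule tendsto_mult_right_zero[OF geo0])
  qed (use Gk(2) pint_nonneg in auto)
  have "(\<lambda>n. pint p (\<lambda>z. G z - g n z)) \<longlonglongrightarrow> 0"
  proof (rule LIMSEQ_I)
    fix e :: real assume e: "e > 0"
    define e1 where "e1 = e / (2 * 2 powr p)"
    have e1: "e1 > 0" using e by (simp add: e1_def)
    obtain K1 where K1: "\<And>k. k \<ge> K1 \<Longrightarrow> pint p (\<lambda>z. G z - g (N k) z) < e1"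
      using LIMSEQ_D[OF lim0 e1] pint_nonneg by auto
    obtain K2 where K2: "\<And>k. k \<ge> K2 \<Longrightarrow> (4 powr (- p)) ^ k < e1"
    proof -
      have "(\<lambda>k. (4 powr (- p)) ^ k) \<longlonglongrightarrow> 0" using p by (intro LIMSEQ_power_zero) (simp add: powr_less_one)
      from LIMSEQ_D[OF this e1] show thesis using that by auto
    qed
    define k where "k = max K1 K2"
    have "pint p (\<lambda>z. G z - g n z) < e" if "n \<ge> N k" for n
    proof -
      have "pint p (\<lambda>z. g (N k) z - g n z) < e1" using N(1)[of k "N k" n] that K2[of k] by (auto simp: k_def)
      moreover have "pint p (\<lambda>z. G z - g (N k) z) < e1" using K1[of k] by (simp add: k_def)
      ultimately have "2 powr p * (pint p (\<lambda>z. G z - g (N k) z) + pint p (\<lambda>z. g (N k) z - g n z)) < 2 powr p * (e1 + e1)"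
        by (intro mult_strict_left_mono) auto
      also have "\<dots> = e" by (simp add: e1_def)
      finally show ?thesis using pint_diff_triangle[OF p G g[of "N k"] g[of n]] by simp
    qed
    then show "\<exists>M. \<forall>n\<ge>M. norm (pint p (\<lambda>z. G z - g n z) - 0) < e" using pint_nonneg by (intro exI[of _ "N k"]) auto
  qed
  then show thesis using that G by blast
qed

section \<open>Density of trigonometric polynomials\<close>

definition trig :: "complex poly \<Rightarrow> complex poly \<Rightarrow> complex \<Rightarrow> complex" where
  "trig F G z = poly F z + cnj (poly G z)"

lemma continuous_on_trig: "continuous_on A (trig F G)"
  unfolding trig_def by (intro continuous_intros)

lemma Lp_circle_trig: "p > 0 \<Longrightarrow> trig F G \<in> Lp_circle p"
  by (intro Lp_circle_continuous continuous_on_trig)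

text \<open>The endpoints of the parameter interval are dropped because they correspond to the point
  \<open>1\<close>, where \<open>Arg2pi\<close> jumps.\<close>

lemma AE_circle_measureI:
  assumes P: "{z \<in> sphere 0 1. P z} \<in> sets circle_measure"
    and AE: "AE t in lborel. t \<in> {0<..<2*pi} \<longrightarrow> P (cis t)"
  shows "AE z in circle_measure. P z"
proof -
  have "AE t in lborel. t \<noteq> 0 \<and> t \<noteq> 2 * pi" using AE_lborel_singleton by (auto intro: AE_conjI)
  with AE have "AE t in lborel. t \<in> {0..2*pi} \<longrightarrow> P (cis t)"
    by eventually_elim auto
  then have *: "AE t in uniform_measure lborel {0..2*pi}. P (cis t)"
    by (intro AE_uniform_measureI) auto
  have m: "cis \<in> measurable (uniform_measure lborel {0..2*pi}) (restrict_space borel (sphere 0 1))"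
    using measurable_cis_circle by (simp add: measurable_def)
  have "{z \<in> space (restrict_space borel (sphere 0 1)). P z} \<in> sets (restrict_space borel (sphere 0 1))"
    using P by (simp add: circle_measure_def space_restrict_space)
  then show ?thesis unfolding circle_measure_def by (subst AE_distr_iff[OF m]) (use * in auto)
qed

lemma pint_dominated_tendsto:
  fixes f :: "nat \<Rightarrow> complex \<Rightarrow> complex"
  assumes p: "p > 0" and m: "\<And>n. f n \<in> borel_measurable circle_measure" "integrable circle_measure H"
    and lim: "AE z in circle_measure. (\<lambda>n. f n z) \<longlonglongrightarrow> 0"
    and le: "\<And>n. AE z in circle_measure. norm (f n z) powr p \<le> H z"
  shows "(\<lambda>n. pint p (f n)) \<longlonglongrightarrow> 0"
proof -
  note [measurable] = m(1)
  have "(\<lambda>n. circle_mean (\<lambda>z. norm (f n z) powr p)) \<longlonglongrightarrow> circle_mean (\<lambda>z. 0)"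
  proof (rule integral_dominated_convergence[OF _ _ m(2)])
    show "AE z in circle_measure. (\<lambda>n. norm (f n z) powr p) \<longlonglongrightarrow> 0"
      using lim
    proof eventually_elim
      case (elim z)
      have "(\<lambda>n. norm (f n z) powr p) \<longlonglongrightarrow> norm (0 :: complex) powr p"
        using p by (intro tendsto_powr' tendsto_norm elim tendsto_const) auto
      then show ?case by simp
    qed
    show "AE z in circle_measure. norm (norm (f n z) powr p) \<le> H z" for n
      using le[of n] by eventually_elim simp
  qed measurable
  then show ?thesis by (simp add: pint_def)
qed

text \<open>The factor \<open>b n x = min 1 (n |x - 1|)\<close> removes the discontinuity of the argument at \<open>1\<close>.\<close>

lemma bounded_continuous_approx:
  assumes f: "f \<in> borel_measurable circle_measure" and M: "M > 0" "\<And>x. norm (f x) \<le> M" and p: "p > 0"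
  obtains G where "\<And>n. continuous_on (sphere 0 1) (G n)" "(\<lambda>n. pint p (\<lambda>x. f x - G n x)) \<longlonglongrightarrow> 0"
proof -
  have fr: "f \<in> borel_measurable (restrict_space borel (sphere 0 1))"
    using f by (simp add: circle_measure_def measurable_distr_eq1)
  have "(\<lambda>t. f (cis t)) \<in> borel_measurable lborel"
    using measurable_compose[OF measurable_cis_circle fr] by simp
  then have "(\<lambda>t. f (cis t)) \<in> borel_measurable lebesgue" by (rule measurable_completion)
  then have "(\<lambda>t. f (cis t)) measurable_on UNIV"
    by (intro lebesgue_measurable_imp_measurable_on) auto
  then obtain N g where N: "negligible N" and g: "\<And>n. continuous_on UNIV (g n)"
    "\<And>t. t \<notin> N \<Longrightarrow> (\<lambda>n. g n t) \<longlonglongrightarrow> f (cis t)"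
    unfolding measurable_on_def by auto
  \<comment> \<open>Projecting onto the disc of radius \<open>M\<close> gives the approximants the
    common bound needed for dominated convergence, without moving the values of
    \<open>f\<close>.\<close>
  define c where "c = closest_point (cball (0::complex) M)"
  have c: "continuous_on UNIV c" "norm (c z) \<le> M" "norm z \<le> M \<Longrightarrow> c z = z" for z
  proof -
    show "continuous_on UNIV c" unfolding c_def using M by (intro continuous_on_closest_point) auto
    show "norm (c z) \<le> M" using closest_point_in_set[of "cball (0::complex) M" z] M by (auto simp: c_def)
    show "norm z \<le> M \<Longrightarrow> c z = z" by (simp add: c_def closest_point_self)
  qed
  define b where "b n x = min 1 (real n * norm (x - 1))" for n and x :: complex
  define G where "G n x = of_real (b n x) * c (g n (Arg2pi x))" for n x
  have b: "0 \<le> b n x" "b n x \<le> 1" for n x by (auto simp: b_def)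
  have G_le: "norm (G n x) \<le> M" for n x
    using mult_mono[of "b n x" 1 "norm (c (g n (Arg2pi x)))" M] b[of n x] c(2)[of "g n (Arg2pi x)"] M(1)
    by (simp add: G_def norm_mult)
  have G_cont: "continuous_on (sphere 0 1) (G n)" for n
  proof -
    have "continuous (at x within sphere 0 1) (G n)" if x: "x \<in> sphere 0 1" for x
    proof (cases "x = 1")
      case True
      have "((\<lambda>z. G n z) \<longlongrightarrow> 0) (at 1 within sphere 0 1)"
      proof (rule Lim_null_comparison)
        show "\<forall>\<^sub>F z in at 1 within sphere 0 1. norm (G n z) \<le> real n * norm (z - 1) * M"
        proof (rule always_eventually, rule allI)
          fix z :: complex
          have "b n z \<le> real n * norm (z - 1)" by (simp add: b_def)
          then show "norm (G n z) \<le> real n * norm (z - 1) * M"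
            using mult_mono[of "b n z" "real n * norm (z - 1)" "norm (c (g n (Arg2pi z)))" M] c(2)[of "g n (Arg2pi z)"] b[of n z]
            by (simp add: G_def norm_mult)
        qed
        have "((\<lambda>z::complex. real n * norm (z - 1) * M) \<longlongrightarrow> real n * norm ((1::complex) - 1) * M) (at 1 within sphere 0 1)"
          by (intro tendsto_intros)
        then show "((\<lambda>z. real n * norm (z - (1::complex)) * M) \<longlongrightarrow> 0) (at 1 within sphere 0 1)" by simp
      qed
      moreover have "G n 1 = 0" by (simp add: G_def b_def)
      ultimately show ?thesis using True by (simp add: continuous_within)
    next
      case False
      have "x \<notin> \<real>\<^sub>\<ge>\<^sub>0"
      proof
        assume "x \<in> \<real>\<^sub>\<ge>\<^sub>0"
        then obtain r where "x = of_real r" "r \<ge> 0" by (auto simp: nonneg_Reals_def)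
        then show False using x False by simp
      qed
      then have A: "isCont Arg2pi x" by (rule continuous_at_Arg2pi)
      have cg: "isCont (\<lambda>t. c (g n t)) (Arg2pi x)"
        using continuous_on_compose2[OF c(1) g(1)[of n]] by (simp add: continuous_on_eq_continuous_at)
      have "isCont (\<lambda>z. c (g n (Arg2pi z))) x" by (rule isCont_o2[OF A cg])
      moreover have "isCont (\<lambda>z. complex_of_real (b n z)) x" unfolding b_def by (intro continuous_intros)
      ultimately have "isCont (G n) x" unfolding G_def by (intro isCont_mult)
      then show ?thesis by (rule continuous_at_imp_continuous_at_within)
    qed
    then show ?thesis by (simp add: continuous_on_eq_continuous_within)
  qed
  have G_m: "G n \<in> borel_measurable circle_measure" for n
    by (intro borel_measurable_circle_continuous G_cont)
  note [measurable] = f G_m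
  have AE_lim: "AE x in circle_measure. (\<lambda>n. f x - G n x) \<longlonglongrightarrow> 0"
  proof (rule AE_circle_measureI)
    have "{x \<in> space circle_measure. (\<lambda>n. norm (f x - G n x)) \<longlonglongrightarrow> 0} \<in> sets circle_measure"
      by measurable
    then show "{x \<in> sphere 0 1. (\<lambda>n. f x - G n x) \<longlonglongrightarrow> 0} \<in> sets circle_measure"
      by (simp add: space_circle_measure tendsto_norm_zero_iff)
    have "N \<in> null_sets lebesgue" using N by (simp add: negligible_iff_null_sets)
    then have "AE t in lebesgue. t \<notin> N" by (rule AE_not_in)
    then have "AE t in lborel. t \<notin> N" by (simp add: AE_completion_iff)
    then show "AE t in lborel. t \<in> {0<..<2*pi} \<longrightarrow> (\<lambda>n. f (cis t) - G n (cis t)) \<longlonglongrightarrow> 0"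
    proof (rule eventually_mono, intro impI)
      fix t assume t: "t \<notin> N" "t \<in> {0<..<2*pi}"
      have arg: "Arg2pi (cis t) = t" using t Arg2pi_unique[of 1 t] by (simp add: cis_conv_exp)
      have ne: "cis t \<noteq> 1"
      proof
        assume "cis t = 1"
        then have "Arg2pi (cis t) = 0" by (simp add: Arg2pi_real)
        then show False using arg t by simp
      qed
      have lim_c: "(\<lambda>n. c (g n t)) \<longlonglongrightarrow> f (cis t)"
      proof -
        have "isCont c (f (cis t))" using c(1) by (simp add: continuous_on_eq_continuous_at)
        from isCont_tendsto_compose[OF this g(2)[OF t(1)]] show ?thesis using c(3) M(2) by simp
      qed
      have "\<forall>\<^sub>F n in sequentially. b n (cis t) = 1"
      proof -
        obtain n0 where "1 / norm (cis t - 1) < real n0" using reals_Archimedean2 by blast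
        then have "b n (cis t) = 1" if "n \<ge> n0" for n
        proof -
          have "1 / norm (cis t - 1) < real n" using that \<open>1 / norm (cis t - 1) < real n0\<close> by simp
          then have "1 < real n * norm (cis t - 1)" using ne by (simp add: field_simps)
          then show ?thesis by (simp add: b_def)
        qed
        then show ?thesis by (auto simp: eventually_sequentially)
      qed
      then have "\<forall>\<^sub>F n in sequentially. G n (cis t) = c (g n t)"
        by eventually_elim (simp add: G_def arg)
      then have "(\<lambda>n. G n (cis t)) \<longlonglongrightarrow> f (cis t)" using lim_c by (simp add: tendsto_cong)
      from tendsto_diff[OF tendsto_const[of "f (cis t)"] this] show "(\<lambda>n. f (cis t) - G n (cis t)) \<longlonglongrightarrow> 0" by simp
    qed
  qed
  have "(\<lambda>n. pint p (\<lambda>x. f x - G n x)) \<longlonglongrightarrow> 0"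
  proof (rule pint_dominated_tendsto[OF p _ _ AE_lim])
    show "integrable circle_measure (\<lambda>_. (2 * M) powr p)" by simp
    show "AE x in circle_measure. norm (f x - G n x) powr p \<le> (2 * M) powr p" for n
    proof (intro AE_I2 powr_mono2)
      fix x show "norm (f x - G n x) \<le> 2 * M"
        using norm_triangle_ineq4[of "f x" "G n x"] M(2)[of x] G_le[of n x] by simp
    qed (use p in auto)
  qed measurable
  then show thesis using that G_cont by blast
qed

text \<open>Truncation makes \<open>f\<close> bounded, bounded functions are approximated by
  continuous ones, and these uniformly by trigonometric polynomials.\<close>

lemma Lp_circle_trig_dense:
  assumes p: "p > 0" and f: "f \<in> Lp_circle p" and e: "e > 0"
  obtains F G where "poly G 0 = 0" "pint p (\<lambda>z. f z - trig F G z) < e"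
proof -
  note fD = Lp_circleD[OF f]
  note [measurable] = fD(1)
  \<comment> \<open>Two quasi-triangle inequalities turn three errors of size \<open>e1\<close> into
    at most \<open>3 * 2 powr p * 2 powr p * e1\<close>; the \<open>4\<close> leaves room for
    strictness.\<close>
  define e1 where "e1 = e / (4 * 2 powr p * 2 powr p)"
  have e1: "e1 > 0" using e by (simp add: e1_def)
  define t where "t n z = (if norm (f z) \<le> real n then f z else 0)" for n z
  have [measurable]: "t n \<in> borel_measurable circle_measure" for n unfolding t_def by measurable
  have t_le: "norm (t n z) \<le> norm (f z)" "norm (f z - t n z) \<le> norm (f z)" "norm (t n z) \<le> real n" for n z
    by (auto simp: t_def)
  have tL: "t n \<in> Lp_circle p" for n
    by (rule Lp_circle_bounded_by(1)[OF _ fD(2)]) (use t_le p in \<open>auto intro!: powr_mono2 AE_I2\<close>)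
  have "(\<lambda>n. pint p (\<lambda>z. f z - t n z)) \<longlonglongrightarrow> 0"
  proof (rule pint_dominated_tendsto[OF p _ fD(2)])
    show "AE z in circle_measure. (\<lambda>n. f z - t n z) \<longlonglongrightarrow> 0"
    proof (rule AE_I2)
      fix z
      obtain n0 where "norm (f z) < real n0" using reals_Archimedean2 by blast
      then have "f z - t n z = 0" if "n \<ge> n0" for n using that by (auto simp: t_def)
      then have "\<forall>\<^sub>F n in sequentially. f z - t n z = 0" by (auto simp: eventually_sequentially)
      then show "(\<lambda>n. f z - t n z) \<longlonglongrightarrow> 0" by (rule tendsto_eventually)
    qed
    show "AE z in circle_measure. norm (f z - t n z) powr p \<le> norm (f z) powr p" for n
      using t_le p by (auto intro!: powr_mono2 AE_I2)
  qed measurable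
  from LIMSEQ_D[OF this e1] obtain n0 where n0: "\<And>n. n \<ge> n0 \<Longrightarrow> pint p (\<lambda>z. f z - t n z) < e1"
    using pint_nonneg by auto
  \<comment> \<open>The successor makes the truncation level positive, as
    \<open>bounded_continuous_approx\<close> requires.\<close>
  define n where "n = Suc n0"
  have 1: "pint p (\<lambda>z. f z - t n z) < e1" using n0 by (simp add: n_def)
  obtain C where C: "\<And>k. continuous_on (sphere 0 1) (C k)" "(\<lambda>k. pint p (\<lambda>z. t n z - C k z)) \<longlonglongrightarrow> 0"
    by (rule bounded_continuous_approx[of "t n" "real n" p, OF _ _ t_le(3) p]) (auto simp: n_def)
  from LIMSEQ_D[OF C(2) e1] obtain k where 2: "pint p (\<lambda>z. t n z - C k z) < e1"
    using pint_nonneg by auto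
  have CL: "C k \<in> Lp_circle p" using C(1) p by (intro Lp_circle_continuous)
  define e2 where "e2 = (e1 / 2) powr (1 / p)"
  have e2: "e2 > 0" "e2 powr p = e1 / 2" using e1 p by (auto simp: e2_def powr_powr)
  obtain F G where FG: "poly G 0 = 0" "\<And>z. norm z = 1 \<Longrightarrow> norm (C k z - (poly F z + cnj (poly G z))) < e2"
    by (rule trig_polynomial_approx[OF C(1)[of k] e2(1)]) blast
  have "pint p (\<lambda>z. C k z - trig F G z) \<le> circle_mean (\<lambda>z. e1 / 2)"
  proof (rule Lp_circle_bounded_by(2))
    show "(\<lambda>z. C k z - trig F G z) \<in> borel_measurable circle_measure"
      by (intro borel_measurable_circle_continuous continuous_intros C(1) continuous_on_trig)
    show "AE z in circle_measure. norm (C k z - trig F G z) powr p \<le> e1 / 2"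
    proof (rule AE_I2)
      fix z assume "z \<in> space circle_measure"
      then have "norm (C k z - trig F G z) \<le> e2" using FG(2)[of z] by (simp add: space_circle_measure trig_def)
      then show "norm (C k z - trig F G z) powr p \<le> e1 / 2" unfolding e2(2)[symmetric] using p by (intro powr_mono2) auto
    qed
  qed simp
  then have 3: "pint p (\<lambda>z. C k z - trig F G z) < e1" using e1 circle.prob_space by simp
  have "pint p (\<lambda>z. t n z - trig F G z) \<le> 2 powr p * (pint p (\<lambda>z. t n z - C k z) + pint p (\<lambda>z. C k z - trig F G z))"
    by (rule pint_diff_triangle[OF p tL CL Lp_circle_trig[OF p]])
  also have "\<dots> \<le> 2 powr p * (e1 + e1)" using 2 3 by (intro mult_left_mono add_mono) auto
  finally have 4: "pint p (\<lambda>z. t n z - trig F G z) \<le> 2 powr p * (e1 + e1)" .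
  have one: "1 \<le> 2 powr p" using p by (simp add: ge_one_powr_ge_zero)
  have "pint p (\<lambda>z. f z - trig F G z) \<le> 2 powr p * (pint p (\<lambda>z. f z - t n z) + pint p (\<lambda>z. t n z - trig F G z))"
    by (rule pint_diff_triangle[OF p f tL Lp_circle_trig[OF p]])
  also have "\<dots> < 2 powr p * (2 powr p * e1 + 2 powr p * (e1 + e1))"
  proof (intro mult_strict_left_mono add_less_le_mono 4)
    have "1 * e1 \<le> 2 powr p * e1" using one e1 by (intro mult_right_mono) auto
    then show "pint p (\<lambda>z. f z - t n z) < 2 powr p * e1" using 1 by linarith
  qed simp
  also have "\<dots> < e" using e by (simp add: e1_def field_simps)
  finally show thesis using that FG(1) by blast
qed

section \<open>M. Riesz' theorem\<close>

definition psum :: "(complex \<Rightarrow> complex) \<Rightarrow> nat \<Rightarrow> complex \<Rightarrow> complex" where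
  "psum f N z = (\<Sum>n<N. fourier_coeff f (int n) * z ^ n)"

lemma Lp_circle_psum: "p > 0 \<Longrightarrow> psum f N \<in> Lp_circle p"
  unfolding psum_def by (intro Lp_circle_continuous continuous_intros)

lemma fourier_coeff_nat:
  assumes "f \<in> borel_measurable circle_measure"
  shows "fourier_coeff f (int n) = circle_mean (\<lambda>z. f z * cnj z ^ n)"
proof -
  have "(\<lambda>z::complex. cnj z ^ n) \<in> borel_measurable circle_measure"
    by (intro borel_measurable_circle_continuous continuous_intros)
  then have "(\<lambda>z. f z * cnj z ^ n) \<in> borel_measurable circle_measure"
    using assms by measurable
  moreover have "cnj (cis t) ^ n = exp (- \<i> * of_int (int n) * of_real t)" for t
  proof -
    have "cnj (cis t) ^ n = cis (real n * - t)" unfolding cis_cnj Complex.DeMoivre ..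
    then show ?thesis by (simp add: cis_conv_exp mult_ac)
  qed
  ultimately show ?thesis
    by (simp add: integral_circle_measure fourier_coeff_def scaleR_conv_of_real)
qed

text \<open>For \<open>x > \<eta>\<close> the factor \<open>(x / \<eta>)^(p - 1)\<close> exceeds
  \<open>1\<close>. This plays the part of Hoelder's inequality: a function with \<open>pint\<close>
  at most \<open>\<eta> powr p\<close> has mean modulus at most \<open>2 * \<eta>\<close>.\<close>

lemma norm_le_powr:
  fixes x \<eta> p :: real
  assumes "p > 1" "\<eta> > 0" "x \<ge> 0"
  shows "x \<le> \<eta> + \<eta> powr (1 - p) * x powr p"
proof (cases "x \<le> \<eta>")
  case False
  then have x: "x > 0" using assms by simp
  then have "x = x powr (1 - p) * x powr p" by (simp flip: powr_add)
  also have "\<dots> \<le> \<eta> powr (1 - p) * x powr p"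
    using False assms by (intro mult_right_mono powr_mono2') auto
  finally show ?thesis using assms by simp
qed (use assms in \<open>simp add: add_increasing2\<close>)

lemma Lp_circle_integrable:
  assumes p: "p > 1" and f: "f \<in> Lp_circle p"
  shows "integrable circle_measure f"
    and "\<eta> > 0 \<Longrightarrow> (circle_mean (\<lambda>z. norm (f z))) \<le> \<eta> + \<eta> powr (1 - p) * pint p f"
proof -
  have i: "integrable circle_measure (\<lambda>z. \<eta> + \<eta> powr (1 - p) * norm (f z) powr p)" for \<eta>
    using Lp_circleD(2)[OF f] by simp
  have le: "norm (f z) \<le> \<eta> + \<eta> powr (1 - p) * norm (f z) powr p" if "\<eta> > 0" for \<eta> z
    using norm_le_powr[OF p that] by simp
  show *: "integrable circle_measure f"
  proof (rule Bochner_Integration.integrable_bound[OF i[of 1] Lp_circleD(1)[OF f]], rule AE_I2)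
    fix z show "norm (f z) \<le> norm (1 + 1 powr (1 - p) * norm (f z) powr p)" using le[of 1 z] by simp
  qed
  assume \<eta>: "\<eta> > 0"
  have "circle_mean (\<lambda>z. norm (f z)) \<le> circle_mean (\<lambda>z. \<eta> + \<eta> powr (1 - p) * norm (f z) powr p)"
    by (intro integral_mono integrable_norm * i le \<eta>)
  also have "\<dots> = \<eta> + \<eta> powr (1 - p) * pint p f"
    using Lp_circleD(2)[OF f] circle.prob_space by (simp add: pint_def)
  finally show "circle_mean (\<lambda>z. norm (f z)) \<le> \<eta> + \<eta> powr (1 - p) * pint p f" .
qed

lemma integrable_mult_cnj_power:
  assumes "integrable circle_measure f"
  shows "integrable circle_measure (\<lambda>z. f z * cnj z ^ n)"
proof (rule Bochner_Integration.integrable_bound[OF assms])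
  have "(\<lambda>z::complex. cnj z ^ n) \<in> borel_measurable circle_measure"
    by (intro borel_measurable_circle_continuous continuous_intros)
  then show "(\<lambda>z. f z * cnj z ^ n) \<in> borel_measurable circle_measure"
    using assms by measurable
  show "AE z in circle_measure. norm (f z * cnj z ^ n) \<le> norm (f z)"
    by (rule AE_I2) (simp add: space_circle_measure norm_mult norm_power)
qed

lemma fourier_coeff_diff:
  assumes "integrable circle_measure f" "integrable circle_measure g"
  shows "fourier_coeff f (int n) - fourier_coeff g (int n) = fourier_coeff (\<lambda>z. f z - g z) (int n)"
proof -
  have [measurable]: "f \<in> borel_measurable circle_measure" "g \<in> borel_measurable circle_measure"
    using assms by auto
  have "(\<lambda>z. f z - g z) \<in> borel_measurable circle_measure" by measurable
  then show ?thesis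
    using integrable_mult_cnj_power[OF assms(1), of n] integrable_mult_cnj_power[OF assms(2), of n]
    by (simp add: fourier_coeff_nat left_diff_distrib)
qed

lemma psum_diff:
  assumes "integrable circle_measure f" "integrable circle_measure g"
  shows "psum f N z - psum g N z = psum (\<lambda>z. f z - g z) N z"
  by (simp add: psum_def fourier_coeff_diff[OF assms, symmetric] left_diff_distrib sum_subtractf)

lemma norm_fourier_coeff_le:
  assumes "integrable circle_measure f"
  shows "norm (fourier_coeff f (int n)) \<le> circle_mean (\<lambda>z. norm (f z))"
proof -
  have "norm (fourier_coeff f (int n)) \<le> circle_mean (\<lambda>z. norm (f z * cnj z ^ n))"
    using assms by (simp add: fourier_coeff_nat integral_norm_bound)
  also have "\<dots> = circle_mean (\<lambda>z. norm (f z))"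
    by (intro Bochner_Integration.integral_cong) (auto simp: space_circle_measure norm_mult norm_power)
  finally show ?thesis .
qed

lemma integral_circle_cong:
  assumes "\<And>z. norm z = 1 \<Longrightarrow> f z = g z"
  shows "circle_mean (\<lambda>z. f z) = circle_mean (\<lambda>z. g z)"
  by (intro Bochner_Integration.integral_cong) (auto simp: space_circle_measure assms)

lemma integral_poly_mult_cnj_power:
  "circle_mean (\<lambda>z. poly F z * cnj z ^ n) = coeff F n"
proof (induction n arbitrary: F)
  case 0
  then show ?case by (simp add: integral_circle_poly poly_0_coeff_0)
next
  case (Suc n)
  obtain c F' where F: "F = pCons c F'" by (cases F)
  have "circle_mean (\<lambda>z. poly F z * cnj z ^ Suc n)
      = circle_mean (\<lambda>z. cnj (cnj c * z ^ Suc n) + poly F' z * cnj z ^ n)"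
  proof (rule integral_circle_cong)
    fix z :: complex assume "norm z = 1"
    from cnj_power_mult_power[OF this, of 1] have "cnj z * z = 1" by simp
    then have "poly F' z * cnj z ^ n * (cnj z * z) = poly F' z * cnj z ^ n" by simp
    then show "poly F z * cnj z ^ Suc n = cnj (cnj c * z ^ Suc n) + poly F' z * cnj z ^ n"
      by (simp add: F algebra_simps)
  qed
  also have "\<dots> = circle_mean (\<lambda>z. cnj (cnj c * z ^ Suc n)) + circle_mean (\<lambda>z. poly F' z * cnj z ^ n)"
    by (intro Bochner_Integration.integral_add integrable_circle_continuous continuous_intros)
  also have "circle_mean (\<lambda>z. cnj (cnj c * z ^ Suc n)) = cnj (cnj c * circle_mean (\<lambda>z. z ^ Suc n))"
    by (simp only: Bochner_Integration.integral_cnj integral_mult_right_zero)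
  also have "\<dots> = 0" by (simp add: integral_circle_power del: power_Suc)
  finally show ?case by (simp add: Suc F)
qed

lemma fourier_coeff_trig:
  assumes "poly G 0 = 0"
  shows "fourier_coeff (trig F G) (int n) = coeff F n"
proof -
  have "fourier_coeff (trig F G) (int n) = circle_mean (\<lambda>z. trig F G z * cnj z ^ n)"
    by (intro fourier_coeff_nat borel_measurable_circle_continuous continuous_on_trig)
  also have "\<dots> = circle_mean (\<lambda>z. poly F z * cnj z ^ n + cnj (poly (G * monom 1 n) z))"
    by (intro integral_circle_cong) (simp add: trig_def poly_monom algebra_simps)
  also have "\<dots> = circle_mean (\<lambda>z. poly F z * cnj z ^ n) + circle_mean (\<lambda>z. cnj (poly (G * monom 1 n) z))"
    by (intro Bochner_Integration.integral_add integrable_circle_continuous continuous_intros)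
  also have "circle_mean (\<lambda>z. cnj (poly (G * monom 1 n) z)) = cnj (poly (G * monom 1 n) 0)"
    by (simp only: Bochner_Integration.integral_cnj integral_circle_poly)
  finally show ?thesis using assms by (simp add: integral_poly_mult_cnj_power)
qed

lemma poly_split_at:
  fixes F :: "complex poly"
  obtains F1 where "\<And>z. poly F z = (\<Sum>n<N. coeff F n * z ^ n) + z ^ N * poly F1 z"
proof -
  have "\<exists>F1. (\<forall>z. poly F z = (\<Sum>n<N. coeff F n * z ^ n) + z ^ N * poly F1 z)
      \<and> (\<forall>n. coeff F1 n = coeff F (N + n))"
  proof (induction N)
    case 0
    show ?case by (intro exI[of _ F]) simp
  next
    case (Suc N)
    then obtain F1 where F1: "\<And>z. poly F z = (\<Sum>n<N. coeff F n * z ^ n) + z ^ N * poly F1 z"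
      "\<And>n. coeff F1 n = coeff F (N + n)" by blast
    obtain c F' where F': "F1 = pCons c F'" by (cases F1)
    have c: "c = coeff F N" using F1(2)[of 0] by (simp add: F')
    have "coeff F' n = coeff F (Suc N + n)" for n using F1(2)[of "Suc n"] by (simp add: F')
    moreover have "poly F z = (\<Sum>n<Suc N. coeff F n * z ^ n) + z ^ Suc N * poly F' z" for z
      using F1(1)[of z] by (simp add: F' c algebra_simps)
    ultimately show ?case by blast
  qed
  then show thesis using that by blast
qed

lemma pint_cong:
  assumes "\<And>z. norm z = 1 \<Longrightarrow> norm (f z) = norm (g z)"
  shows "pint p f = pint p g"
  unfolding pint_def by (intro integral_circle_cong) (simp add: assms)

lemma riesz_trig:
  assumes p: "p > 1"
  obtains C where "C \<ge> 0" "\<And>F G. poly G 0 = 0 \<Longrightarrow> pint p (poly F) \<le> C * pint p (trig F G)"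
proof -
  obtain g where g: "continuous_on {0..pi} g" "\<And>t. \<bar>g t\<bar> \<le> 1" "g pi < 0"
    and mean: "\<And>h. poly h 0 = 0 \<Longrightarrow> 0 \<le> circle_mean (\<lambda>x. polar_fun (p / 2) g (poly h x))"
  proof (cases "p \<le> 2")
    case True
    show thesis
    proof (rule that[of "\<lambda>t. cos (p / 2 * t)"])
      have "cos (p / 2 * pi) < cos (pi / 2)" using p True by (intro cos_monotone_0_pi) auto
      then show "cos (p / 2 * pi) < 0" by simp
      show "0 \<le> circle_mean (\<lambda>x. polar_fun (p / 2) (\<lambda>t. cos (p / 2 * t)) (poly h x))" if "poly h 0 = 0" for h
        using that p True by (intro cos_polar_mean_nonneg) auto
    qed (auto intro!: continuous_intros)
  next
    case False
    let ?g = "\<lambda>t. - cos (min (p / 2 * (pi - t)) pi)"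
    show thesis
    proof (rule that[of ?g])
      show "?g pi < 0" by simp
      fix h :: "complex poly" assume "poly h 0 = 0"
      then have "0 \<le> circle_mean (\<lambda>x. polar_fun (p / 2) (\<lambda>t. - cos (min (p / 2 * t) pi)) (poly (- h) x))"
        using False by (intro neg_cos_polar_mean_nonneg) auto
      then show "0 \<le> circle_mean (\<lambda>x. polar_fun (p / 2) ?g (poly h x))"
        by (simp add: polar_fun_def absarg_minus)
    qed (auto intro!: continuous_intros)
  qed
  obtain C D where CD: "C \<ge> 0" "D \<ge> 0"
    "\<And>z w. norm z powr p \<le> C * norm (z + cnj w) powr p - D * polar_fun (p / 2) g (z * w)"
    by (rule riesz_pointwise[of p g]) (use p g in auto)
  have "pint p (poly F) \<le> C * pint p (trig F G)" if G: "poly G 0 = 0" for F G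
  proof -
    have U: "continuous_on A (polar_fun (p / 2) g)" for A
      using continuous_on_polar_fun[OF _ g(1,2), of "p / 2"] p continuous_on_subset by force
    have i1: "integrable circle_measure (\<lambda>x. norm (trig F G x) powr p)"
      using Lp_circleD(2)[OF Lp_circle_trig] p by simp
    have i2: "integrable circle_measure (\<lambda>x. polar_fun (p / 2) g (poly F x * poly G x))"
      by (intro integrable_circle_continuous continuous_on_compose2[OF U[of UNIV]] continuous_intros) auto
    have i3: "integrable circle_measure (\<lambda>x. norm (poly F x) powr p)"
      using p by (intro integrable_circle_continuous continuous_on_powr' continuous_intros) auto
    have "pint p (poly F) \<le> circle_mean (\<lambda>x. C * norm (trig F G x) powr p - D * polar_fun (p / 2) g (poly F x * poly G x))"
      unfolding pint_def using CD(3)[of "poly F _" "poly G _"]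
      by (intro integral_mono i3 Bochner_Integration.integrable_diff integrable_mult_right i1 i2) (simp add: trig_def)
    also have "\<dots> = C * pint p (trig F G) - D * circle_mean (\<lambda>x. polar_fun (p / 2) g (poly F x * poly G x))"
      using i1 i2 by (simp add: pint_def)
    also have "\<dots> \<le> C * pint p (trig F G)"
      using mean[of "F * G"] G CD(2) by simp
    finally show ?thesis .
  qed
  then show thesis using that CD(1) by blast
qed

text \<open>A partial sum is the difference of two shifted analytic projections.\<close>

lemma psum_trig_bound:
  assumes p: "p > 1"
  obtains C where "C \<ge> 0" "\<And>F G N. poly G 0 = 0 \<Longrightarrow> pint p (psum (trig F G) N) \<le> C * pint p (trig F G)"
proof -
  obtain C where C: "C \<ge> 0" "\<And>F G. poly G 0 = 0 \<Longrightarrow> pint p (poly F) \<le> C * pint p (trig F G)"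
    by (rule riesz_trig[OF p]) blast
  have p0: "p > 0" using p by simp
  have "pint p (psum (trig F G) N) \<le> (2 powr p * (C + C)) * pint p (trig F G)" if G: "poly G 0 = 0" for F G N
  proof -
    obtain F1 where F1: "\<And>z. poly F z = (\<Sum>n<N. coeff F n * z ^ n) + z ^ N * poly F1 z"
      by (rule poly_split_at[where N = N and F = F]) blast
    \<comment> \<open>On the circle, \<open>cnj z ^ N\<close> times the partial sum has only
      negative frequencies; \<open>G1\<close> is the polynomial whose conjugate it is.\<close>
    define G1 where "G1 = (\<Sum>n<N. monom (cnj (coeff F n)) (N - n))"
    have G10: "poly G1 0 = 0" unfolding G1_def poly_sum poly_monom by (intro sum.neutral) auto
    have G1: "cnj z ^ N * (\<Sum>n<N. coeff F n * z ^ n) = cnj (poly G1 z)" if z: "norm z = 1" for z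
      unfolding G1_def poly_sum cnj_sum sum_distrib_left
    proof (rule sum.cong[OF refl])
      fix n assume "n \<in> {..<N}"
      then have "cnj z ^ N = cnj z ^ (N - n) * cnj z ^ n" by (simp flip: power_add)
      then have "cnj z ^ N * (coeff F n * z ^ n) = cnj z ^ (N - n) * coeff F n * (cnj z ^ n * z ^ n)"
        by (simp add: mult_ac)
      then show "cnj z ^ N * (coeff F n * z ^ n) = cnj (poly (monom (cnj (coeff F n)) (N - n)) z)"
        unfolding cnj_power_mult_power[OF z] by (simp add: poly_monom mult_ac)
    qed
    \<comment> \<open>Multiplication by \<open>cnj z ^ N\<close> preserves moduli on the circle and
      makes \<open>F1\<close> the analytic part, so the remainder is bounded by the same constant as
      the projection itself.\<close>
    have shift: "trig F1 (G1 + monom 1 N * G) z = cnj z ^ N * trig F G z" if z: "norm z = 1" for z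
    proof -
      have "cnj z ^ N * trig F G z = cnj z ^ N * (\<Sum>n<N. coeff F n * z ^ n) + (cnj z ^ N * z ^ N) * poly F1 z
          + cnj z ^ N * cnj (poly G z)"
        unfolding trig_def F1 by (simp add: algebra_simps)
      then show ?thesis unfolding G1[OF z] cnj_power_mult_power[OF z] by (simp add: trig_def poly_monom)
    qed
    have "psum (trig F G) N = (\<lambda>z. poly F z - z ^ N * poly F1 z)"
      by (rule ext) (simp add: psum_def fourier_coeff_trig[OF G] F1)
    then have "pint p (psum (trig F G) N) \<le> 2 powr p * (pint p (poly F) + pint p (\<lambda>z. z ^ N * poly F1 z))"
      by (simp only:) (intro Lp_circle_diff p0 Lp_circle_continuous continuous_intros)
    also have "pint p (\<lambda>z. z ^ N * poly F1 z) = pint p (poly F1)"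
      by (intro pint_cong) (simp add: norm_mult norm_power)
    also have "pint p (poly F1) \<le> C * pint p (trig F1 (G1 + monom 1 N * G))"
      using G G10 by (intro C) simp
    also have "pint p (trig F1 (G1 + monom 1 N * G)) = pint p (trig F G)"
      by (intro pint_cong) (simp add: shift norm_mult norm_power)
    also have "pint p (poly F) \<le> C * pint p (trig F G)" by (intro C G)
    finally show ?thesis by (simp add: algebra_simps)
  qed
  then show thesis using that[of "2 powr p * (C + C)"] C(1) by simp
qed

text \<open>For fixed \<open>N\<close> a partial sum depends on \<open>f\<close> only through
  \<open>N\<close> coefficients, each controlled by the mean modulus. The error of replacing
  \<open>f\<close> by a trigonometric polynomial depends on \<open>N\<close> but tends to
  \<open>0\<close> with \<open>e\<close>, and the remaining constant is independent of
  \<open>N\<close>.\<close>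

lemma psum_bound:
  assumes p: "p > 1"
  obtains C where "C \<ge> 0" "\<And>f N. f \<in> Lp_circle p \<Longrightarrow> pint p (psum f N) \<le> C * pint p f"
proof -
  obtain C where C: "C \<ge> 0" "\<And>F G N. poly G 0 = 0 \<Longrightarrow> pint p (psum (trig F G) N) \<le> C * pint p (trig F G)"
    by (rule psum_trig_bound[OF p]) blast
  have p0: "p > 0" using p by simp
  define B where "B f N e = 2 powr p * (C * (2 powr p * (pint p f + e powr p)) + (real N * (2 * e)) powr p)" for f N and e :: real
  have step: "pint p (psum f N) \<le> B f N e" if f: "f \<in> Lp_circle p" and e: "e > 0" for f N e
  proof -
    have "e powr p > 0" using e by simp
    then obtain F G where FG: "poly G 0 = 0" "pint p (\<lambda>z. f z - trig F G z) < e powr p"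
      by (rule Lp_circle_trig_dense[OF p0 f]) blast
    let ?q = "trig F G"
    have q: "?q \<in> Lp_circle p" using p0 by (rule Lp_circle_trig)
    have d: "(\<lambda>z. f z - ?q z) \<in> Lp_circle p" by (intro Lp_circle_diff p0 f q)
    have "circle_mean (\<lambda>z. norm (f z - ?q z)) \<le> e + e powr (1 - p) * e powr p"
      using Lp_circle_integrable(2)[OF p d e] FG(2) by (smt (verit) mult_left_mono powr_ge_zero)
    also have "\<dots> = 2 * e" using e by (simp flip: powr_add)
    finally have L1: "circle_mean (\<lambda>z. norm (f z - ?q z)) \<le> 2 * e" .
    have psd: "norm (psum f N z - psum ?q N z) \<le> real N * (2 * e)" if "norm z = 1" for z
    proof -
      have "norm (psum f N z - psum ?q N z) = norm (psum (\<lambda>z. f z - ?q z) N z)"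
        by (simp add: psum_diff Lp_circle_integrable(1)[OF p f] Lp_circle_integrable(1)[OF p q])
      also have "\<dots> \<le> (\<Sum>n<N. norm (fourier_coeff (\<lambda>z. f z - ?q z) (int n) * z ^ n))"
        unfolding psum_def by (rule norm_sum)
      also have "\<dots> \<le> (\<Sum>n<N. 2 * e)"
      proof (rule sum_mono)
        fix n
        have "norm (fourier_coeff (\<lambda>z. f z - ?q z) (int n)) \<le> 2 * e"
          using norm_fourier_coeff_le[OF Lp_circle_integrable(1)[OF p d]] L1 order_trans by blast
        then show "norm (fourier_coeff (\<lambda>z. f z - ?q z) (int n) * z ^ n) \<le> 2 * e"
          using that by (simp add: norm_mult norm_power)
      qed
      finally show ?thesis by simp
    qed
    have m: "(\<lambda>z. psum f N z - psum ?q N z) \<in> borel_measurable circle_measure"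
      using Lp_circleD(1)[OF Lp_circle_diff(1)[OF p0 Lp_circle_psum[OF p0] Lp_circle_psum[OF p0]]] .
    have "pint p (\<lambda>z. psum f N z - psum ?q N z) \<le> circle_mean (\<lambda>z. (real N * (2 * e)) powr p)"
      by (rule Lp_circle_bounded_by(2)[OF m]) (use psd p in \<open>auto intro!: AE_I2 powr_mono2 simp: space_circle_measure\<close>)
    then have 1: "pint p (\<lambda>z. psum f N z - psum ?q N z) \<le> (real N * (2 * e)) powr p"
      using circle.prob_space by simp
    have "pint p ?q \<le> 2 powr p * (pint p f + pint p (\<lambda>z. f z - ?q z))"
      using Lp_circle_diff(2)[OF p0 f d] by simp
    also have "\<dots> \<le> 2 powr p * (pint p f + e powr p)" using FG(2) by (intro mult_left_mono add_left_mono) auto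
    finally have 2: "C * pint p ?q \<le> C * (2 powr p * (pint p f + e powr p))" using C(1) by (rule mult_left_mono)
    have "pint p (psum f N) \<le> 2 powr p * (pint p (psum ?q N) + pint p (\<lambda>z. psum f N z - psum ?q N z))"
      using Lp_circle_add(2)[OF p0 Lp_circle_psum[OF p0] Lp_circle_diff(1)[OF p0 Lp_circle_psum[OF p0] Lp_circle_psum[OF p0]], of ?q N f N ?q N]
      by simp
    also have "\<dots> \<le> B f N e"
      unfolding B_def using C(2)[OF FG(1), of F N] 1 2 by (intro mult_left_mono add_mono) auto
    finally show ?thesis .
  qed
  have "pint p (psum f N) \<le> (2 powr p * (C * 2 powr p)) * pint p f" if f: "f \<in> Lp_circle p" for f N
  proof -
    have "(\<lambda>k. B f N (inverse (real (Suc k)))) \<longlonglongrightarrow> 2 powr p * (C * (2 powr p * (pint p f + 0 powr p)) + (real N * (2 * 0)) powr p)"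
      unfolding B_def using p
      by (intro tendsto_intros tendsto_powr' LIMSEQ_inverse_real_of_nat) auto
    then have "pint p (psum f N) \<le> 2 powr p * (C * (2 powr p * (pint p f + 0 powr p)) + (real N * (2 * 0)) powr p)"
      by (rule LIMSEQ_le_const) (intro exI[of _ 0] allI impI step[OF f], simp)
    then show ?thesis by (simp add: mult_ac)
  qed
  then show thesis using that[of "2 powr p * (C * 2 powr p)"] C(1) by simp
qed

lemma psum_trig_eq_poly:
  assumes "poly G 0 = 0" "degree F < N"
  shows "psum (trig F G) N = poly F"
proof
  fix z
  have "poly F z = (\<Sum>i\<le>degree F. coeff F i * z ^ i)" by (rule poly_altdef)
  also have "\<dots> = (\<Sum>i<N. coeff F i * z ^ i)"
    using assms(2) by (intro sum.mono_neutral_left) (auto simp: coeff_eq_0)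
  finally show "psum (trig F G) N z = poly F z" by (simp add: psum_def fourier_coeff_trig[OF assms(1)])
qed

text \<open>The partial sums are Cauchy: those of a nearby trigonometric polynomial are eventually
  equal to its analytic part, and \<open>psum_bound\<close> controls the difference uniformly. Their
  limit witnesses the choice in the definition of \<open>riesz_plus\<close>.\<close>

lemma riesz_plus:
  assumes p: "p > 1" and f: "f \<in> Lp_circle p"
  shows "riesz_plus p f \<in> Lp_circle p"
    and "(\<lambda>N. pint p (\<lambda>z. riesz_plus p f z - psum f N z)) \<longlonglongrightarrow> 0"
proof -
  have p0: "p > 0" using p by simp
  obtain C where C: "C \<ge> 0" "\<And>f N. f \<in> Lp_circle p \<Longrightarrow> pint p (psum f N) \<le> C * pint p f"
    by (rule psum_bound[OF p]) blast
  have "\<exists>M. \<forall>m\<ge>M. \<forall>n\<ge>M. pint p (\<lambda>z. psum f m z - psum f n z) < e" if e: "e > 0" for e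
  proof -
    define e1 where "e1 = e / (2 powr p * (2 * (C + 1)))"
    have e1: "e1 > 0" using e C(1) by (simp add: e1_def)
    obtain F G where FG: "poly G 0 = 0" "pint p (\<lambda>z. f z - trig F G z) < e1"
      by (rule Lp_circle_trig_dense[OF p0 f e1]) blast
    let ?q = "trig F G"
    have q: "?q \<in> Lp_circle p" using p0 by (rule Lp_circle_trig)
    have d: "(\<lambda>z. f z - ?q z) \<in> Lp_circle p" by (intro Lp_circle_diff p0 f q)
    have close: "pint p (\<lambda>z. psum f n z - poly F z) \<le> C * e1" if "n > degree F" for n
    proof -
      have "(\<lambda>z. psum f n z - poly F z) = psum (\<lambda>z. f z - ?q z) n"
        unfolding psum_trig_eq_poly[OF FG(1) that, symmetric]
        by (intro ext psum_diff Lp_circle_integrable(1)[OF p] f q)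
      then have "pint p (\<lambda>z. psum f n z - poly F z) \<le> C * pint p (\<lambda>z. f z - ?q z)" using C(2)[OF d] by simp
      also have "\<dots> \<le> C * e1" using FG(2) C(1) by (intro mult_left_mono) auto
      finally show ?thesis .
    qed
    have "pint p (\<lambda>z. psum f m z - psum f n z) < e" if "m > degree F" "n > degree F" for m n
    proof -
      have "poly F \<in> Lp_circle p" by (intro Lp_circle_continuous continuous_intros p0)
      from pint_diff_triangle[OF p0 Lp_circle_psum[OF p0] this Lp_circle_psum[OF p0]]
      have "pint p (\<lambda>z. psum f m z - psum f n z) \<le> 2 powr p * (pint p (\<lambda>z. psum f m z - poly F z) + pint p (\<lambda>z. poly F z - psum f n z))" .
      also have "\<dots> \<le> 2 powr p * (C * e1 + C * e1)"
        using close[OF that(1)] close[OF that(2)] pint_diff_commute[of p "poly F" "psum f n"]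
        by (intro mult_left_mono add_mono) auto
      also have "\<dots> < 2 powr p * ((C + 1) * e1 + (C + 1) * e1)" using e1 by (intro mult_strict_left_mono) (auto simp: algebra_simps)
      also have "\<dots> = e"
      proof -
        have "2 powr p * (2 * (C + 1)) \<noteq> 0" using C(1) by simp
        then have "e1 * (2 powr p * (2 * (C + 1))) = e" by (simp add: e1_def)
        then show ?thesis by (simp add: algebra_simps)
      qed
      finally show ?thesis .
    qed
    then show ?thesis by (intro exI[of _ "Suc (degree F)"]) auto
  qed
  then obtain g where g: "g \<in> Lp_circle p" "(\<lambda>N. pint p (\<lambda>z. g z - psum f N z)) \<longlonglongrightarrow> 0"
    by (rule Lp_circle_complete[OF p0 Lp_circle_psum[OF p0]]) blast
  have norm_pint: "Lp_norm p u = pint p u powr (1 / p)" for u :: "complex \<Rightarrow> complex" by (simp add: Lp_norm_def pint_def)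
  have "(\<lambda>N. pint p (\<lambda>z. g z - psum f N z) powr (1 / p)) \<longlonglongrightarrow> 0 powr (1 / p)"
    using p g(2) by (intro tendsto_powr' tendsto_const) (auto simp: pint_nonneg)
  then have ex: "\<exists>g. g \<in> Lp_circle p \<and>
     (\<lambda>N. Lp_norm p (\<lambda>z. g z - (\<Sum>n<N. fourier_coeff f (int n) * z ^ n))) \<longlonglongrightarrow> 0"
    using g(1) by (auto simp: norm_pint psum_def)
  from someI_ex[OF this] have *: "riesz_plus p f \<in> Lp_circle p"
    "(\<lambda>N. Lp_norm p (\<lambda>z. riesz_plus p f z - psum f N z)) \<longlonglongrightarrow> 0"
    unfolding riesz_plus_def[symmetric] psum_def by auto
  show "riesz_plus p f \<in> Lp_circle p" by (rule *)
  have "(\<lambda>N. Lp_norm p (\<lambda>z. riesz_plus p f z - psum f N z) powr p) \<longlonglongrightarrow> 0 powr p"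
    using p by (intro tendsto_powr' *(2) tendsto_const) (auto simp: norm_pint)
  then show "(\<lambda>N. pint p (\<lambda>z. riesz_plus p f z - psum f N z)) \<longlonglongrightarrow> 0"
    using p by (simp add: norm_pint powr_powr pint_nonneg)
qed

text \<open>Stability of the projection. Applied to a trigonometric polynomial itself, it identifies
  the chosen representative with \<open>poly F\<close> almost everywhere.\<close>

lemma riesz_plus_approx:
  assumes p: "p > 1"
  obtains C where "C \<ge> 0" "\<And>f F G. f \<in> Lp_circle p \<Longrightarrow> poly G 0 = 0 \<Longrightarrow>
    pint p (\<lambda>z. riesz_plus p f z - poly F z) \<le> C * pint p (\<lambda>z. f z - trig F G z)"
proof -
  have p0: "p > 0" using p by simp
  obtain C where C: "C \<ge> 0" "\<And>f N. f \<in> Lp_circle p \<Longrightarrow> pint p (psum f N) \<le> C * pint p f"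
    by (rule psum_bound[OF p]) blast
  have "pint p (\<lambda>z. riesz_plus p f z - poly F z) \<le> (2 powr p * C) * pint p (\<lambda>z. f z - trig F G z)"
    if f: "f \<in> Lp_circle p" and G: "poly G 0 = 0" for f F G
  proof -
    let ?q = "trig F G"
    have q: "?q \<in> Lp_circle p" using p0 by (rule Lp_circle_trig)
    have d: "(\<lambda>z. f z - ?q z) \<in> Lp_circle p" by (intro Lp_circle_diff p0 f q)
    have F: "poly F \<in> Lp_circle p" by (intro Lp_circle_continuous continuous_intros p0)
    have le: "pint p (\<lambda>z. riesz_plus p f z - poly F z)
        \<le> 2 powr p * (pint p (\<lambda>z. riesz_plus p f z - psum f N z) + C * pint p (\<lambda>z. f z - ?q z))" if "N \<ge> Suc (degree F)" for N
    proof -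
      have "degree F < N" using that by simp
      have "(\<lambda>z. psum f N z - poly F z) = psum (\<lambda>z. f z - ?q z) N"
        unfolding psum_trig_eq_poly[OF G \<open>degree F < N\<close>, symmetric]
        by (intro ext psum_diff Lp_circle_integrable(1)[OF p] f q)
      then have "pint p (\<lambda>z. psum f N z - poly F z) \<le> C * pint p (\<lambda>z. f z - ?q z)" using C(2)[OF d] by simp
      then show ?thesis
        using pint_diff_triangle[OF p0 riesz_plus(1)[OF p f] Lp_circle_psum[OF p0] F, of f N]
        by (smt (verit) mult_left_mono powr_ge_zero)
    qed
    have "(\<lambda>N. 2 powr p * (pint p (\<lambda>z. riesz_plus p f z - psum f N z) + C * pint p (\<lambda>z. f z - ?q z)))
        \<longlonglongrightarrow> 2 powr p * (0 + C * pint p (\<lambda>z. f z - ?q z))"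
      by (intro tendsto_intros riesz_plus(2)[OF p f])
    then have "pint p (\<lambda>z. riesz_plus p f z - poly F z) \<le> 2 powr p * (0 + C * pint p (\<lambda>z. f z - ?q z))"
      by (rule LIMSEQ_le_const) (use le in blast)
    then show ?thesis by simp
  qed
  then show thesis using that[of "2 powr p * C"] C(1) by simp
qed

lemma fast_convergence_tendsto:
  fixes d :: "nat \<Rightarrow> complex"
  assumes p: "p > 0" and H: "H \<ge> 0" and d: "\<And>k. norm (d k) powr p \<le> H * (2 powr (- p)) ^ k"
  shows "d \<longlonglongrightarrow> 0"
proof (rule Lim_null_comparison)
  show "\<forall>\<^sub>F k in sequentially. norm (d k) \<le> H powr (1 / p) * (1 / 2) ^ k"
    using powr_le_geometricD[OF p _ H d] by simp
  show "(\<lambda>k. H powr (1 / p) * (1 / 2) ^ k) \<longlonglongrightarrow> 0"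
    by (intro tendsto_mult_right_zero LIMSEQ_power_zero) simp
qed

text \<open>The approximants are chosen so close that \<open>f\<close> and its projection are limits
  almost everywhere of the polynomial data, under integrable majorants. Dominated convergence then
  preserves the inequality with its exact constant.\<close>

lemma riesz_plus_transfer:
  fixes \<Phi> :: "complex \<Rightarrow> complex \<Rightarrow> real"
  assumes p: "p > 1" and f: "f \<in> Lp_circle p"
    and cont: "continuous_on UNIV (\<lambda>(a, b). \<Phi> a b)"
    and bound: "\<And>a b. \<bar>\<Phi> a b\<bar> \<le> K * (norm a powr p + norm b powr p)" "K \<ge> 0"
    and trig: "\<And>F G. poly G 0 = 0 \<Longrightarrow> 0 \<le> circle_mean (\<lambda>z. \<Phi> (trig F G z) (poly F z))"
  shows "0 \<le> circle_mean (\<lambda>z. \<Phi> (f z) (riesz_plus p f z))"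
proof -
  have p0: "p > 0" using p by simp
  define g where "g = riesz_plus p f"
  have g: "g \<in> Lp_circle p" unfolding g_def by (rule riesz_plus[OF p f])
  obtain C where C: "C \<ge> 0" "\<And>F G. poly G 0 = 0 \<Longrightarrow>
    pint p (\<lambda>z. g z - poly F z) \<le> C * pint p (\<lambda>z. f z - trig F G z)"
    unfolding g_def by (rule riesz_plus_approx[OF p]) (use f in blast)
  \<comment> \<open>Dividing by \<open>C + 1\<close> makes the error of the projections as small as
    that of the approximants.\<close>
  have "\<exists>F G. poly G 0 = 0 \<and> pint p (\<lambda>z. f z - trig F G z) < (4 powr (- p)) ^ k / (C + 1)" for k
  proof -
    have "(4 powr (- p)) ^ k / (C + 1) > 0" using C(1) by simp
    then show ?thesis by (rule Lp_circle_trig_dense[OF p0 f]) blast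
  qed
  then obtain F G where FG: "\<And>k. poly (G k) 0 = 0"
    "\<And>k. pint p (\<lambda>z. f z - trig (F k) (G k) z) < (4 powr (- p)) ^ k / (C + 1)" by metis
  define q where "q k = trig (F k) (G k)" for k
  have q: "q k \<in> Lp_circle p" for k unfolding q_def using p0 by (rule Lp_circle_trig)
  have F: "poly (F k) \<in> Lp_circle p" for k by (intro Lp_circle_continuous continuous_intros p0)
  have b1: "pint p (\<lambda>z. f z - q k z) \<le> (4 powr (- p)) ^ k" for k
  proof -
    have "(4 powr (- p)) ^ k / (C + 1) \<le> (4 powr (- p)) ^ k / 1"
      using C(1) by (intro divide_left_mono) auto
    then show ?thesis using FG(2)[of k] by (simp add: q_def)
  qed
  have b2: "pint p (\<lambda>z. g z - poly (F k) z) \<le> (4 powr (- p)) ^ k" for k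
  proof -
    have "pint p (\<lambda>z. g z - poly (F k) z) \<le> (C + 1) * pint p (\<lambda>z. f z - q k z)"
      using C(2)[OF FG(1), of "F k" k] pint_nonneg[of p "\<lambda>z. f z - q k z"] by (simp add: q_def algebra_simps)
    also have "\<dots> \<le> (C + 1) * ((4 powr (- p)) ^ k / (C + 1))"
      using FG(2)[of k] C(1) by (intro mult_left_mono) (auto simp: q_def)
    finally show ?thesis using C(1) by simp
  qed
  obtain H1 where H1: "integrable circle_measure H1" "\<And>z. H1 z \<ge> 0"
    "AE z in circle_measure. \<forall>k. norm (f z - q k z) powr p \<le> H1 z * (2 powr (- p)) ^ k"
    by (rule fast_convergence[OF p0 Lp_circle_diff(1)[OF p0 f q] b1]) blast
  obtain H2 where H2: "integrable circle_measure H2" "\<And>z. H2 z \<ge> 0"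
    "AE z in circle_measure. \<forall>k. norm (g z - poly (F k) z) powr p \<le> H2 z * (2 powr (- p)) ^ k"
    by (rule fast_convergence[OF p0 Lp_circle_diff(1)[OF p0 g F] b2]) blast
  have \<Phi>_m: "(\<lambda>z. \<Phi> (u z) (v z)) \<in> borel_measurable circle_measure" if "u \<in> Lp_circle p" "v \<in> Lp_circle p" for u v
  proof -
    have [measurable]: "(\<lambda>(a, b). \<Phi> a b) \<in> borel_measurable borel"
      using cont by (rule borel_measurable_continuous_onI)
    have [measurable]: "u \<in> borel_measurable circle_measure" "v \<in> borel_measurable circle_measure"
      using that Lp_circleD by auto
    have "(\<lambda>z. (u z, v z)) \<in> borel_measurable circle_measure" by measurable
    from measurable_compose[OF this \<open>(\<lambda>(a, b). \<Phi> a b) \<in> borel_measurable borel\<close>] show ?thesis by simp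
  qed
  define H where "H z = K * (2 powr p * (norm (f z) powr p + H1 z) + 2 powr p * (norm (g z) powr p + H2 z))" for z
  have "(\<lambda>k. circle_mean (\<lambda>z. \<Phi> (q k z) (poly (F k) z))) \<longlonglongrightarrow> circle_mean (\<lambda>z. \<Phi> (f z) (g z))"
  proof (rule integral_dominated_convergence)
    show "integrable circle_measure H"
      unfolding H_def using Lp_circleD(2)[OF f] Lp_circleD(2)[OF g] H1(1) H2(1) by simp
    show "AE z in circle_measure. (\<lambda>k. \<Phi> (q k z) (poly (F k) z)) \<longlonglongrightarrow> \<Phi> (f z) (g z)"
      using H1(3) H2(3)
    proof eventually_elim
      case (elim z)
      have "(\<lambda>k. f z - q k z) \<longlonglongrightarrow> 0" "(\<lambda>k. g z - poly (F k) z) \<longlonglongrightarrow> 0"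
        using fast_convergence_tendsto[OF p0 H1(2)[of z]] fast_convergence_tendsto[OF p0 H2(2)[of z]] elim by auto
      from tendsto_diff[OF tendsto_const this(1), of "f z"] tendsto_diff[OF tendsto_const this(2), of "g z"]
      have "(\<lambda>k. (q k z, poly (F k) z)) \<longlonglongrightarrow> (f z, g z)" by (auto intro!: tendsto_Pair)
      moreover have "isCont (\<lambda>(a, b). \<Phi> a b) (f z, g z)" using cont by (simp add: continuous_on_eq_continuous_at)
      ultimately have "(\<lambda>k. (\<lambda>(a, b). \<Phi> a b) (q k z, poly (F k) z)) \<longlonglongrightarrow> (\<lambda>(a, b). \<Phi> a b) (f z, g z)"
        by (rule isCont_tendsto_compose[rotated])
      then show ?case by simp
    qed
    show "AE z in circle_measure. norm (\<Phi> (q k z) (poly (F k) z)) \<le> H z" for k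
      using H1(3) H2(3)
    proof eventually_elim
      case (elim z)
      have half: "norm (b :: complex) powr p \<le> 2 powr p * (norm a powr p + h)"
        if "norm (a - b) powr p \<le> h * (2 powr (- p)) ^ k" "h \<ge> 0" for a b h
      proof -
        have "(2 powr (- p)) ^ k \<le> 1" using p0 by (intro power_le_one less_imp_le[OF powr_less_one]) auto
        then have "h * (2 powr (- p)) ^ k \<le> h" using that(2) by (simp add: mult_left_le)
        then have "norm (b - a) powr p \<le> h" using that(1) by (simp add: norm_minus_commute)
        moreover have "norm b powr p \<le> 2 powr p * (norm a powr p + norm (b - a) powr p)"
          using norm_add_powr_le[OF p0, of a "b - a"] by simp
        ultimately show ?thesis by (smt (verit) mult_left_mono powr_ge_zero)
      qed
      have "norm (\<Phi> (q k z) (poly (F k) z)) \<le> K * (norm (q k z) powr p + norm (poly (F k) z) powr p)"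
        using bound(1) by simp
      also have "\<dots> \<le> H z"
      proof -
        have "norm (q k z) powr p \<le> 2 powr p * (norm (f z) powr p + H1 z)"
          by (rule half) (use elim H1(2) in auto)
        moreover have "norm (poly (F k) z) powr p \<le> 2 powr p * (norm (g z) powr p + H2 z)"
          by (rule half) (use elim H2(2) in auto)
        ultimately show ?thesis unfolding H_def using bound(2) by (intro mult_left_mono add_mono)
      qed
      finally show ?case .
    qed
  qed (use \<Phi>_m f g q F in auto)
  then show ?thesis
    unfolding g_def[symmetric] by (rule LIMSEQ_le_const) (use trig[OF FG(1)] in \<open>auto simp: q_def\<close>)
qed

section \<open>Upper bounds\<close>

text \<open>Monotonicity of power means, that is, concavity of \<open>t powr \<theta>\<close>:
  Young's inequality against the arithmetic mean \<open>m\<close> is the tangent bound at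
  \<open>m\<close>.\<close>

lemma powr_sum_mono_exponent:
  fixes x y r s :: real
  assumes "0 < r" "r \<le> s" "0 \<le> x" "0 \<le> y"
  shows "x powr r + y powr r \<le> 2 powr (1 - r / s) * (x powr s + y powr s) powr (r / s)"
proof (cases "x = 0 \<and> y = 0")
  case False
  define \<theta> where "\<theta> = r / s"
  have \<theta>: "0 < \<theta>" "\<theta> \<le> 1" using assms by (auto simp: \<theta>_def)
  define u v where "u = x powr s" and "v = y powr s"
  have uv: "u \<ge> 0" "v \<ge> 0" "u + v > 0"
    using False assms by (auto simp: u_def v_def add_nonneg_eq_0_iff intro: add_pos_nonneg add_nonneg_pos)
  define m where "m = (u + v) / 2"
  have m: "m > 0" using uv by (simp add: m_def)
  have Y: "t powr \<theta> * m powr (1 - \<theta>) \<le> \<theta> * t + (1 - \<theta>) * m" if "t \<ge> 0" for t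
    using Youngs_inequality_0[of \<theta> "1 - \<theta>" t m] \<theta> m that by (cases "t = 0") auto
  have "(u powr \<theta> + v powr \<theta>) * m powr (1 - \<theta>) \<le> 2 * m"
    using Y[OF uv(1)] Y[OF uv(2)] by (simp add: m_def field_simps)
  also have "\<dots> = 2 * m powr \<theta> * m powr (1 - \<theta>)" using m by (simp flip: powr_add)
  finally have "u powr \<theta> + v powr \<theta> \<le> 2 * m powr \<theta>" using m by simp
  also have "\<dots> = 2 powr (1 - \<theta>) * (u + v) powr \<theta>"
    using uv by (simp add: m_def powr_divide powr_diff)
  finally show ?thesis using assms by (simp add: u_def v_def powr_powr \<theta>_def)
qed (use assms in auto)

text \<open>Normalised by \<open>x + y\<close> both entries lie in \<open>[0, 1]\<close>, where
  \<open>t \<le> t powr s\<close>.\<close>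

lemma add_le_powr_sum:
  fixes x y s :: real
  assumes "0 < s" "s \<le> 1" "0 \<le> x" "0 \<le> y"
  shows "x + y \<le> (x powr s + y powr s) powr (1 / s)"
proof (cases "x + y = 0")
  case False
  then have pos: "x + y > 0" using assms by simp
  have le: "t \<le> t powr s" if "0 \<le> t" "t \<le> 1" for t
    using powr_mono'[of s 1 t] assms that by (cases "t = 0") auto
  have "1 = x / (x + y) + y / (x + y)" using pos by (simp flip: add_divide_distrib)
  also have "\<dots> \<le> (x / (x + y)) powr s + (y / (x + y)) powr s"
    using assms pos by (intro add_mono le) auto
  also have "\<dots> = (x powr s + y powr s) / (x + y) powr s"
    using assms pos by (simp add: powr_divide add_divide_distrib)
  finally have "(x + y) powr s \<le> x powr s + y powr s" using pos by (simp add: field_simps)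
  then have "((x + y) powr s) powr (1 / s) \<le> (x powr s + y powr s) powr (1 / s)"
    using assms by (intro powr_mono2) auto
  then show ?thesis using assms pos by (simp add: powr_powr)
qed (use assms in auto)

lemma powr_sum_powr_le:
  fixes x y s p :: real
  assumes "0 < s" "0 < p" "0 \<le> x" "0 \<le> y"
  shows "(x powr s + y powr s) powr (p / s) \<le> 2 powr (p / s) * (x powr p + y powr p)"
proof -
  have mx: "x powr s \<le> (max x y) powr s" "y powr s \<le> (max x y) powr s" using assms by (auto intro!: powr_mono2)
  then have "(x powr s + y powr s) powr (p / s) \<le> (2 * (max x y) powr s) powr (p / s)"
    using assms by (intro powr_mono2) auto
  also have "\<dots> = 2 powr (p / s) * (max x y) powr p" using assms by (simp add: powr_mult powr_powr)
  also have "\<dots> \<le> 2 powr (p / s) * (x powr p + y powr p)" by (intro mult_left_mono) (auto simp: max_def)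
  finally show ?thesis .
qed

text \<open>The \<open>p\<close>-th power of the mixed integrand, with \<open>a\<close> standing for
  a value of \<open>f\<close> and \<open>b\<close> for one of its analytic projection.\<close>

definition mixed :: "real \<Rightarrow> real \<Rightarrow> complex \<Rightarrow> complex \<Rightarrow> real" where
  "mixed p s a b = (norm b powr s + norm (a - b) powr s) powr (p / s)"

lemma mixed_nonneg: "0 \<le> mixed p s a b"
  by (simp add: mixed_def)

lemma mixed_le:
  assumes "0 < s" "0 < p"
  shows "mixed p s a b \<le> (2 powr (p / s) * 2 powr p) * (norm a powr p + 2 * norm b powr p)"
proof -
  have "norm (a - b) powr p \<le> 2 powr p * (norm a powr p + norm b powr p)"
    using norm_add_powr_le[OF assms(2), of a "- b"] by simp
  moreover have "1 * norm b powr p \<le> 2 powr p * norm b powr p"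
    using assms by (intro mult_right_mono) (auto simp: ge_one_powr_ge_zero)
  ultimately have "norm b powr p + norm (a - b) powr p \<le> 2 powr p * (norm a powr p + 2 * norm b powr p)"
    by (simp add: algebra_simps)
  then have "2 powr (p / s) * (norm b powr p + norm (a - b) powr p) \<le> 2 powr (p / s) * (2 powr p * (norm a powr p + 2 * norm b powr p))"
    by (intro mult_left_mono) auto
  moreover have "mixed p s a b \<le> 2 powr (p / s) * (norm b powr p + norm (a - b) powr p)"
    unfolding mixed_def using assms by (intro powr_sum_powr_le) auto
  ultimately show ?thesis unfolding mult.assoc by (rule order_trans[rotated])
qed

lemma continuous_on_mixed:
  assumes "0 < s" "0 < p"
  shows "continuous_on UNIV (\<lambda>(a, b). mixed p s a b)"
  unfolding mixed_def case_prod_unfold using assms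
  by (intro continuous_intros continuous_on_powr') auto

lemma integrable_mixed:
  assumes s: "0 < s" and p: "1 < p" and f: "f \<in> Lp_circle p"
  shows "integrable circle_measure (\<lambda>z. mixed p s (f z) (riesz_plus p f z))"
proof -
  note fD = Lp_circleD[OF f] and gD = Lp_circleD[OF riesz_plus(1)[OF p f]]
  note [measurable] = fD(1) gD(1)
  have "integrable circle_measure (\<lambda>z. (2 powr (p / s) * 2 powr p) * (norm (f z) powr p + 2 * norm (riesz_plus p f z) powr p))"
    using fD(2) gD(2) by simp
  then show ?thesis
  proof (rule Bochner_Integration.integrable_bound)
    show "(\<lambda>z. mixed p s (f z) (riesz_plus p f z)) \<in> borel_measurable circle_measure"
      unfolding mixed_def by measurable
    show "AE z in circle_measure. norm (mixed p s (f z) (riesz_plus p f z))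
        \<le> norm ((2 powr (p / s) * 2 powr p) * (norm (f z) powr p + 2 * norm (riesz_plus p f z) powr p))"
    proof (rule AE_I2)
      fix z
      show "norm (mixed p s (f z) (riesz_plus p f z))
        \<le> norm ((2 powr (p / s) * 2 powr p) * (norm (f z) powr p + 2 * norm (riesz_plus p f z) powr p))"
        using mixed_le[OF s, of p "f z" "riesz_plus p f z"] p mixed_nonneg[of p s "f z" "riesz_plus p f z"] by simp
    qed
  qed
qed

abbreviation mixed_norm :: "real \<Rightarrow> real \<Rightarrow> (complex \<Rightarrow> complex) \<Rightarrow> real" where
  "mixed_norm p s f \<equiv> Lp_norm p (\<lambda>z. (norm (riesz_plus p f z) powr s + norm (riesz_minus p f z) powr s) powr (1 / s))"

lemma Lp_norm_mixed:
  "mixed_norm p s f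
    = circle_mean (\<lambda>z. mixed p s (f z) (riesz_plus p f z)) powr (1 / p)"
  by (simp add: Lp_norm_def mixed_def riesz_minus_def powr_powr)

lemma mixed_mono_exponent:
  assumes "0 < r" "r \<le> s" "0 < p"
  shows "mixed p r a b \<le> 2 powr (p / r - p / s) * mixed p s a b"
proof -
  have "mixed p r a b \<le> (2 powr (1 - r / s) * (norm b powr s + norm (a - b) powr s) powr (r / s)) powr (p / r)"
    unfolding mixed_def using assms by (intro powr_mono2 powr_sum_mono_exponent) auto
  also have "\<dots> = 2 powr ((1 - r / s) * (p / r)) * mixed p s a b"
    using assms by (simp add: mixed_def powr_mult powr_powr)
  also have "(1 - r / s) * (p / r) = p / r - p / s" using assms by (simp add: field_simps)
  finally show ?thesis .
qed

text \<open>\<open>A\<close> collects the constant at the smallest exponent \<open>r\<close> and the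
  power mean factor for passing from \<open>r\<close> to \<open>s\<close>.\<close>

lemma Lp_norm_le_mixed:
  assumes p: "1 < p" and r: "0 < r" "r \<le> s" and f: "f \<in> Lp_circle p" and K: "K \<ge> 0"
    and bound: "pint p f \<le> K * circle_mean (\<lambda>z. mixed p r (f z) (riesz_plus p f z))"
    and A: "A \<ge> 0" "K * 2 powr (p / r - p / s) = A powr p"
  shows "Lp_norm p f \<le> A * mixed_norm p s f"
proof -
  let ?I = "\<lambda>s. circle_mean (\<lambda>z. mixed p s (f z) (riesz_plus p f z))"
  have "?I r \<le> circle_mean (\<lambda>z. 2 powr (p / r - p / s) * mixed p s (f z) (riesz_plus p f z))"
    using p r f by (intro integral_mono integrable_mult_right integrable_mixed mixed_mono_exponent) auto
  also have "\<dots> = 2 powr (p / r - p / s) * ?I s" by simp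
  finally have "K * ?I r \<le> K * (2 powr (p / r - p / s) * ?I s)" using K by (rule mult_left_mono)
  then have "pint p f \<le> A powr p * ?I s" using bound unfolding A(2)[symmetric] by (simp add: mult.assoc)
  then have "pint p f powr (1 / p) \<le> (A powr p * ?I s) powr (1 / p)"
    using p by (intro powr_mono2) (auto simp: pint_nonneg)
  also have "\<dots> = A * ?I s powr (1 / p)"
    using p A(1) by (simp add: powr_mult powr_powr integral_nonneg mixed_nonneg)
  finally show ?thesis unfolding Lp_norm_mixed by (simp add: Lp_norm_def pint_def)
qed

text \<open>For \<open>f = F + cnj G\<close> on the circle the two projections have moduli
  \<open>|F|\<close> and \<open>|G|\<close>, so the pointwise inequality at \<open>z = F\<close>,
  \<open>w = G\<close> integrates to the claim. The passage to general \<open>f\<close> needs a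
  two-sided growth bound on the integrand.\<close>

lemma pint_le_mixed:
  assumes p: "1 < p" and r: "0 < r" and K: "K \<ge> 0" and D: "D \<ge> 0" and f: "f \<in> Lp_circle p"
    and U: "continuous_on UNIV U" "\<And>F G. poly G 0 = 0 \<Longrightarrow> 0 \<le> circle_mean (\<lambda>x. U (poly F x * poly G x))"
    and bound: "\<And>z w. norm (z + cnj w) powr p \<le> K * (norm z powr r + norm w powr r) powr (p / r) - D * U (z * w)"
  shows "pint p f \<le> K * circle_mean (\<lambda>x. mixed p r (f x) (riesz_plus p f x))"
proof -
  have p0: "p > 0" using p by simp
  define \<Phi> where "\<Phi> a b = K * mixed p r a b - norm a powr p" for a b
  have cont: "continuous_on UNIV (\<lambda>(a, b). \<Phi> a b)"
  proof -
    have "continuous_on UNIV (\<lambda>ab. K * (\<lambda>(a, b). mixed p r a b) ab - norm (fst ab :: complex) powr p)"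
      using p by (intro continuous_intros continuous_on_mixed r p0 continuous_on_powr') auto
    then show ?thesis by (simp add: \<Phi>_def case_prod_unfold)
  qed
  \<comment> \<open>The summand \<open>1\<close> accounts for the term
    \<open>norm a powr p\<close>.\<close>
  define L where "L = K * (2 powr (p / r) * 2 powr p) * 2 + 1"
  have "0 \<le> circle_mean (\<lambda>x. \<Phi> (f x) (riesz_plus p f x))"
  proof (rule riesz_plus_transfer[OF p f cont])
    show "L \<ge> 0" using K by (simp add: L_def)
    show "\<bar>\<Phi> a b\<bar> \<le> L * (norm a powr p + norm b powr p)" for a b
    proof -
      have "K * mixed p r a b \<le> K * ((2 powr (p / r) * 2 powr p) * (norm a powr p + 2 * norm b powr p))"
        by (intro mult_left_mono mixed_le r p0 K)
      also have "\<dots> \<le> K * ((2 powr (p / r) * 2 powr p) * (2 * (norm a powr p + norm b powr p)))"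
        using K by (intro mult_left_mono) auto
      also have "\<dots> = (L - 1) * (norm a powr p + norm b powr p)" by (simp add: L_def algebra_simps)
      finally have "K * mixed p r a b \<le> (L - 1) * (norm a powr p + norm b powr p)" .
      moreover have "K * mixed p r a b \<ge> 0" using K by (simp add: mixed_nonneg)
      moreover have "(L - 1) * (norm a powr p + norm b powr p) \<ge> 0" using K by (simp add: L_def)
      moreover have "L * (norm a powr p + norm b powr p) = (L - 1) * (norm a powr p + norm b powr p) + (norm a powr p + norm b powr p)"
        by (simp add: algebra_simps)
      moreover have "0 \<le> norm a powr p" "0 \<le> norm b powr p" by auto
      ultimately show ?thesis unfolding \<Phi>_def abs_le_iff by linarith
    qed
    fix F G :: "complex poly" assume G: "poly G 0 = 0"
    have i: "integrable circle_measure (\<lambda>x. U (poly F x * poly G x))"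
      by (intro integrable_circle_continuous continuous_on_compose2[OF U(1)] continuous_intros) auto
    have i2: "integrable circle_measure (\<lambda>x. \<Phi> (trig F G x) (poly F x))"
    proof (rule integrable_circle_continuous)
      have "continuous_on (sphere 0 1) (\<lambda>x. (\<lambda>(a, b). \<Phi> a b) (trig F G x, poly F x))"
        by (intro continuous_on_compose2[OF cont] continuous_intros continuous_on_trig) auto
      then show "continuous_on (sphere 0 1) (\<lambda>x. \<Phi> (trig F G x) (poly F x))" by simp
    qed
    have "0 \<le> D * circle_mean (\<lambda>x. U (poly F x * poly G x))" using D U(2)[OF G] by simp
    also have "\<dots> = circle_mean (\<lambda>x. D * U (poly F x * poly G x))" by simp
    also have "\<dots> \<le> circle_mean (\<lambda>x. \<Phi> (trig F G x) (poly F x))"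
    proof (intro integral_mono integrable_mult_right i i2)
      fix x
      show "D * U (poly F x * poly G x) \<le> \<Phi> (trig F G x) (poly F x)"
        using bound[of "poly F x" "poly G x"] by (simp add: \<Phi>_def mixed_def trig_def)
    qed
    finally show "0 \<le> circle_mean (\<lambda>x. \<Phi> (trig F G x) (poly F x))" .
  qed
  also have "\<dots> = K * circle_mean (\<lambda>x. mixed p r (f x) (riesz_plus p f x)) - pint p f"
    unfolding \<Phi>_def pint_def using integrable_mixed[OF r p f] Lp_circleD(2)[OF f] by simp
  finally show ?thesis by simp
qed

lemma reverse_bound_lower:
  assumes p: "1 < p" "p \<le> 2" and s: "p \<le> s" and f: "f \<in> Lp_circle p"
  shows "Lp_norm p f \<le> 2 powr (1 - 1 / s) * sin (pi / (2 * p)) * mixed_norm p s f"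
proof (rule Lp_norm_le_mixed[where r = p and K = "2 powr (p - 1) * sin (pi / (2 * p)) powr p"])
  have "0 < pi / (2 * p)" "pi / (2 * p) < pi / 2" using p by (auto simp: field_simps)
  then have sn: "sin (pi / (2 * p)) > 0" and cs: "cos (pi / (2 * p)) > 0" by (auto intro!: sin_gt_zero2 cos_gt_zero)
  then show "0 \<le> 2 powr (1 - 1 / s) * sin (pi / (2 * p))" by simp
  have "(2 powr (1 - 1 / s) * sin (pi / (2 * p))) powr p = 2 powr ((1 - 1 / s) * p) * sin (pi / (2 * p)) powr p"
    using sn by (simp add: powr_mult powr_powr)
  also have "(1 - 1 / s) * p = (p - 1) + (p / p - p / s)" using p by (simp add: algebra_simps)
  finally show "2 powr (p - 1) * sin (pi / (2 * p)) powr p * 2 powr (p / p - p / s) = (2 powr (1 - 1 / s) * sin (pi / (2 * p))) powr p"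
    by (simp add: powr_add)
  let ?U = "\<lambda>u. polar_fun (p / 2) (\<lambda>t. cos (p / 2 * t)) (- u)"
  show "pint p f \<le> 2 powr (p - 1) * sin (pi / (2 * p)) powr p * circle_mean (\<lambda>x. mixed p p (f x) (riesz_plus p f x))"
  proof (rule pint_le_mixed[where U = ?U and D = "2 powr p * sin (pi / (2 * p)) powr (p - 1) * cos (pi / (2 * p))"])
    have "continuous_on UNIV (polar_fun (p / 2) (\<lambda>t. cos (p / 2 * t)))"
      using p by (intro continuous_on_polar_fun continuous_intros) auto
    then show "continuous_on UNIV ?U" by (rule continuous_on_compose2) (auto intro!: continuous_intros)
    show "0 \<le> circle_mean (\<lambda>x. ?U (poly F x * poly G x))" if "poly G 0 = 0" for F G
      using cos_polar_mean_nonneg[of "p / 2" "- (F * G)"] that p by simp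
    show "norm (z + cnj w) powr p \<le> 2 powr (p - 1) * sin (pi / (2 * p)) powr p * (norm z powr p + norm w powr p) powr (p / p)
        - 2 powr p * sin (pi / (2 * p)) powr (p - 1) * cos (pi / (2 * p)) * ?U (z * w)" for z w
      using norm_add_cnj_powr_le_lower[OF p, of z w] p by simp
  qed (use p f cs in auto)
qed (use p s f in auto)

lemma reverse_bound_upper:
  assumes p: "2 < p" and s: "p / (p - 1) \<le> s" and f: "f \<in> Lp_circle p"
  shows "Lp_norm p f \<le> 2 powr (1 - 1 / s) * cos (pi / (2 * p)) * mixed_norm p s f"
proof (rule Lp_norm_le_mixed[where r = "p / (p - 1)" and K = "2 * cos (pi / (2 * p)) powr p"])
  have "0 < pi / (2 * p)" "pi / (2 * p) < pi / 2" using p by (auto simp: field_simps)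
  then have sn: "sin (pi / (2 * p)) > 0" and cs: "cos (pi / (2 * p)) > 0" by (auto intro!: sin_gt_zero2 cos_gt_zero)
  then show "0 \<le> 2 powr (1 - 1 / s) * cos (pi / (2 * p))" by simp
  have q: "p / (p / (p - 1)) = p - 1" using p by simp
  have "(2 powr (1 - 1 / s) * cos (pi / (2 * p))) powr p = 2 powr ((1 - 1 / s) * p) * cos (pi / (2 * p)) powr p"
    using cs by (simp add: powr_mult powr_powr)
  also have "(1 - 1 / s) * p = 1 + (p - 1 - p / s)" by (simp add: algebra_simps)
  finally show "2 * cos (pi / (2 * p)) powr p * 2 powr (p / (p / (p - 1)) - p / s) = (2 powr (1 - 1 / s) * cos (pi / (2 * p))) powr p"
    unfolding q powr_add by simp
  let ?U = "polar_fun (p / 2) (\<lambda>t. - cos (min (p / 2 * t) pi))"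
  show "pint p f \<le> 2 * cos (pi / (2 * p)) powr p * circle_mean (\<lambda>x. mixed p (p / (p - 1)) (f x) (riesz_plus p f x))"
  proof (rule pint_le_mixed[where U = ?U and D = "2 powr p * cos (pi / (2 * p)) powr (p - 1) * sin (pi / (2 * p))"])
    show "continuous_on UNIV ?U"
      using p by (intro continuous_on_polar_fun continuous_intros) auto
    show "0 \<le> circle_mean (\<lambda>x. ?U (poly F x * poly G x))" if "poly G 0 = 0" for F G
      using neg_cos_polar_mean_nonneg[of "p / 2" "F * G"] that p by simp
    show "norm (z + cnj w) powr p \<le> 2 * cos (pi / (2 * p)) powr p * (norm z powr (p / (p - 1)) + norm w powr (p / (p - 1))) powr (p / (p / (p - 1)))
        - 2 powr p * cos (pi / (2 * p)) powr (p - 1) * sin (pi / (2 * p)) * ?U (z * w)" for z w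
      unfolding q using norm_add_cnj_powr_le_upper[OF p, of z w] by simp
  qed (use p f sn in auto)
qed (use p s f in auto)

lemma reverse_bound_small_exponent:
  assumes p: "1 < p" and s: "0 < s" "s \<le> 1" and f: "f \<in> Lp_circle p"
  shows "Lp_norm p f \<le> mixed_norm p s f"
proof -
  have "pint p f \<le> circle_mean (\<lambda>z. mixed p s (f z) (riesz_plus p f z))"
    unfolding pint_def
  proof (intro integral_mono Lp_circleD(2)[OF f] integrable_mixed p f s(1))
    fix z
    let ?a = "f z" and ?b = "riesz_plus p f z"
    have "norm ?a \<le> norm ?b + norm (?a - ?b)" using norm_triangle_ineq[of ?b "?a - ?b"] by simp
    also have "\<dots> \<le> (norm ?b powr s + norm (?a - ?b) powr s) powr (1 / s)"
      using s by (intro add_le_powr_sum) auto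
    finally have "norm ?a powr p \<le> ((norm ?b powr s + norm (?a - ?b) powr s) powr (1 / s)) powr p"
      using p by (intro powr_mono2) auto
    then show "norm ?a powr p \<le> mixed p s ?a ?b" by (simp add: mixed_def powr_powr)
  qed
  then have "pint p f powr (1 / p) \<le> circle_mean (\<lambda>z. mixed p s (f z) (riesz_plus p f z)) powr (1 / p)"
    using p by (intro powr_mono2) (auto simp: pint_nonneg)
  then show ?thesis unfolding Lp_norm_mixed by (simp add: Lp_norm_def pint_def)
qed

section \<open>Sharpness\<close>

text \<open>A radius above \<open>1\<close> makes the Taylor coefficients absolutely summable;
  \<open>B\<close> is the sum of their moduli.\<close>

lemma taylor_polynomials:
  fixes u :: "complex \<Rightarrow> complex"
  assumes hol: "u holomorphic_on ball 0 \<rho>" and \<rho>: "\<rho> > 1"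
  obtains Q B where "\<And>n. poly (Q n) 0 = u 0" "\<And>n z. norm z = 1 \<Longrightarrow> norm (poly (Q n) z) \<le> B"
    "\<And>z. norm z = 1 \<Longrightarrow> (\<lambda>n. poly (Q n) z) \<longlonglongrightarrow> u z"
proof -
  define a where "a n = (deriv ^^ n) u 0 / fact n" for n
  have sums: "(\<lambda>n. a n * w ^ n) sums u w" if "norm w < \<rho>" for w
    using holomorphic_power_series[OF hol, of w] that by (simp add: a_def)
  have "summable (\<lambda>n. a n * of_real ((1 + \<rho>) / 2) ^ n)"
    using sums[of "of_real ((1 + \<rho>) / 2)"] \<rho> by (intro sums_summable) (auto simp del: of_real_divide of_real_add)
  then have "summable (\<lambda>n. norm (a n * 1 ^ n))"
    by (rule powser_insidea) (use \<rho> in \<open>simp del: of_real_divide of_real_add\<close>)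
  then have abs: "summable (\<lambda>n. norm (a n))" by simp
  define Q where "Q n = (\<Sum>k\<le>n. monom (a k) k)" for n
  have Q: "poly (Q n) z = (\<Sum>k\<le>n. a k * z ^ k)" for n z
    by (simp add: Q_def poly_sum poly_monom)
  have "a 0 = u 0" by (simp add: a_def)
  show thesis
  proof
    fix n
    have "(\<Sum>k\<le>n. a k * 0 ^ k) = (\<Sum>k\<in>{0}. a k * 0 ^ k)"
      by (rule sum.mono_neutral_right) auto
    then show "poly (Q n) 0 = u 0" by (simp add: Q \<open>a 0 = u 0\<close>)
    fix z :: complex assume z: "norm z = 1"
    have "norm (poly (Q n) z) \<le> (\<Sum>k\<le>n. norm (a k * z ^ k))" unfolding Q by (rule norm_sum)
    also have "\<dots> = (\<Sum>k\<le>n. norm (a k))" by (simp add: norm_mult norm_power z)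
    also have "\<dots> \<le> (\<Sum>k. norm (a k))" by (intro sum_le_suminf abs) auto
    finally show "norm (poly (Q n) z) \<le> (\<Sum>k. norm (a k))" .
  next
    fix z :: complex assume "norm z = 1"
    then have "(\<lambda>n. a n * z ^ n) sums u z" using sums \<rho> by simp
    then show "(\<lambda>n. poly (Q n) z) \<longlonglongrightarrow> u z" unfolding Q sums_def_le .
  qed
qed

lemma integral_circle_bounded_tendsto:
  fixes f :: "nat \<Rightarrow> complex \<Rightarrow> 'a::{banach, second_countable_topology}"
  assumes f: "\<And>n. continuous_on (sphere 0 1) (f n)" "\<And>n z. norm z = 1 \<Longrightarrow> norm (f n z) \<le> B"
    and g: "continuous_on (sphere 0 1) g" "\<And>z. norm z = 1 \<Longrightarrow> (\<lambda>n. f n z) \<longlonglongrightarrow> g z"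
  shows "(\<lambda>n. circle_mean (\<lambda>z. f n z)) \<longlonglongrightarrow> circle_mean (\<lambda>z. g z)"
  by (rule integral_dominated_convergence[where w = "\<lambda>_. B"])
     (auto intro!: borel_measurable_circle_continuous f g AE_I2 simp: space_circle_measure)

lemma holomorphic_on_imp_continuous_sphere:
  assumes "u holomorphic_on ball 0 \<rho>" "\<rho> > 1"
  shows "continuous_on (sphere 0 1) u"
  by (rule continuous_on_subset[OF holomorphic_on_imp_continuous_on[OF assms(1)]]) (use assms(2) in auto)

lemma integral_circle_holomorphic:
  assumes hol: "u holomorphic_on ball 0 \<rho>" and \<rho>: "\<rho> > 1"
  shows "circle_mean (\<lambda>z. u z) = u 0"
proof -
  obtain Q B where Q: "\<And>n. poly (Q n) 0 = u 0" "\<And>n z. norm z = 1 \<Longrightarrow> norm (poly (Q n) z) \<le> B"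
    "\<And>z. norm z = 1 \<Longrightarrow> (\<lambda>n. poly (Q n) z) \<longlonglongrightarrow> u z"
    by (rule taylor_polynomials[OF assms]) blast
  have "(\<lambda>n. circle_mean (\<lambda>z. poly (Q n) z)) \<longlonglongrightarrow> circle_mean (\<lambda>z. u z)"
    by (intro integral_circle_bounded_tendsto[where B = B] Q continuous_intros holomorphic_on_imp_continuous_sphere[OF assms])
  then have "(\<lambda>n::nat. u 0) \<longlonglongrightarrow> circle_mean (\<lambda>z. u z)" by (simp add: integral_circle_poly Q(1))
  then show ?thesis using LIMSEQ_const_iff by metis
qed

lemma poly_ineq_imp_holomorphic_ineq:
  assumes p: "p > 0"
    and ineq: "\<And>R. poly R 0 = 0 \<Longrightarrow> (circle_mean (\<lambda>z. \<bar>2 * Im (poly R z)\<bar> powr p)) \<le> \<kappa> * pint p (poly R)"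
    and hol: "u holomorphic_on ball 0 \<rho>" and \<rho>: "\<rho> > 1" and u0: "u 0 = 0"
  shows "circle_mean (\<lambda>z. \<bar>2 * Im (u z)\<bar> powr p) \<le> \<kappa> * pint p u"
proof -
  obtain Q B where Q: "\<And>n. poly (Q n) 0 = u 0" "\<And>n z. norm z = 1 \<Longrightarrow> norm (poly (Q n) z) \<le> B"
    "\<And>z. norm z = 1 \<Longrightarrow> (\<lambda>n. poly (Q n) z) \<longlonglongrightarrow> u z"
    by (rule taylor_polynomials[OF hol \<rho>]) blast
  have u: "continuous_on (sphere 0 1) u" by (rule holomorphic_on_imp_continuous_sphere[OF hol \<rho>])
  have cont: "continuous_on (sphere 0 1) (\<lambda>z. \<bar>2 * Im (v z)\<bar> powr p)"
    "continuous_on (sphere 0 1) (\<lambda>z. norm (v z) powr p)" if "continuous_on (sphere 0 1) v" for v :: "complex \<Rightarrow> complex"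
    using p by (intro continuous_on_powr' continuous_intros that; simp)+
  have "(\<lambda>n. circle_mean (\<lambda>z. \<bar>2 * Im (poly (Q n) z)\<bar> powr p)) \<longlonglongrightarrow> circle_mean (\<lambda>z. \<bar>2 * Im (u z)\<bar> powr p)"
  proof (rule integral_circle_bounded_tendsto[where B = "(2 * B) powr p"])
    fix n and z :: complex assume z: "norm z = 1"
    have "\<bar>2 * Im (poly (Q n) z)\<bar> \<le> 2 * B"
      using abs_Im_le_cmod[of "poly (Q n) z"] Q(2)[OF z, of n] by (simp add: abs_mult)
    then show "norm (\<bar>2 * Im (poly (Q n) z)\<bar> powr p) \<le> (2 * B) powr p"
      using p by (simp add: powr_mono2)
  next
    fix z :: complex assume z: "norm z = 1"
    show "(\<lambda>n. \<bar>2 * Im (poly (Q n) z)\<bar> powr p) \<longlonglongrightarrow> \<bar>2 * Im (u z)\<bar> powr p"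
      using p by (intro tendsto_powr' tendsto_intros Q(3)[OF z]) auto
  qed (intro cont continuous_intros u)+
  moreover have "(\<lambda>n. \<kappa> * pint p (poly (Q n))) \<longlonglongrightarrow> \<kappa> * pint p u"
    unfolding pint_def
  proof (intro tendsto_mult_left, rule integral_circle_bounded_tendsto[where B = "B powr p"])
    fix n and z :: complex assume z: "norm z = 1"
    show "norm (norm (poly (Q n) z) powr p) \<le> B powr p"
      using p Q(2)[OF z, of n] by (simp add: powr_mono2)
  next
    fix z :: complex assume z: "norm z = 1"
    show "(\<lambda>n. norm (poly (Q n) z) powr p) \<longlonglongrightarrow> norm (u z) powr p"
      using p by (intro tendsto_powr' tendsto_intros Q(3)[OF z]) auto
  qed (intro cont continuous_intros u)+
  ultimately show ?thesis
    by (rule LIMSEQ_le) (use ineq Q(1) u0 in auto)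
qed

text \<open>Near \<open>pi / 2\<close> continuity costs only \<open>\<epsilon>\<close>; elsewhere
  \<open>cos \<theta> \<ge> sin \<delta>\<close>, and a multiple of \<open>cos \<theta>\<close>
  outweighs the whole value. The correction has this form because \<open>|m| * cos \<theta>\<close>
  is the real part of a holomorphic function, whose mean is known.\<close>

lemma sin_powr_gap:
  fixes a p \<epsilon> :: real
  assumes p: "p > 0" and \<epsilon>: "\<epsilon> > 0"
  obtains C where "C \<ge> 0" "\<And>\<theta>. \<bar>\<theta>\<bar> \<le> pi / 2 \<Longrightarrow>
    \<bar>2 * sin (a * (pi / 2))\<bar> powr p - \<epsilon> - C * cos \<theta> \<le> \<bar>2 * sin (a * \<theta>)\<bar> powr p"
proof -
  define \<psi> where "\<psi> \<theta> = \<bar>2 * sin (a * \<theta>)\<bar> powr p" for \<theta>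
  have "continuous_on UNIV \<psi>" unfolding \<psi>_def using p by (intro continuous_on_powr' continuous_intros) auto
  then have "isCont \<psi> (pi / 2)" by (simp add: continuous_on_eq_continuous_at)
  then obtain d where d: "d > 0" "\<And>\<theta>. dist \<theta> (pi / 2) < d \<Longrightarrow> dist (\<psi> \<theta>) (\<psi> (pi / 2)) < \<epsilon>"
    using \<epsilon> unfolding continuous_at_eps_delta by (auto simp: dist_real_def)
  define \<delta> where "\<delta> = min d (pi / 2)"
  have \<delta>: "0 < \<delta>" "\<delta> \<le> d" "\<delta> \<le> pi / 2" using d by (auto simp: \<delta>_def)
  have sin\<delta>: "sin \<delta> > 0" using \<delta> by (intro sin_gt_zero) auto
  define C where "C = \<psi> (pi / 2) / sin \<delta>"
  have C: "C \<ge> 0" using sin\<delta> by (simp add: C_def \<psi>_def)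
  have nonneg: "\<psi> (pi / 2) - \<epsilon> - C * cos \<theta> \<le> \<psi> \<theta>" if \<theta>: "0 \<le> \<theta>" "\<theta> \<le> pi / 2" for \<theta>
  proof (cases "\<theta> > pi / 2 - \<delta>")
    case True
    then have "dist (\<psi> \<theta>) (\<psi> (pi / 2)) < \<epsilon>" using \<theta> \<delta> by (intro d(2)) (auto simp: dist_real_def)
    moreover have "C * cos \<theta> \<ge> 0" using C \<theta> by (intro mult_nonneg_nonneg cos_ge_zero) auto
    ultimately show ?thesis by (simp add: dist_real_def)
  next
    case False
    then have "cos (pi / 2 - \<delta>) \<le> cos \<theta>" using \<theta> \<delta> by (intro cos_monotone_0_pi_le) auto
    then have "sin \<delta> \<le> cos \<theta>" by (simp add: cos_diff)
    then have "C * sin \<delta> \<le> C * cos \<theta>" using C by (intro mult_left_mono)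
    then have "\<psi> (pi / 2) \<le> C * cos \<theta>" using sin\<delta> by (simp add: C_def)
    moreover have "\<psi> \<theta> \<ge> 0" by (simp add: \<psi>_def)
    ultimately show ?thesis using \<epsilon> by simp
  qed
  have "\<psi> (- \<theta>) = \<psi> \<theta>" for \<theta> by (simp add: \<psi>_def)
  then have "\<psi> (pi / 2) - \<epsilon> - C * cos \<theta> \<le> \<psi> \<theta>" if "\<bar>\<theta>\<bar> \<le> pi / 2" for \<theta>
    using nonneg[of "\<bar>\<theta>\<bar>"] that by (cases "\<theta> \<ge> 0") (auto simp: abs_if)
  then show thesis using that C by (simp add: \<psi>_def)
qed

section \<open>Test functions from the Cayley map of the disc onto the right half-plane\<close>

definition cayley :: "real \<Rightarrow> complex \<Rightarrow> complex" where
  "cayley r z = (1 + of_real r * z) / (1 - of_real r * z)"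

lemma cayley:
  assumes "norm (of_real r * z) < 1"
  shows "1 - of_real r * z \<noteq> 0" "Re (cayley r z) > 0"
proof -
  define w where "w = of_real r * z"
  have w: "norm w < 1" using assms by (simp add: w_def)
  then show ne: "1 - of_real r * z \<noteq> 0" unfolding w_def[symmetric] by auto
  have "1 - w \<noteq> 0" using ne by (simp add: w_def)
  then have "cnj (1 - w) \<noteq> 0" by (metis complex_cnj_zero_iff)
  then have "cayley r z = (1 + w) * cnj (1 - w) / ((1 - w) * cnj (1 - w))"
    unfolding cayley_def w_def[symmetric] by (rule mult_divide_mult_cancel_right[symmetric])
  also have "(1 - w) * cnj (1 - w) = of_real ((norm (1 - w))\<^sup>2)" by (rule complex_norm_square[symmetric])
  finally have "cayley r z = (1 + w) * cnj (1 - w) / of_real ((norm (1 - w))\<^sup>2)" .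
  then have "Re (cayley r z) = (1 - (norm w)\<^sup>2) / (norm (1 - w))\<^sup>2"
    by (simp add: Re_divide_of_real cmod_power2) (simp add: power2_eq_square algebra_simps)
  moreover have "(norm w)\<^sup>2 < 1" using w by (simp add: abs_square_less_1)
  ultimately show "Re (cayley r z) > 0" using ne by (simp add: w_def)
qed

text \<open>Near the pole the modulus at \<open>cis t\<close> is at least \<open>1 / (2 * t)\<close>
  for \<open>1 - r \<le> t \<le> 1 / 2\<close>. With \<open>1 - r = exp (- Y) / 2\<close> the
  integral of this is exactly \<open>Y / 2\<close>, and the normalisation divides by
  \<open>2 * pi\<close>.\<close>

lemma integral_norm_cayley_lower:
  assumes Y: "Y \<ge> 0"
  shows "Y / (4 * pi) \<le> circle_mean (\<lambda>x. norm (cayley (1 - exp (- Y) / 2) x))"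
proof -
  define r where "r = 1 - exp (- Y) / 2"
  have eY: "exp (- Y) \<le> 1" "exp (- Y) > 0" using Y by auto
  have r: "1 / 2 \<le> r" "r < 1" "1 - r = exp (- Y) / 2" using eY by (auto simp: r_def)
  have ne: "1 - of_real r * z \<noteq> 0" if "norm z = 1" for z :: complex
    using that r by (intro cayley(1)) (simp add: norm_mult)
  have cont: "continuous_on (sphere 0 1) (\<lambda>x. norm (cayley r x))"
    unfolding cayley_def using ne by (intro continuous_intros) auto
  have contc: "continuous_on A (\<lambda>t. norm (cayley r (cis t)))" for A
    by (rule continuous_on_compose2[OF cont]) (auto intro!: continuous_intros)
  have low: "1 / (2 * t) \<le> norm (cayley r (cis t))" if t: "1 - r \<le> t" "t \<le> 1 / 2" for t
  proof -
    have t0: "t > 0" using t r by simp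
    have "norm (cis t - 1) \<le> t" using iexp_approx1[of t 0] t0 by (simp add: cis_conv_exp)
    moreover have "1 - of_real r * cis t = of_real r * (1 - cis t) + of_real (1 - r)" by (simp add: algebra_simps)
    then have "norm (1 - of_real r * cis t) \<le> norm (of_real r * (1 - cis t)) + norm (of_real (1 - r) :: complex)"
      by (metis norm_triangle_ineq)
    moreover have "norm (of_real r * (1 - cis t)) \<le> 1 * norm (cis t - 1)"
      using r by (simp add: norm_mult norm_minus_commute mult_left_le_one_le)
    moreover have "norm (of_real (1 - r) :: complex) = 1 - r" using r by (simp del: of_real_diff)
    ultimately have den: "norm (1 - of_real r * cis t) \<le> 2 * t" using t by linarith
    have "2 = norm ((1 + of_real r * cis t) + (1 - of_real r * cis t))" by simp
    also have "\<dots> \<le> norm (1 + of_real r * cis t) + norm (1 - of_real r * cis t)" by (rule norm_triangle_ineq)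
    finally have num: "1 \<le> norm (1 + of_real r * cis t)" using den t by simp
    have "1 / (2 * t) \<le> norm (1 + of_real r * cis t) / norm (1 - of_real r * cis t)"
      using num den t0 ne[of "cis t"] by (intro frac_le) auto
    then show ?thesis by (simp add: cayley_def norm_divide)
  qed
  have "(\<integral>t. indicator {1 - r..1 / 2} t *\<^sub>R (1 / (2 * t)) \<partial>lborel) = ln (1 / 2) / 2 - ln (1 - r) / 2"
  proof (rule integral_FTC_Icc)
    fix t assume "1 - r \<le> t" "t \<le> 1 / 2"
    then have "t > 0" using r by simp
    then show "((\<lambda>t. ln t / 2) has_vector_derivative 1 / (2 * t)) (at t within {1 - r..1 / 2})"
      by (auto intro!: derivative_eq_intros simp: has_real_derivative_iff_has_vector_derivative[symmetric] field_simps)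
  qed (use r Y in \<open>auto intro!: continuous_intros\<close>)
  also have "ln (1 / 2) / 2 - ln (1 - r) / 2 = Y / 2"
    unfolding r(3) by (simp add: ln_div field_simps)
  finally have I: "(\<integral>t. indicator {1 - r..1 / 2} t *\<^sub>R (1 / (2 * t)) \<partial>lborel) = Y / 2" .
  have "Y / 2 \<le> (LBINT t:{0..2*pi}. norm (cayley r (cis t)))"
    unfolding I[symmetric] set_lebesgue_integral_def
  proof (rule integral_mono)
    show "integrable lborel (\<lambda>t. indicator {1 - r..1 / 2} t *\<^sub>R (1 / (2 * t)))"
      by (rule borel_integrable_compact) (use r in \<open>auto intro!: continuous_intros\<close>)
    show "integrable lborel (\<lambda>t. indicator {0..2*pi} t *\<^sub>R norm (cayley r (cis t)))"
      by (rule borel_integrable_compact) (auto intro!: contc)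
    fix t :: real
    have "1 / 2 \<le> 2 * pi" using pi_gt3 by simp
    then show "indicator {1 - r..1 / 2} t *\<^sub>R (1 / (2 * t)) \<le> indicator {0..2*pi} t *\<^sub>R norm (cayley r (cis t))"
      using low[of t] r by (auto simp: indicator_def)
  qed
  moreover have "circle_mean (\<lambda>x. norm (cayley r x)) = 1 / (2 * pi) * (LBINT t:{0..2*pi}. norm (cayley r (cis t)))"
    by (subst integral_circle_measure[OF borel_measurable_circle_continuous[OF cont]]) simp
  ultimately show ?thesis unfolding r_def[symmetric] by (simp add: field_simps)
qed

text \<open>Test functions \<open>h = cayley r powr (1 / p)\<close>: where the argument of \<open>cayley r\<close> is far from
  \<open>\<plusminus>\<pi>/2\<close>, \<open>|h|\<^sup>p = |cayley r|\<close> is controlled by \<open>Re (cayley r)\<close>, whose mean is \<open>1\<close>, while the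
  mean of \<open>|cayley r|\<close> is unbounded as \<open>r\<close> tends to \<open>1\<close>.\<close>

lemma im_ratio_lower:
  fixes p \<kappa> :: real
  assumes p: "p > 1" and \<kappa>: "\<kappa> \<ge> 0"
    and ineq: "\<And>R. poly R 0 = 0 \<Longrightarrow> (circle_mean (\<lambda>x. \<bar>2 * Im (poly R x)\<bar> powr p)) \<le> \<kappa> * pint p (poly R)"
  shows "\<bar>2 * sin (pi / (2 * p))\<bar> powr p \<le> \<kappa>"
proof (rule ccontr)
  define S where "S = \<bar>2 * sin (pi / (2 * p))\<bar> powr p"
  define a where "a = 1 / p"
  have S_a: "S = \<bar>2 * sin (a * (pi / 2))\<bar> powr p" by (simp add: S_def a_def mult.commute)
  assume "\<not> \<bar>2 * sin (pi / (2 * p))\<bar> powr p \<le> \<kappa>"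
  then have less: "\<kappa> < S" by (simp add: S_def)
  define \<epsilon> where "\<epsilon> = (S - \<kappa>) / 2"
  have \<epsilon>: "\<epsilon> > 0" using less by (simp add: \<epsilon>_def)
  obtain C where C: "C \<ge> 0" "\<And>\<theta>. \<bar>\<theta>\<bar> \<le> pi / 2 \<Longrightarrow> S - \<epsilon> - C * cos \<theta> \<le> \<bar>2 * sin (a * \<theta>)\<bar> powr p"
    unfolding S_a by (rule sin_powr_gap[of p \<epsilon> a]) (use p \<epsilon> in auto)
  \<comment> \<open>\<open>M\<close> is the size of \<open>|h|\<close> above which subtracting the
    constant \<open>1\<close> costs only a factor \<open>1 + 1 / M\<close>. It is taken so large
    that the supposed gap between \<open>\<kappa>\<close> and \<open>S\<close> survives.\<close>
  have "(\<lambda>n. \<kappa> * (1 + inverse (real (Suc n))) powr p) \<longlonglongrightarrow> \<kappa> * (1 + 0) powr p"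
    by (intro tendsto_intros LIMSEQ_inverse_real_of_nat) auto
  then have "\<forall>\<^sub>F n in sequentially. \<kappa> * (1 + inverse (real (Suc n))) powr p < S - \<epsilon>"
    by (rule order_tendstoD(2)) (use less in \<open>simp add: \<epsilon>_def field_simps\<close>)
  then obtain n where "\<kappa> * (1 + inverse (real (Suc n))) powr p < S - \<epsilon>"
    by (auto simp: eventually_sequentially)
  then obtain M :: real where M: "M > 0" "\<kappa> * (1 + 1 / M) powr p < S - \<epsilon>"
    using that[of "real (Suc n)"] by (auto simp: inverse_eq_divide)
  define c where "c = S - \<epsilon> - \<kappa> * (1 + 1 / M) powr p"
  have c: "c > 0" using M by (simp add: c_def)
  \<comment> \<open>The coefficient \<open>c\<close> is positive and the right-hand side does not
    depend on \<open>r\<close>, so the mean of \<open>|cayley r|\<close> would stay bounded.\<close>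
  have J_le: "c * circle_mean (\<lambda>x. norm (cayley r x)) \<le> C + \<kappa> * (M + 1) powr p" if r: "0 < r" "r < 1" for r
  proof -
    let ?m = "cayley r"
    define h where "h z = exp (of_real a * Ln (?m z))" for z :: complex
    have in_disc: "norm (of_real r * z) < 1" if "z \<in> ball 0 (1 / r)" for z :: complex
      using that r by (simp add: norm_mult field_simps)
    have \<rho>: "1 / r > 1" using r by simp
    have m_hol: "?m holomorphic_on ball 0 (1 / r)"
      unfolding cayley_def using cayley(1)[OF in_disc] by (intro holomorphic_intros) auto
    have h_hol: "h holomorphic_on ball 0 (1 / r)"
      unfolding h_def
    proof (intro holomorphic_intros m_hol)
      fix z :: complex assume "z \<in> ball 0 (1 / r)"
      then have "Re (?m z) > 0" using cayley(2)[OF in_disc] by blast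
      then show "?m z \<notin> \<real>\<^sub>\<le>\<^sub>0" by (auto simp: complex_nonpos_Reals_iff)
    qed
    have m_cont: "continuous_on (sphere 0 1) ?m" and h_cont: "continuous_on (sphere 0 1) h"
      using holomorphic_on_imp_continuous_sphere[OF _ \<rho>] m_hol h_hol by auto
    have pos: "Re (?m x) > 0" "?m x \<noteq> 0" if "norm x = 1" for x :: complex
    proof -
      show "Re (?m x) > 0" using that r by (intro cayley(2)) (simp add: norm_mult)
      then show "?m x \<noteq> 0" by auto
    qed
    have norm_h: "norm (h x) powr p = norm (?m x)" if "norm x = 1" for x :: complex
    proof -
      have "norm (h x) = norm (?m x) powr a"
        using pos(2)[OF that] by (simp add: h_def powr_def)
      then show ?thesis using p by (simp add: powr_powr a_def)
    qed
    have lower: "(S - \<epsilon>) * norm (?m x) - C * Re (?m x) \<le> \<bar>2 * Im (h x)\<bar> powr p" if x: "norm x = 1" for x :: complex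
    proof -
      define \<theta> where "\<theta> = Im (Ln (?m x))"
      have "\<bar>\<theta>\<bar> \<le> pi / 2" using pos[OF x] Re_Ln_pos_lt_imp[of "?m x"] by (simp add: \<theta>_def)
      then have "norm (?m x) * (S - \<epsilon> - C * cos \<theta>) \<le> norm (?m x) * \<bar>2 * sin (a * \<theta>)\<bar> powr p"
        by (intro mult_left_mono C(2)) auto
      also have "\<dots> = (norm (?m x) powr a) powr p * \<bar>2 * sin (a * \<theta>)\<bar> powr p"
        using p by (simp add: powr_powr a_def)
      also have "\<dots> = \<bar>2 * Im (h x)\<bar> powr p"
      proof -
        have "Im (h x) = norm (?m x) powr a * sin (a * \<theta>)"
          using pos(2)[OF x] by (simp add: h_def Im_exp powr_def \<theta>_def)
        then have "\<bar>2 * Im (h x)\<bar> = norm (?m x) powr a * \<bar>2 * sin (a * \<theta>)\<bar>" by (simp add: abs_mult)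
        then show ?thesis by (simp add: powr_mult)
      qed
      finally have "norm (?m x) * (S - \<epsilon> - C * cos \<theta>) \<le> \<bar>2 * Im (h x)\<bar> powr p" .
      moreover have "Re (?m x) = norm (?m x) * cos \<theta>"
        unfolding \<theta>_def using pos(2)[OF x] by (metis Re_exp exp_Ln norm_exp_eq_Re)
      ultimately show ?thesis by (simp add: algebra_simps)
    qed
    have upper: "norm (h x - 1) powr p \<le> (1 + 1 / M) powr p * norm (?m x) + (M + 1) powr p" if x: "norm x = 1" for x :: complex
    proof -
      have tri: "norm (h x - 1) \<le> norm (h x) + 1" using norm_triangle_ineq4[of "h x" 1] by simp
      show ?thesis
      proof (cases "norm (h x) \<le> M")
        case True
        then have "norm (h x - 1) powr p \<le> (M + 1) powr p" using tri p by (intro powr_mono2) auto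
        then show ?thesis by (simp add: add_increasing)
      next
        case False
        then have "1 \<le> 1 / M * norm (h x)" using M(1) by (simp add: field_simps)
        then have "norm (h x - 1) \<le> (1 + 1 / M) * norm (h x)" using tri by (simp add: distrib_right)
        then have "norm (h x - 1) powr p \<le> ((1 + 1 / M) * norm (h x)) powr p" using p by (intro powr_mono2) auto
        also have "\<dots> = (1 + 1 / M) powr p * norm (?m x)" using M(1) norm_h[OF x] by (simp add: powr_mult)
        finally show ?thesis by (simp add: add_increasing2)
      qed
    qed
    let ?J = "circle_mean (\<lambda>x. norm (?m x))"
    have iJ: "integrable circle_measure (\<lambda>x. norm (?m x))"
      by (intro integrable_circle_continuous continuous_intros m_cont)
    have "circle_mean (\<lambda>x. Re (?m x)) = Re (circle_mean (\<lambda>x. ?m x))"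
      by (intro integral_Re integrable_circle_continuous m_cont)
    also have "circle_mean (\<lambda>x. ?m x) = 1"
      using integral_circle_holomorphic[OF m_hol \<rho>] by (simp add: cayley_def)
    finally have Re1: "circle_mean (\<lambda>x. Re (?m x)) = 1" by simp
    have iRe: "integrable circle_measure (\<lambda>x. Re (?m x))"
      by (intro integrable_circle_continuous continuous_intros m_cont)
    have "(S - \<epsilon>) * ?J - C = circle_mean (\<lambda>x. (S - \<epsilon>) * norm (?m x) - C * Re (?m x))"
      using iJ iRe Re1 by simp
    also have "\<dots> \<le> circle_mean (\<lambda>x. \<bar>2 * Im (h x)\<bar> powr p)"
    proof (rule integral_mono)
      show "integrable circle_measure (\<lambda>x. \<bar>2 * Im (h x)\<bar> powr p)"
        using p by (intro integrable_circle_continuous continuous_on_powr' continuous_intros h_cont) auto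
    qed (use iJ iRe lower in \<open>auto simp: space_circle_measure\<close>)
    \<comment> \<open>Since \<open>h 0 = 1\<close>, subtracting \<open>1\<close> meets the
      normalisation at the origin and leaves the imaginary part alone.\<close>
    also have "\<dots> = circle_mean (\<lambda>x. \<bar>2 * Im (h x - 1)\<bar> powr p)" by simp
    also have "\<dots> \<le> \<kappa> * pint p (\<lambda>x. h x - 1)"
    proof (rule poly_ineq_imp_holomorphic_ineq[OF _ ineq _ \<rho>])
      show "(\<lambda>x. h x - 1) holomorphic_on ball 0 (1 / r)" by (intro holomorphic_intros h_hol)
      show "h 0 - 1 = 0" by (simp add: h_def cayley_def)
    qed (use p in auto)
    also have "\<dots> \<le> \<kappa> * ((1 + 1 / M) powr p * ?J + (M + 1) powr p)"
    proof (intro mult_left_mono \<kappa>)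
      have "pint p (\<lambda>x. h x - 1) \<le> circle_mean (\<lambda>x. (1 + 1 / M) powr p * norm (?m x) + (M + 1) powr p)"
        unfolding pint_def
      proof (rule integral_mono)
        show "integrable circle_measure (\<lambda>x. norm (h x - 1) powr p)"
          using p by (intro integrable_circle_continuous continuous_on_powr' continuous_intros h_cont) auto
      qed (use iJ upper in \<open>auto simp: space_circle_measure\<close>)
      also have "\<dots> = (1 + 1 / M) powr p * ?J + (M + 1) powr p"
        using iJ circle.prob_space by simp
      finally show "pint p (\<lambda>x. h x - 1) \<le> (1 + 1 / M) powr p * ?J + (M + 1) powr p" .
    qed
    finally show ?thesis by (simp add: c_def algebra_simps)
  qed
  define X where "X = C + \<kappa> * (M + 1) powr p"
  have X: "X \<ge> 0" using C(1) \<kappa> by (simp add: X_def)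
  define Y where "Y = 4 * pi * ((X + 1) / c)"
  have Y: "Y \<ge> 0" using X c by (simp add: Y_def)
  have "c * (Y / (4 * pi)) \<le> c * circle_mean (\<lambda>x. norm (cayley (1 - exp (- Y) / 2) x))"
    using c integral_norm_cayley_lower[OF Y] by (intro mult_left_mono) auto
  also have "\<dots> \<le> X"
  proof -
    have "exp (- Y) \<le> 1" using Y by simp
    moreover have "exp (- Y) > 0" by simp
    ultimately have "0 < 1 - exp (- Y) / 2" "1 - exp (- Y) / 2 < 1" by linarith+
    then show ?thesis unfolding X_def by (rule J_le)
  qed
  finally show False using c by (simp add: Y_def)
qed

text \<open>For \<open>f = R - cnj R\<close> with \<open>R 0 = 0\<close> both projections have
  modulus \<open>|R|\<close> and \<open>|f| = |2 * Im R|\<close>. An inequality with constant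
  \<open>C\<close> thus becomes a bound of \<open>Im R\<close> by \<open>R\<close> with constant
  \<open>\<kappa>\<close>, and \<open>im_ratio_lower\<close> limits \<open>\<kappa>\<close> from
  below.\<close>

lemma reverse_bound_sharp:
  assumes p: "1 < p" "p \<le> 2" and s: "0 < s" and C: "C < 2 powr (1 - 1 / s) * sin (pi / (2 * p))"
  shows "\<not> (\<forall>f \<in> Lp_circle p. Lp_norm p f \<le> C * mixed_norm p s f)"
proof
  assume H: "\<forall>f \<in> Lp_circle p. Lp_norm p f \<le> C * mixed_norm p s f"
  have p0: "p > 0" using p by simp
  \<comment> \<open>Taking the maximum with \<open>0\<close> allows \<open>p\<close>-th powers even
    when \<open>C\<close> is negative.\<close>
  define C' where "C' = max C 0"
  define \<kappa> where "\<kappa> = C' powr p * 2 powr (p / s)"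
  have "0 < pi / (2 * p)" "pi / (2 * p) < pi / 2" using p by (auto simp: field_simps)
  then have sn: "sin (pi / (2 * p)) > 0" by (intro sin_gt_zero2)
  have "\<bar>2 * sin (pi / (2 * p))\<bar> powr p \<le> \<kappa>"
  proof (rule im_ratio_lower[OF p(1)])
    show "\<kappa> \<ge> 0" by (simp add: \<kappa>_def)
    fix R :: "complex poly" assume R: "poly R 0 = 0"
    define f where "f = trig R (- R)"
    have f: "f \<in> Lp_circle p" unfolding f_def using p0 by (rule Lp_circle_trig)
    have f_norm: "norm (f z) = \<bar>2 * Im (poly R z)\<bar>" for z
    proof -
      have "f z = of_real (2 * Im (poly R z)) * \<i>" by (simp add: f_def trig_def complex_eq_iff)
      then show ?thesis by (simp add: norm_mult del: of_real_mult)
    qed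
    have RL: "poly R \<in> Lp_circle p" by (intro Lp_circle_continuous continuous_intros p0)
    obtain K where "\<And>f F G. f \<in> Lp_circle p \<Longrightarrow> poly G 0 = 0 \<Longrightarrow>
      pint p (\<lambda>z. riesz_plus p f z - poly F z) \<le> K * pint p (\<lambda>z. f z - trig F G z)"
      by (rule riesz_plus_approx[OF p(1)]) blast
    \<comment> \<open>The approximating polynomial is \<open>f\<close> itself, so the right-hand
      side is \<open>0\<close> and the representative is known almost everywhere.\<close>
    from this[OF f, of "- R" R] have "pint p (\<lambda>z. riesz_plus p f z - poly R z) \<le> 0"
      using R p0 by (simp add: f_def pint_def)
    then have "pint p (\<lambda>z. riesz_plus p f z - poly R z) = 0" using pint_nonneg by (intro antisym)
    then have AE: "AE z in circle_measure. riesz_plus p f z = poly R z"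
      unfolding pint_def
      using integral_nonneg_eq_0_iff_AE[OF Lp_circleD(2)[OF Lp_circle_diff(1)[OF p0 riesz_plus(1)[OF p(1) f] RL]]]
      by simp
    have mix: "circle_mean (\<lambda>z. mixed p s (f z) (riesz_plus p f z)) = 2 powr (p / s) * pint p (poly R)"
    proof -
      have "circle_mean (\<lambda>z. mixed p s (f z) (riesz_plus p f z)) = circle_mean (\<lambda>z. 2 powr (p / s) * norm (poly R z) powr p)"
      proof (rule integral_cong_AE)
        show "AE z in circle_measure. mixed p s (f z) (riesz_plus p f z) = 2 powr (p / s) * norm (poly R z) powr p"
          using AE
        proof eventually_elim
          case (elim z)
          have "norm (f z - poly R z) = norm (poly R z)" by (simp add: f_def trig_def)
          then have "mixed p s (f z) (riesz_plus p f z) = (2 * norm (poly R z) powr s) powr (p / s)"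
            by (simp add: mixed_def elim)
          then show ?case using s by (simp add: powr_mult powr_powr)
        qed
        show "(\<lambda>z. mixed p s (f z) (riesz_plus p f z)) \<in> borel_measurable circle_measure"
          using integrable_mixed[OF s p(1) f] by (rule borel_measurable_integrable)
        show "(\<lambda>z. 2 powr (p / s) * norm (poly R z) powr p) \<in> borel_measurable circle_measure"
          using borel_measurable_integrable[OF Lp_circleD(2)[OF RL]] by simp
      qed
      then show ?thesis by (simp add: pint_def)
    qed
    have "Lp_norm p f \<le> C * (2 powr (p / s) * pint p (poly R)) powr (1 / p)"
      using bspec[OF H f] unfolding Lp_norm_mixed mix .
    also have "\<dots> \<le> C' * (2 powr (p / s) * pint p (poly R)) powr (1 / p)"
      by (intro mult_right_mono) (auto simp: C'_def)
    finally have "pint p f powr (1 / p) \<le> C' * (2 powr (p / s) * pint p (poly R)) powr (1 / p)"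
      by (simp add: Lp_norm_def pint_def)
    then have "(pint p f powr (1 / p)) powr p \<le> (C' * (2 powr (p / s) * pint p (poly R)) powr (1 / p)) powr p"
      using p0 by (intro powr_mono2) auto
    then have "pint p f \<le> \<kappa> * pint p (poly R)"
      using p0 by (simp add: \<kappa>_def powr_mult powr_powr pint_nonneg C'_def mult_ac)
    then show "circle_mean (\<lambda>z. \<bar>2 * Im (poly R z)\<bar> powr p) \<le> \<kappa> * pint p (poly R)"
      by (simp add: pint_def f_norm)
  qed
  then have "(\<bar>2 * sin (pi / (2 * p))\<bar> powr p) powr (1 / p) \<le> \<kappa> powr (1 / p)"
    using p0 by (intro powr_mono2) auto
  then have "2 * sin (pi / (2 * p)) \<le> C' * 2 powr (1 / s)"
    using p0 sn by (simp add: \<kappa>_def powr_mult powr_powr C'_def)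
  then have "2 powr (1 - 1 / s) * sin (pi / (2 * p)) \<le> C'" by (simp add: powr_diff field_simps)
  moreover have "2 powr (1 - 1 / s) * sin (pi / (2 * p)) > 0" using sn by simp
  ultimately show False using C by (auto simp: C'_def max_def split: if_splits)
qed

theorem theorem1p1:
  "(\<forall>p s :: real. 1 < p \<and> p \<le> 2 \<and> p \<le> s \<longrightarrow>
      (\<forall>f \<in> Lp_circle p.
         Lp_norm p f \<le> 2 powr (1 - 1 / s) * sin (pi / (2 * p)) *
           Lp_norm p (\<lambda>\<zeta>. (norm (riesz_plus p f \<zeta>) powr s + norm (riesz_minus p f \<zeta>) powr s) powr (1 / s))) \<and>
      (\<forall>C :: real. C < 2 powr (1 - 1 / s) * sin (pi / (2 * p)) \<longrightarrow>
         \<not> (\<forall>f \<in> Lp_circle p.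
              Lp_norm p f \<le> C *
                Lp_norm p (\<lambda>\<zeta>. (norm (riesz_plus p f \<zeta>) powr s + norm (riesz_minus p f \<zeta>) powr s) powr (1 / s)))))
   \<and>
   (\<forall>p s :: real. 4 \<le> p \<and> p / (p - 1) \<le> s \<longrightarrow>
      (\<forall>f \<in> Lp_circle p.
         Lp_norm p f \<le> 2 powr (1 - 1 / s) * cos (pi / (2 * p)) *
           Lp_norm p (\<lambda>\<zeta>. (norm (riesz_plus p f \<zeta>) powr s + norm (riesz_minus p f \<zeta>) powr s) powr (1 / s))))
   \<and>
   (\<forall>p s :: real. 0 < s \<and> s \<le> 1 \<and> 1 < p \<longrightarrow>
      (\<forall>f \<in> Lp_circle p.
         Lp_norm p f \<le>
           Lp_norm p (\<lambda>\<zeta>. (norm (riesz_plus p f \<zeta>) powr s + norm (riesz_minus p f \<zeta>) powr s) powr (1 / s))))"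
proof (intro conjI allI impI ballI)
  fix p s :: real and f assume "1 < p \<and> p \<le> 2 \<and> p \<le> s" "f \<in> Lp_circle p"
  then show "Lp_norm p f \<le> 2 powr (1 - 1 / s) * sin (pi / (2 * p)) * mixed_norm p s f"
    by (intro reverse_bound_lower) auto
next
  fix p s C :: real assume "1 < p \<and> p \<le> 2 \<and> p \<le> s" "C < 2 powr (1 - 1 / s) * sin (pi / (2 * p))"
  then show "\<not> (\<forall>f \<in> Lp_circle p. Lp_norm p f \<le> C * mixed_norm p s f)"
    by (intro reverse_bound_sharp) auto
next
  fix p s :: real and f assume "4 \<le> p \<and> p / (p - 1) \<le> s" "f \<in> Lp_circle p"
  then show "Lp_norm p f \<le> 2 powr (1 - 1 / s) * cos (pi / (2 * p)) * mixed_norm p s f"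
    by (intro reverse_bound_upper) auto
next
  fix p s :: real and f assume "0 < s \<and> s \<le> 1 \<and> 1 < p" "f \<in> Lp_circle p"
  then show "Lp_norm p f \<le> mixed_norm p s f"
    by (intro reverse_bound_small_exponent) auto
qed

end
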